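(* Let $n\ge2$ be an integer and let $\alpha\in\mathbb C$ with $\alpha\notin -n/2-\mathbb Z^+$. If $f\in\mathscr E(\mathbb R^n)$, then $u(x,t)=(f*m_\alpha^t)(x)$ is the unique function $u\in C^\infty(\mathbb R^n\times\mathbb R)$, even in $t$, that solves the Cauchy problem $$\Delta_x u=\frac{\partial^2u}{\partial t^2}+\frac{n-1+2\alpha}{t}\,\frac{\partial u}{\partial t}\quad(t>0),\qquad \lim_{t\to0^+}u(x,t)=f(x),\qquad \lim_{t\to0^+}\frac{\partial u}{\partial t}(x,t)=0 .$$
   Context: $\mathbb Z^+=\{0,1,2,\dots\}$. $\mathscr E(\mathbb R^n)$ is the space of complex-valued $C^\infty$ functions on $\mathbb R^n$ and $\mathscr E'(\mathbb R^n)$ the space of compactly supported distributions on $\mathbb R^n$; for $f\in\mathscr E(\mathbb R^n)$, $\mu\in\mathscr E'(\mathbb R^n)$, $(f*\mu)(x)$ is the value of $\mu$ on the function $y\mapsto f(x-y)$. The distributions $m_\alpha^t$: for $t>0$ and $\mathrm{Re}\,\alpha>0$, $m_\alpha^t\in\mathscr E'(\mathbb R^n)$ is given by $$m_\alpha^t(\varphi)=\frac{\Gamma(\alpha+n/2)}{\pi^{n/2}\Gamma(\alpha)}\,t^{2-n-2\alpha}\int_{\|x\|\le t}\varphi(x)\,(t^2-\|x\|^2)^{\alpha-1}\,dx,\qquad \varphi\in\mathscr E(\mathbb R^n).$$ For fixed $t$ and $\varphi$, the right side extends to a meromorphic function of $\alpha\in\mathbb C$ with poles only in $-n/2-\mathbb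 Z^+$; this analytic continuation defines $m_\alpha^t\in\mathscr E'(\mathbb R^n)$ for all $\alpha\notin -n/2-\mathbb Z^+$. For fixed such $\alpha$ and fixed $\varphi$, $t\mapsto m_\alpha^t(\varphi)$ extends to an even $C^\infty$ function on $\mathbb R$ with $m_\alpha^0(\varphi)=\varphi(0)$, which defines $m_\alpha^t$ for all $t\in\mathbb R$. *)

theory Defs
  imports "HOL-Complex_Analysis.Complex_Analysis"
begin

definition dir_deriv ::
    "'a::real_normed_vector \<Rightarrow> ('a \<Rightarrow> 'b::real_normed_vector) \<Rightarrow> 'a \<Rightarrow> 'b" where
  "dir_deriv v f x = frechet_derivative f (at x) v"

primrec k_smooth ::
    "nat \<Rightarrow> ('a::euclidean_space \<Rightarrow> 'b::real_normed_vector) \<Rightarrow> bool" where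
  "k_smooth 0 f \<longleftrightarrow> continuous_on UNIV f"
| "k_smooth (Suc k) f \<longleftrightarrow>
     (\<forall>x. f differentiable (at x)) \<and> (\<forall>v. k_smooth k (dir_deriv v f))"

definition smooth :: "('a::euclidean_space \<Rightarrow> 'b::real_normed_vector) \<Rightarrow> bool" where
  "smooth f \<longleftrightarrow> (\<forall>k. k_smooth k f)"

definition laplacian :: "('a::euclidean_space \<Rightarrow> complex) \<Rightarrow> 'a \<Rightarrow> complex" where
  "laplacian f x = (\<Sum>b\<in>Basis. dir_deriv b (dir_deriv b f) x)"

definition exceptional :: "'n::finite itself \<Rightarrow> complex set" where
  "exceptional _ = {- of_nat CARD('n) / 2 - of_nat k |k :: nat. True}"

text \<open>
  The integral formula, meaningful for \<open>t > 0\<close> and \<open>Re \<alpha> > 0\<close>. Since \<open>0 powr z = 0\<close>, the integrand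
  vanishes on the sphere \<open>norm x = t\<close>, which is a null set.
\<close>

definition m_integral ::
    "complex \<Rightarrow> real \<Rightarrow> (real ^ 'n \<Rightarrow> complex) \<Rightarrow> complex" where
  "m_integral \<alpha> t \<phi> =
     Gamma (\<alpha> + of_nat CARD('n) / 2) / (of_real (pi powr (real CARD('n) / 2)) * Gamma \<alpha>)
     * of_real t powr (2 - of_nat CARD('n) - 2 * \<alpha>)
     * (LINT x:cball 0 t|lborel. \<phi> x * of_real (t\<^sup>2 - (norm x)\<^sup>2) powr (\<alpha> - 1))"

text \<open>
  Analytic continuation in \<open>\<alpha>\<close> for fixed \<open>t > 0\<close> and \<open>\<phi>\<close>. The complement of the exceptional set is
  connected, so any two admissible \<open>F\<close> agree there. The condition of holomorphy is stated separately
  because \<open>meromorphic_on\<close> constrains \<open>F\<close> at individual points only up to a removable singularity.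
\<close>

definition m_pos ::
    "complex \<Rightarrow> real \<Rightarrow> (real ^ 'n \<Rightarrow> complex) \<Rightarrow> complex" where
  "m_pos \<alpha> t \<phi> =
     (THE z. \<exists>F. F meromorphic_on UNIV \<and> F holomorphic_on - exceptional TYPE('n) \<and>
                 (\<forall>\<beta>. Re \<beta> > 0 \<longrightarrow> F \<beta> = m_integral \<beta> t \<phi>) \<and> z = F \<alpha>)"

text \<open>
  The even extension in \<open>t\<close> with value \<open>\<phi> 0\<close> at \<open>t = 0\<close>. These requirements already fix every value,
  so smoothness in \<open>t\<close> is not part of the definition.
\<close>

definition m_dist ::
    "complex \<Rightarrow> real \<Rightarrow> (real ^ 'n \<Rightarrow> complex) \<Rightarrow> complex" where
  "m_dist \<alpha> t \<phi> = (if t = 0 then \<phi> 0 else m_pos \<alpha> \<bar>t\<bar> \<phi>)"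

definition convolution ::
    "('a::ab_group_add \<Rightarrow> complex) \<Rightarrow> (('a \<Rightarrow> complex) \<Rightarrow> complex) \<Rightarrow> 'a \<Rightarrow> complex" where
  "convolution f \<mu> x = \<mu> (\<lambda>y. f (x - y))"

definition time_deriv :: "('a \<times> real \<Rightarrow> complex) \<Rightarrow> 'a \<times> real \<Rightarrow> complex" where
  "time_deriv u = (\<lambda>(x, t). vector_derivative (\<lambda>s. u (x, s)) (at t))"

definition solves_cauchy ::
    "complex \<Rightarrow> (real ^ 'n \<Rightarrow> complex) \<Rightarrow> ((real ^ 'n) \<times> real \<Rightarrow> complex) \<Rightarrow> bool" where
  "solves_cauchy \<alpha> f u \<longleftrightarrow>
     (\<forall>x t. t > 0 \<longrightarrow>
        laplacian (\<lambda>y. u (y, t)) x =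
          time_deriv (time_deriv u) (x, t)
          + (of_nat CARD('n) - 1 + 2 * \<alpha>) / of_real t * time_deriv u (x, t)) \<and>
     (\<forall>x. ((\<lambda>t. u (x, t)) \<longlongrightarrow> f x) (at_right 0)) \<and>
     (\<forall>x. ((\<lambda>t. time_deriv u (x, t)) \<longlongrightarrow> 0) (at_right 0))"

definition even_in_time :: "('a \<times> real \<Rightarrow> complex) \<Rightarrow> bool" where
  "even_in_time u \<longleftrightarrow> (\<forall>x t. u (x, - t) = u (x, t))"

end

(*
  The means are continued in alpha by a recurrence without derivatives in t: integration by parts on the unit
  ball gives, with n the dimension and L the Laplacian,
    u_alpha[f] = u_(alpha+1)[f] + t^2 / ((n+2 alpha)(n+2 alpha+2)) u_(alpha+2)[L f],
    d/dt u_alpha[f] = t / (n+2 alpha) u_(alpha+1)[L f],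
  first for large Re alpha and then for all nonexceptional alpha. Smoothness follows from the second identity and
  the differential equation from both. For uniqueness, the difference of two solutions has vanishing Taylor
  expansion at t = 0, because evenness and nonexceptionality make all the recurrence factors nonzero; an energy
  estimate on a cone, multiplied by a power of t that compensates the singular coefficient, then shows that
  it vanishes.
*)
theory Submission imports Defs begin

text \<open>The two identities are Bessel relations. On a function with \<open>L f = - k^2 f\<close>
  the mean multiplies \<open>f\<close> by the normalised Bessel function of order
  \<open>\<alpha> + n/2 - 1\<close> at \<open>k t\<close>; the three-term relation and the
  derivative formula of these functions give the constants \<open>n + 2 \<alpha>\<close> and
  \<open>n + 2 \<alpha> + 2\<close>. Both identities only raise the parameter, so facts in a right
  half-plane move to the left, at the cost of Laplacians of \<open>f\<close>. The continuation must
  agree with the integrals on all of \<open>Re \<alpha> > 0\<close>, so the recurrence is proved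
  there, although the weight may blow up at the sphere. Differentiation under the integral is
  carried out for \<open>Re \<alpha> > 2\<close>, where the weight is continuous. In the uniqueness
  part the coefficient of \<open>1 / t\<close> may have a negative real part. Then the energy may
  grow like a power of \<open>t\<close>, and a second solution that starts with
  \<open>t^(2 - n - 2 \<alpha>)\<close> may have zero initial data. Smoothness and evenness exclude
  it unless this exponent is a positive even integer, which happens exactly at the exceptional
  parameters.\<close>

section \<open>Smooth functions and directional derivatives\<close>

lemma dir_deriv_eqI: "(f has_derivative f') (at x) \<Longrightarrow> dir_deriv v f x = f' v"
  unfolding dir_deriv_def by (metis frechet_derivative_at)

lemma has_derivative_dir_deriv:
  "f differentiable (at x) \<Longrightarrow> (f has_derivative (\<lambda>v. dir_deriv v f x)) (at x)"
  unfolding dir_deriv_def by (simp add: frechet_derivative_works)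

lemma linear_dir_deriv: "f differentiable (at x) \<Longrightarrow> linear (\<lambda>v. dir_deriv v f x)"
  using has_derivative_dir_deriv has_derivative_linear by blast

lemma dir_deriv_Basis:
  fixes f :: "'a::euclidean_space \<Rightarrow> 'b::real_normed_vector"
  assumes "f differentiable (at x)"
  shows "dir_deriv v f x = (\<Sum>b\<in>Basis. (v \<bullet> b) *\<^sub>R dir_deriv b f x)"
proof -
  interpret linear "\<lambda>v. dir_deriv v f x" by (rule linear_dir_deriv[OF assms])
  have "dir_deriv v f x = dir_deriv (\<Sum>b\<in>Basis. (v \<bullet> b) *\<^sub>R b) f x"
    by (simp add: euclidean_representation)
  then show ?thesis by (simp add: sum scale)
qed

lemma k_smooth_continuous: "k_smooth k f \<Longrightarrow> continuous_on UNIV f"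
  by (cases k) (auto simp: continuous_on_eq_continuous_at differentiable_imp_continuous_within)

lemma k_smooth_SucD: "k_smooth (Suc k) f \<Longrightarrow> k_smooth k f"
proof (induction k arbitrary: f)
  case 0
  then show ?case using k_smooth_continuous[of "Suc 0"] by simp
next
  case (Suc k)
  then show ?case by (metis k_smooth.simps(2))
qed

lemma smoothD:
  assumes "smooth f"
  shows smooth_dir_deriv: "smooth (dir_deriv v f)"
    and smooth_differentiable: "f differentiable (at x)"
    and smooth_continuous: "continuous_on UNIV f"
    and smooth_has_derivative: "(f has_derivative (\<lambda>v. dir_deriv v f x)) (at x)"
proof -
  show "smooth (dir_deriv v f)" for v using assms unfolding smooth_def by (metis k_smooth.simps(2))
  show *: "f differentiable (at x)" for x using assms unfolding smooth_def by (metis k_smooth.simps(2))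
  show "continuous_on UNIV f" using assms k_smooth_continuous smooth_def by blast
  show "(f has_derivative (\<lambda>v. dir_deriv v f x)) (at x)" using * by (rule has_derivative_dir_deriv)
qed

lemma smooth_isCont: "smooth f \<Longrightarrow> isCont f x"
  by (simp add: smooth_differentiable differentiable_imp_continuous_within)

lemma smooth_continuous_on: "smooth f \<Longrightarrow> continuous_on S f"
  using smooth_continuous continuous_on_subset by blast

lemma smooth_continuous_on_compose:
  "smooth f \<Longrightarrow> continuous_on S g \<Longrightarrow> continuous_on S (\<lambda>x. f (g x))"
  by (rule continuous_on_compose2[OF smooth_continuous]) auto

lemma k_smooth_linear:
  assumes "bounded_linear L" "k_smooth k f"
  shows "k_smooth k (\<lambda>x. L (f x))"
  using assms(2)
proof (induction k arbitrary: f)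
  case 0
  then show ?case by (auto intro: bounded_linear.continuous_on[OF assms(1)])
next
  case (Suc k)
  have d: "((\<lambda>x. L (f x)) has_derivative (\<lambda>v. L (dir_deriv v f x))) (at x)" for x
    using Suc.prems by (intro bounded_linear.has_derivative[OF assms(1)] has_derivative_dir_deriv) auto
  have "dir_deriv v (\<lambda>x. L (f x)) = (\<lambda>x. L (dir_deriv v f x))" for v
    by (rule ext) (rule dir_deriv_eqI[OF d])
  with d Suc show ?case by (auto simp: differentiable_def)
qed

lemma k_smooth_add:
  assumes "k_smooth k f" "k_smooth k g"
  shows "k_smooth k (\<lambda>x. f x + g x)"
  using assms
proof (induction k arbitrary: f g)
  case 0
  then show ?case by (auto intro: continuous_intros)
next
  case (Suc k)
  have d: "((\<lambda>x. f x + g x) has_derivative (\<lambda>v. dir_deriv v f x + dir_deriv v g x)) (at x)" for x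
    using Suc.prems by (intro has_derivative_add has_derivative_dir_deriv) auto
  have "dir_deriv v (\<lambda>x. f x + g x) = (\<lambda>x. dir_deriv v f x + dir_deriv v g x)" for v
    by (rule ext) (rule dir_deriv_eqI[OF d])
  with d Suc show ?case by (auto simp: differentiable_def)
qed

lemma k_smooth_const:
  "k_smooth k (\<lambda>x::'a::euclidean_space. c::'b::real_normed_vector)"
proof (induction k arbitrary: c)
  case (Suc k)
  have "dir_deriv v (\<lambda>x::'a. c) = (\<lambda>x. 0)" for v
    by (rule ext) (rule dir_deriv_eqI[OF has_derivative_const])
  with Suc show ?case by simp
qed simp

text \<open>In the derivatives of a mean the only nonconstant factor is the time coordinate. For
  linear \<open>L\<close> the derivative of the factor is the constant \<open>L v\<close>, so the
  induction closes without a product rule for two arbitrary smooth functions.\<close>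

lemma k_smooth_linear_mult:
  fixes f :: "'a::euclidean_space \<Rightarrow> complex"
  assumes L: "bounded_linear L" and "k_smooth k f"
  shows "k_smooth k (\<lambda>x. of_real (L x) * f x)"
  using assms(2)
proof (induction k arbitrary: f)
  case 0
  have "continuous_on UNIV L" using L by (simp add: linear_continuous_on)
  with 0 show ?case by (auto intro!: continuous_intros)
next
  case (Suc k)
  have d: "((\<lambda>x. of_real (L x) * f x) has_derivative
       (\<lambda>v. of_real (L x) * dir_deriv v f x + of_real (L v) * f x)) (at x)" for x
    using Suc.prems
    by (intro has_derivative_mult has_derivative_dir_deriv has_derivative_of_real
        bounded_linear.has_derivative[OF L] has_derivative_ident) auto
  have "dir_deriv v (\<lambda>x. of_real (L x) * f x)
      = (\<lambda>x. of_real (L x) * dir_deriv v f x + of_real (L v) * f x)" for v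
    by (rule ext) (rule dir_deriv_eqI[OF d])
  moreover have "k_smooth k (\<lambda>x. of_real (L x) * dir_deriv v f x + of_real (L v) * f x)" for v
    using Suc.IH[of "dir_deriv v f"] Suc.prems k_smooth_SucD[OF Suc.prems]
      k_smooth_linear[OF bounded_linear_mult_right, of k f "of_real (L v)"]
    by (intro k_smooth_add) auto
  ultimately show ?case using d by (auto simp: differentiable_def)
qed

lemma k_smooth_sum:
  "finite A \<Longrightarrow> (\<And>a. a \<in> A \<Longrightarrow> k_smooth k (f a)) \<Longrightarrow> k_smooth k (\<lambda>x. \<Sum>a\<in>A. f a x)"
  by (induction A rule: finite_induct) (auto intro: k_smooth_const k_smooth_add)

lemma smooth_diff: "smooth f \<Longrightarrow> smooth g \<Longrightarrow> smooth (\<lambda>x. f x - g x)"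
  unfolding smooth_def
  using k_smooth_add[of _ f "\<lambda>x. - g x"] k_smooth_linear[OF bounded_linear_minus[OF bounded_linear_ident]]
  by (metis (no_types, lifting) ab_group_add_class.ab_diff_conv_add_uminus ext)

lemma smooth_sum:
  "finite A \<Longrightarrow> (\<And>a. a \<in> A \<Longrightarrow> smooth (f a)) \<Longrightarrow> smooth (\<lambda>x. \<Sum>a\<in>A. f a x)"
  unfolding smooth_def by (auto intro: k_smooth_sum)

lemma laplacian_eq: "laplacian f = (\<lambda>x. \<Sum>b\<in>Basis. dir_deriv b (dir_deriv b f) x)"
  by (rule ext) (simp add: laplacian_def)

lemma smooth_laplacian: "smooth f \<Longrightarrow> smooth (laplacian f)"
  unfolding laplacian_eq by (intro smooth_sum smooth_dir_deriv) auto

lemma has_derivative_sum_dir_deriv: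
  assumes "finite A" "\<And>a. a \<in> A \<Longrightarrow> (f a) differentiable (at x)"
  shows "((\<lambda>x. \<Sum>a\<in>A. f a x) has_derivative (\<lambda>v. \<Sum>a\<in>A. dir_deriv v (f a) x)) (at x)"
  using assms by (intro has_derivative_sum has_derivative_dir_deriv)

lemma dir_deriv_sum:
  assumes "finite A" "\<And>a. a \<in> A \<Longrightarrow> smooth (f a)"
  shows "dir_deriv v (\<lambda>x. \<Sum>a\<in>A. f a x) = (\<lambda>x. \<Sum>a\<in>A. dir_deriv v (f a) x)"
  using assms by (intro ext dir_deriv_eqI has_derivative_sum_dir_deriv smooth_differentiable) auto

lemma laplacian_sum:
  assumes "finite A" "\<And>a. a \<in> A \<Longrightarrow> smooth (f a)"
  shows "laplacian (\<lambda>x. \<Sum>a\<in>A. f a x) = (\<lambda>x. \<Sum>a\<in>A. laplacian (f a) x)"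
  unfolding laplacian_eq using assms
  by (simp add: dir_deriv_sum smooth_dir_deriv sum.swap[of _ A])

section \<open>Derivatives along lines and symmetry of second derivatives\<close>

lemma has_vector_derivative_line:
  assumes "f differentiable (at (x + s *\<^sub>R v))"
  shows "((\<lambda>s. f (x + s *\<^sub>R v)) has_vector_derivative dir_deriv v f (x + s *\<^sub>R v)) (at s within S)"
proof -
  have "((\<lambda>s. f (x + s *\<^sub>R v)) has_derivative (\<lambda>h. dir_deriv (h *\<^sub>R v) f (x + s *\<^sub>R v))) (at s within S)"
    by (rule has_derivative_compose[of "\<lambda>s. x + s *\<^sub>R v" "\<lambda>h. h *\<^sub>R v", OF _ has_derivative_dir_deriv[OF assms]])
      (auto intro!: derivative_eq_intros)
  then show ?thesis
    using linear_scale[OF linear_dir_deriv[OF assms]] by (simp add: has_vector_derivative_def)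
qed

text \<open>Symmetry of second derivatives: differentiate
  \<open>f (x + s a + t b) - f (x + t b) = \<integral>\<^bsub>0\<^esub>\<^bsup>s\<^esup> \<partial>\<^sub>a f (x + \<sigma> a + t b) d\<sigma>\<close> first in \<open>t\<close>, under the integral, and then in \<open>s\<close>.\<close>

lemma dir_deriv_commute:
  fixes f :: "'a::euclidean_space \<Rightarrow> 'b::banach"
  assumes "smooth f"
  shows "dir_deriv a (dir_deriv b f) x = dir_deriv b (dir_deriv a f) x"
proof -
  let ?p = "\<lambda>(s::real) (t::real). x + t *\<^sub>R b + s *\<^sub>R a"
  note sm = assms smooth_dir_deriv[OF assms] smooth_dir_deriv[OF smooth_dir_deriv[OF assms]]
  have vd: "((\<lambda>s. g (?p s t)) has_vector_derivative dir_deriv a g (?p s t)) (at s within S)"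
    if "smooth g" for g :: "'a \<Rightarrow> 'b" and s t S
    using has_vector_derivative_line[OF smooth_differentiable[OF that], where x="x + t *\<^sub>R b"] by simp
  have vd': "((\<lambda>t. g (?p s t)) has_vector_derivative dir_deriv b g (?p s t)) (at t within S)"
    if "smooth g" for g :: "'a \<Rightarrow> 'b" and s t S
    using has_vector_derivative_line[OF smooth_differentiable[OF that], where x="x + s *\<^sub>R a" and s=t and v=b]
    by (simp add: algebra_simps)
  have ftc: "f (?p s t) = f (?p 0 t) + integral (cbox 0 s) (\<lambda>s. dir_deriv a f (?p s t))"
    if "s \<ge> 0" for s t
    using integral_unique[OF fundamental_theorem_of_calculus[OF that vd[OF assms]], of t] by simp
  have 1: "dir_deriv b f (?p s 0) = dir_deriv b f (?p 0 0)
      + integral (cbox 0 s) (\<lambda>s. dir_deriv b (dir_deriv a f) (?p s 0))" if "s \<ge> 0" for s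
  proof -
    have "((\<lambda>t. integral (cbox 0 s) (\<lambda>s. dir_deriv a f (?p s t))) has_vector_derivative
       integral (cbox 0 s) (\<lambda>s. dir_deriv b (dir_deriv a f) (?p s 0))) (at 0 within UNIV)"
      by (rule leibniz_rule_vector_derivative[where U=UNIV])
        (auto intro!: vd' sm integrable_continuous_interval smooth_continuous_on_compose continuous_intros
          simp: split_beta)
    then have "((\<lambda>t. f (?p s t)) has_vector_derivative dir_deriv b f (?p 0 0) +
       integral (cbox 0 s) (\<lambda>s. dir_deriv b (dir_deriv a f) (?p s 0))) (at 0)"
      unfolding ftc[OF that] by (intro has_vector_derivative_add vd' assms)
    from vector_derivative_unique_at[OF this vd'[OF assms]] show ?thesis by simp
  qed
  \<comment> \<open>The formula \<open>1\<close> is available for \<open>s \<ge> 0\<close>, so the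
    two derivatives at \<open>0\<close> are compared within \<open>{0..1}\<close>.\<close>
  have "((\<lambda>s. dir_deriv b f (?p 0 0) + integral {0..s} (\<lambda>s. dir_deriv b (dir_deriv a f) (?p s 0)))
     has_vector_derivative 0 + dir_deriv b (dir_deriv a f) (?p 0 0)) (at 0 within {0..1})"
    by (intro has_vector_derivative_add has_vector_derivative_const integral_has_vector_derivative)
      (auto intro!: sm smooth_continuous_on_compose continuous_intros)
  then have "((\<lambda>s. dir_deriv b f (?p s 0)) has_vector_derivative
      dir_deriv b (dir_deriv a f) (?p 0 0)) (at 0 within {0..1})"
    using 1 by (auto intro: has_vector_derivative_transform[rotated 2])
  moreover have "((\<lambda>s. dir_deriv b f (?p s 0)) has_vector_derivative
      dir_deriv a (dir_deriv b f) (?p 0 0)) (at 0 within {0..1})"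
    by (intro vd sm)
  ultimately show ?thesis
    using vector_derivative_unique_within[of 0 "{0..1::real}"]
    by (fastforce simp: trivial_limit_within islimpt_Icc)
qed

lemma dir_deriv_laplacian:
  assumes "smooth f"
  shows "dir_deriv v (laplacian f) = laplacian (dir_deriv v f)"
proof -
  have 1: "dir_deriv v (dir_deriv b f) = dir_deriv b (dir_deriv v f)" for b
    by (rule ext) (rule dir_deriv_commute[OF assms])
  have 2: "dir_deriv v (dir_deriv b (dir_deriv b f)) = dir_deriv b (dir_deriv v (dir_deriv b f))" for b
    by (rule ext) (rule dir_deriv_commute[OF smooth_dir_deriv[OF assms]])
  show ?thesis
    unfolding laplacian_eq using assms by (simp add: dir_deriv_sum smooth_dir_deriv 1 2)
qed

section \<open>Integration by parts and radial integrals\<close>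

text \<open>The bridge between the two integrals in use: changes of variables and dominated
  convergence act on Lebesgue integrals, the Leibniz rules on gauge integrals over a box.\<close>

lemma integrable_continuous_compact_support:
  fixes f :: "'a::euclidean_space \<Rightarrow> 'b::euclidean_space"
  assumes "continuous_on UNIV f" "\<And>x. x \<notin> cbox a b \<Longrightarrow> f x = 0"
  shows "integrable lborel f" "(LINT x|lborel. f x) = integral (cbox a b) f"
proof -
  have eq: "(\<lambda>x. indicator (cbox a b) x *\<^sub>R f x) = f"
    using assms(2) by (auto simp: fun_eq_iff indicator_def)
  have "integrable lborel (\<lambda>x. indicator (cbox a b) x *\<^sub>R f x)"
    by (rule borel_integrable_compact) (auto intro: continuous_on_subset assms)
  then show "integrable lborel f" by (simp add: eq)
  then have "set_integrable lborel (cbox a b) f" by (simp add: set_integrable_def eq)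
  from set_borel_integral_eq_integral(2)[OF this]
  show "(LINT x|lborel. f x) = integral (cbox a b) f" by (simp add: set_lebesgue_integral_def eq)
qed

lemma lborel_integral_translate:
  fixes f :: "'a::euclidean_space \<Rightarrow> 'b::euclidean_space"
  assumes "continuous_on UNIV f"
  shows "(LINT x|lborel. f (x + c)) = (LINT x|lborel. f x)"
proof -
  have "f \<in> borel_measurable borel" by (rule borel_measurable_continuous_onI[OF assms])
  then have "(LINT x|distr lborel borel ((+) c). f x) = (LINT x|lborel. f (c + x))"
    by (intro integral_distr) auto
  then show ?thesis by (simp add: lborel_distr_plus add.commute)
qed

text \<open>By translation invariance \<open>\<integral> \<psi> (y + s b) dy\<close> does not depend on \<open>s\<close>.\<close>

lemma integral_dir_deriv_eq_0:
  fixes \<psi> \<psi>' :: "'a::euclidean_space \<Rightarrow> 'b::euclidean_space"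
  assumes d: "\<And>y. ((\<lambda>s. \<psi> (y + s *\<^sub>R b)) has_vector_derivative \<psi>' y) (at 0)"
    and cont: "continuous_on UNIV \<psi>" "continuous_on UNIV \<psi>'"
    and supp: "\<And>y. norm y \<ge> R \<Longrightarrow> \<psi> y = 0"
  shows "integrable lborel \<psi>'" "(LINT y|lborel. \<psi>' y) = 0"
proof -
  \<comment> \<open>The margin \<open>norm b\<close> keeps the supports of all translates by
    \<open>s *\<^sub>R b\<close> with \<open>\<bar>s\<bar> \<le> 1\<close> inside one box, so that
    the domain stays fixed while \<open>s\<close> varies.\<close>
  obtain a c where ac: "cball (0::'a) (R + norm b) \<subseteq> cbox a c"
    using bounded_subset_cbox_symmetric[OF bounded_cball, of "0::'a" "R + norm b"] by blast
  have out: "norm y > R + norm b" if "y \<notin> cbox a c" for y using ac that by (auto simp: subset_iff not_le)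
  have psi0: "\<psi> (y + s *\<^sub>R b) = 0" if "y \<notin> cbox a c" "s \<in> {-1..1}" for y s
  proof (rule supp)
    have "norm (s *\<^sub>R b) \<le> norm b" using that(2) mult_right_mono[of "\<bar>s\<bar>" 1 "norm b"] by (auto simp: abs_le_iff)
    then show "R \<le> norm (y + s *\<^sub>R b)"
      using out[OF that(1)] norm_triangle_ineq2[of y "- (s *\<^sub>R b)"] by simp
  qed
  have psi'0: "\<psi>' y = 0" if "y \<notin> cbox a c" for y
  proof -
    have "((\<lambda>s. \<psi> (y + s *\<^sub>R b)) has_vector_derivative \<psi>' y) (at 0 within {-1..1})"
      using d has_vector_derivative_at_within by blast
    moreover have "((\<lambda>s. \<psi> (y + s *\<^sub>R b)) has_vector_derivative 0) (at 0 within {-1..1})"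
      by (rule has_vector_derivative_transform[of _ _ _ "\<lambda>s. 0"]) (use psi0[OF that] in auto)
    ultimately show ?thesis
      using vector_derivative_unique_within[of 0 "{-1..1::real}"]
      by (fastforce simp: trivial_limit_within islimpt_Icc)
  qed
  have dd: "((\<lambda>s. \<psi> (y + s *\<^sub>R b)) has_vector_derivative \<psi>' (y + s *\<^sub>R b)) (at s within S)" for y s S
  proof -
    have "((\<lambda>h. h - s) has_vector_derivative 1) (at s within S)"
      by (auto intro!: derivative_eq_intros simp: has_vector_derivative_def)
    from vector_diff_chain_within[OF this, of "\<lambda>h. \<psi> ((y + s *\<^sub>R b) + h *\<^sub>R b)" "\<psi>' (y + s *\<^sub>R b)"]
    show ?thesis using has_vector_derivative_at_within[OF d[of "y + s *\<^sub>R b"]]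
      by (simp add: o_def algebra_simps)
  qed
  note c2 = continuous_on_compose2[OF cont(1)] continuous_on_compose2[OF cont(2)]
  have "((\<lambda>s. integral (cbox a c) (\<lambda>y. \<psi> (y + s *\<^sub>R b))) has_vector_derivative
     integral (cbox a c) (\<lambda>y. \<psi>' (y + 0 *\<^sub>R b))) (at 0 within {-1..1})"
    by (rule leibniz_rule_vector_derivative)
      (auto intro!: dd integrable_continuous c2 continuous_intros simp: split_beta)
  moreover have const: "integral (cbox a c) (\<lambda>y. \<psi> (y + s *\<^sub>R b)) = (LINT y|lborel. \<psi> y)"
    if "s \<in> {-1..1}" for s
  proof -
    have "integral (cbox a c) (\<lambda>y. \<psi> (y + s *\<^sub>R b)) = (LINT y|lborel. \<psi> (y + s *\<^sub>R b))"
      using psi0 that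
      by (intro integrable_continuous_compact_support(2)[symmetric]) (auto intro!: c2 continuous_intros)
    then show ?thesis by (simp add: lborel_integral_translate cont)
  qed
  have "((\<lambda>s. integral (cbox a c) (\<lambda>y. \<psi> (y + s *\<^sub>R b))) has_vector_derivative 0) (at 0 within {-1..1})"
    by (rule has_vector_derivative_transform[of _ _ _ "\<lambda>s. LINT y|lborel. \<psi> y"]) (use const in auto)
  ultimately have "integral (cbox a c) \<psi>' = 0"
    using vector_derivative_unique_within[of 0 "{-1..1::real}"]
    by (fastforce simp: trivial_limit_within islimpt_Icc)
  then show "(LINT y|lborel. \<psi>' y) = 0" "integrable lborel \<psi>'"
    using integrable_continuous_compact_support[OF cont(2) psi'0] by auto
qed

section \<open>The powers of 1 - |y|^2 and their total mass\<close>

definition ball_weight :: "complex \<Rightarrow> 'a::euclidean_space \<Rightarrow> complex" where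
  "ball_weight \<gamma> y = (if norm y < 1 then of_real (1 - (norm y)\<^sup>2) powr \<gamma> else 0)"

definition ball_weight_real :: "real \<Rightarrow> 'a::euclidean_space \<Rightarrow> real" where
  "ball_weight_real c y = (if norm y < 1 then (1 - (norm y)\<^sup>2) powr c else 0)"

lemma norm_less_1_iff: "norm y < 1 \<longleftrightarrow> 1 - (norm y)\<^sup>2 > 0"
  by (simp add: abs_square_less_1)

lemma ball_weight_real_nonneg: "ball_weight_real c y \<ge> 0"
  by (simp add: ball_weight_real_def)

lemma norm_ball_weight: "norm (ball_weight \<gamma> y) = ball_weight_real (Re \<gamma>) y"
  unfolding ball_weight_def ball_weight_real_def
  by (auto simp: norm_powr_real_powr norm_less_1_iff simp del: of_real_diff of_real_power)

lemma ball_weight_of_real: "ball_weight (of_real c) y = of_real (ball_weight_real c y)"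
  unfolding ball_weight_def ball_weight_real_def
  by (auto simp: powr_of_real norm_less_1_iff simp del: of_real_diff of_real_power)

lemma borel_measurable_ball_weight_real [measurable]: "ball_weight_real c \<in> borel_measurable borel"
  unfolding ball_weight_real_def[abs_def] by measurable

lemma borel_measurable_ball_weight [measurable]: "ball_weight \<gamma> \<in> borel_measurable borel"
proof -
  have "ball_weight \<gamma> = (\<lambda>y. if norm y < 1 then exp (\<gamma> * of_real (ln (1 - (norm y)\<^sup>2))) else 0)"
    by (auto simp: fun_eq_iff ball_weight_def powr_def Ln_of_real norm_less_1_iff simp del: of_real_diff of_real_power)
  then show ?thesis by (subst \<open>ball_weight \<gamma> = _\<close>) measurable
qed

text \<open>The distribution of \<open>\<parallel>y\<parallel>\<^sup>2\<close> under the uniform measure on the unit ball, in place of polar coordinates.\<close>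

lemma distr_norm_square_ball:
  defines "n \<equiv> real DIM('a::euclidean_space)"
  shows "distr (density lborel (indicator (ball (0::'a) 1))) borel (\<lambda>y. (norm y)\<^sup>2)
    = density lborel (\<lambda>s. ennreal (indicator {0..1} s * (unit_ball_vol n * (n / 2) * s powr (n / 2 - 1))))"
    (is "?M = ?N")
proof (rule measure_eqI_lessThan)
  have n: "n > 0" by (simp add: n_def)
  let ?V = "unit_ball_vol n"
  \<comment> \<open>The mass beyond \<open>x\<close> depends only on \<open>x\<close> clamped to
    \<open>[0, 1]\<close>; this puts negative, intermediate and large \<open>x\<close> into one
    formula.\<close>
  define m where "m x = min 1 (max x 0)" for x :: real
  have m: "0 \<le> m x" "m x \<le> 1" for x by (auto simp: m_def)
  have M: "emeasure ?M {x<..} = ennreal (?V * (1 - m x powr (n / 2)))" for x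
  proof -
    have "emeasure ?M {x<..} = emeasure lborel {y::'a. norm y < 1 \<and> x < (norm y)\<^sup>2}"
    proof (subst emeasure_distr)
      have "emeasure (density lborel (indicator (ball (0::'a) 1))) ((\<lambda>y. (norm y)\<^sup>2) -` {x<..})
          = emeasure lborel (ball 0 1 \<inter> (\<lambda>y::'a. (norm y)\<^sup>2) -` {x<..})"
        by (rule emeasure_restricted) (auto intro: measurable_sets_borel[of _ borel])
      then show "emeasure (density lborel (indicator (ball (0::'a) 1)))
          ((\<lambda>y. (norm y)\<^sup>2) -` {x<..} \<inter> space (density lborel (indicator (ball 0 1))))
        = emeasure lborel {y::'a. norm y < 1 \<and> x < (norm y)\<^sup>2}"
        by (auto simp: vimage_def Int_def)
    qed auto
    also have "\<dots> = ennreal (?V * (1 - m x powr (n / 2)))"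
    proof (cases "x < 0")
      case True
      then have "{y::'a. norm y < 1 \<and> x < (norm y)\<^sup>2} = ball 0 1" by (auto intro: less_le_trans)
      with True n show ?thesis by (simp add: emeasure_ball m_def n_def)
    next
      case False
      show ?thesis
      proof (cases "x < 1")
        case True
        have "{y::'a. norm y < 1 \<and> x < (norm y)\<^sup>2} = ball 0 1 - cball 0 (sqrt x)"
          using real_sqrt_le_iff[of "(norm y)\<^sup>2" x for y :: 'a]
          by (auto simp: set_eq_iff simp flip: not_le)
        also have "emeasure lborel \<dots> = emeasure lborel (ball (0::'a) 1) - emeasure lborel (cball (0::'a) (sqrt x))"
        proof (rule emeasure_Diff)
          show "cball (0::'a) (sqrt x) \<subseteq> ball 0 1" using True by (simp add: cball_subset_ball_iff)
        qed (use False in \<open>auto simp: emeasure_cball\<close>)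
        also have "\<dots> = ennreal (?V * (1 - m x powr (n / 2)))"
        proof -
          have "sqrt x ^ DIM('a) = x powr (n / 2)"
          proof (cases "x = 0")
            case x: False
            with False have "sqrt x ^ DIM('a) = (x powr (1 / 2)) powr n"
              by (simp add: n_def powr_realpow powr_half_sqrt)
            then show ?thesis by (simp add: powr_powr)
          qed simp
          moreover have "m x = x" using True False by (simp add: m_def)
          moreover have "?V - ?V * x powr (n / 2) = ?V * (1 - x powr (n / 2))" by (simp add: algebra_simps)
          ultimately show ?thesis
            using True False n by (simp add: emeasure_ball emeasure_cball n_def[symmetric] ennreal_minus)
        qed
        finally show ?thesis .
      next
        case g: False
        then have "{y::'a. norm y < 1 \<and> x < (norm y)\<^sup>2} = {}"
          by (auto simp: norm_less_1_iff)
        then have "emeasure lborel {y::'a. norm y < 1 \<and> x < (norm y)\<^sup>2} = 0" by (simp only: emeasure_empty)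
        with g show ?thesis by (simp add: m_def)
      qed
    qed
    finally show ?thesis .
  qed
  have N: "emeasure ?N {x<..} = ennreal (?V * (1 - m x powr (n / 2)))" for x
  proof -
    let ?f = "\<lambda>s. ?V * (n / 2) * s powr (n / 2 - 1)"
    have "(?f has_integral (?V * 1 powr (n / 2) - ?V * m x powr (n / 2))) {m x..1}"
    proof (rule fundamental_theorem_of_calculus_interior)
      show "continuous_on {m x..1} (\<lambda>s. ?V * s powr (n / 2))"
        using n m by (intro continuous_on_mult continuous_on_powr' continuous_on_const continuous_on_id)
          (auto intro: order_trans[of 0 "m x"])
      show "((\<lambda>s. ?V * s powr (n / 2)) has_vector_derivative ?f s) (at s)" if "s \<in> {m x<..<1}" for s
        using that m[of x] unfolding has_real_derivative_iff_has_vector_derivative[symmetric]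
        by (auto intro!: derivative_eq_intros)
    qed (use m in auto)
    then have "((\<lambda>s. if s \<in> {m x..1} then ?f s else 0) has_integral ?V * (1 - m x powr (n / 2))) UNIV"
      unfolding has_integral_restrict_UNIV by (simp add: algebra_simps)
    then have "(\<integral>\<^sup>+s. ennreal (if s \<in> {m x..1} then ?f s else 0) \<partial>lborel) = ennreal (?V * (1 - m x powr (n / 2)))"
      using n by (intro nn_integral_has_integral_lborel) auto
    moreover have "emeasure ?N {x<..} = (\<integral>\<^sup>+s. ennreal (if s \<in> {m x..1} then ?f s else 0) \<partial>lborel)"
    proof -
      \<comment> \<open>The two sides can differ at \<open>x\<close>, where one interval is open and
        the other closed, and at \<open>1\<close>, to which \<open>{m x..1}\<close> shrinks for
        \<open>x \<ge> 1\<close>.\<close>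
      have "AE s in lborel. ennreal (indicator {0..1} s * ?f s) * indicator {x<..} s
          = ennreal (if s \<in> {m x..1} then ?f s else 0)"
        using AE_lborel_singleton[of x] AE_lborel_singleton[of "1::real"]
        by eventually_elim (auto simp: m_def split: split_indicator)
      then show ?thesis
        by (subst emeasure_density) (auto intro!: nn_integral_cong_AE)
    qed
    ultimately show ?thesis by simp
  qed
  show "emeasure ?M {x<..} < \<infinity>" for x by (simp add: M)
  show "emeasure ?M {x<..} = emeasure ?N {x<..}" for x by (simp only: M N)
qed simp_all

text \<open>In the variable \<open>s = |y|^2\<close> the integral is a Beta integral. It yields
  integrability for all exponents above \<open>-1\<close> and, later, the normalisation of the
  means.\<close>

lemma has_bochner_integral_ball_weight_real:
  assumes "a > 0"
  defines "n \<equiv> real DIM('a::euclidean_space)"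
  shows "has_bochner_integral lborel (ball_weight_real (a - 1) :: 'a \<Rightarrow> real)
    (unit_ball_vol n * (n / 2) * Beta (n / 2) a)"
proof (rule has_bochner_integral_nn_integral)
  have n: "n > 0" by (simp add: n_def)
  let ?I = "unit_ball_vol n * (n / 2) * Beta (n / 2) a"
  have Bpos: "Beta (n / 2) a > 0" using n assms by (simp add: Beta_def Gamma_real_pos)
  then show "0 \<le> ?I" using n by simp
  have "(\<integral>\<^sup>+y. ennreal (ball_weight_real (a - 1) y) \<partial>(lborel :: 'a measure))
    = (\<integral>\<^sup>+y. indicator (ball 0 1) y * ennreal ((1 - (norm y)\<^sup>2) powr (a - 1)) \<partial>(lborel :: 'a measure))"
    by (intro nn_integral_cong) (auto simp: ball_weight_real_def split: split_indicator)
  also have "\<dots> = (\<integral>\<^sup>+s. ennreal ((1 - s) powr (a - 1)) \<partial>distr (density lborel (indicator (ball (0::'a) 1))) borel (\<lambda>y. (norm y)\<^sup>2))"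
    by (subst nn_integral_distr, measurable, subst nn_integral_density) (auto intro: borel_measurable_indicator)
  also have "\<dots> = (\<integral>\<^sup>+s. ennreal (indicator {0..1} s * (unit_ball_vol n * (n / 2) * s powr (n / 2 - 1)))
      * ennreal ((1 - s) powr (a - 1)) \<partial>lborel)"
    unfolding distr_norm_square_ball n_def[symmetric] by (subst nn_integral_density) auto
  also have "\<dots> = (\<integral>\<^sup>+s. ennreal (if s \<in> {0..1} then unit_ball_vol n * (n / 2) * (s powr (n / 2 - 1) * (1 - s) powr (a - 1)) else 0) \<partial>lborel)"
    using n by (intro nn_integral_cong) (auto simp: ennreal_mult[symmetric] mult_ac split: split_indicator)
  also have "\<dots> = ennreal ?I"
  proof (rule nn_integral_has_integral_lborel)
    have "((\<lambda>s. s powr (n / 2 - 1) * (1 - s) powr (a - 1)) has_integral Beta (n / 2) a) {0..1}"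
      using n assms by (intro has_integral_Beta_real) auto
    from has_integral_mult_right[OF this, of "unit_ball_vol n * (n / 2)"]
    show "((\<lambda>s. if s \<in> {0..1} then unit_ball_vol n * (n / 2) * (s powr (n / 2 - 1) * (1 - s) powr (a - 1)) else 0)
       has_integral ?I) UNIV"
      unfolding has_integral_restrict_UNIV .
  qed (use n in auto)
  finally show "(\<integral>\<^sup>+y. ennreal (ball_weight_real (a - 1) y) \<partial>(lborel :: 'a measure)) = ennreal ?I" .
qed (auto simp: ball_weight_real_nonneg)

section \<open>Weights on the unit ball\<close>

lemma integrable_ball_weight_real:
  "c > -1 \<Longrightarrow> integrable lborel (ball_weight_real c :: 'a::euclidean_space \<Rightarrow> real)"
  using has_bochner_integral_ball_weight_real[of "c + 1", where 'a='a] by (simp add: has_bochner_integral_iff)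

lemma ball_weight_outside: "norm y \<ge> 1 \<Longrightarrow> ball_weight \<gamma> y = 0"
  by (simp add: ball_weight_def)

lemma bounded_on_unit_ball:
  fixes g :: "'a::euclidean_space \<Rightarrow> 'b::real_normed_vector"
  assumes "continuous_on UNIV g"
  obtains M where "M \<ge> 0" "\<And>y. norm y \<le> 1 \<Longrightarrow> norm (g y) \<le> M"
proof -
  have "compact (g ` cball 0 1)"
    by (intro compact_continuous_image continuous_on_subset[OF assms]) auto
  then obtain M where "M > 0" "\<And>x. x \<in> g ` cball 0 1 \<Longrightarrow> norm x \<le> M"
    using compact_imp_bounded bounded_pos by metis
  then show ?thesis by (intro that[of M]) auto
qed

lemma integrable_mult_ball_weight:
  fixes g :: "'a::euclidean_space \<Rightarrow> complex"
  assumes g: "continuous_on UNIV g" and "Re \<gamma> > -1"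
  shows "integrable lborel (\<lambda>y. g y * ball_weight \<gamma> y)"
proof -
  obtain M where M: "M \<ge> 0" "\<And>y. norm y \<le> 1 \<Longrightarrow> norm (g y) \<le> M"
    using bounded_on_unit_ball[OF g] by blast
  have [measurable]: "g \<in> borel_measurable borel" by (rule borel_measurable_continuous_onI[OF g])
  have "integrable lborel (\<lambda>y::'a. M * ball_weight_real (Re \<gamma>) y)"
    using assms by (intro integrable_mult_right integrable_ball_weight_real)
  then show ?thesis
  proof (rule Bochner_Integration.integrable_bound)
    show "AE y in lborel. norm (g y * ball_weight \<gamma> y) \<le> norm (M * ball_weight_real (Re \<gamma>) y)"
      using M by (auto simp: norm_mult norm_ball_weight ball_weight_real_def intro!: mult_right_mono)
  qed simp
qed

lemma ball_weight_eq: "ball_weight \<gamma> y = of_real (max 0 (1 - (norm y)\<^sup>2)) powr \<gamma>"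
  by (auto simp: ball_weight_def max_def norm_less_1_iff not_less simp del: of_real_diff of_real_power)

text \<open>In the clamped form of \<open>ball_weight_eq\<close>, crossing the sphere means that the
  base of a complex power reaches \<open>0\<close>; there the power is continuous, jointly in base
  and exponent, as long as the exponent has positive real part.\<close>

lemma continuous_on_ball_weight [continuous_intros]:
  assumes "continuous_on S f" "continuous_on S h" "\<And>x. x \<in> S \<Longrightarrow> Re (f x) > 0"
  shows "continuous_on S (\<lambda>x. ball_weight (f x) (h x))"
  unfolding ball_weight_eq
  by (rule continuous_on_powr_complex) (use assms in \<open>auto intro!: continuous_intros\<close>)

lemma ball_weight_recurrence:
  "of_real ((norm y)\<^sup>2) * ball_weight (\<gamma> - 1) y = ball_weight (\<gamma> - 1) y - ball_weight \<gamma> y"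
proof (cases "norm y < 1")
  case True
  then have p: "complex_of_real (1 - (norm y)\<^sup>2) \<noteq> 0" 
    unfolding norm_less_1_iff by (simp del: of_real_diff of_real_power)
  have "ball_weight \<gamma> y = of_real (1 - (norm y)\<^sup>2) * ball_weight (\<gamma> - 1) y"
    using True powr_add[of "complex_of_real (1 - (norm y)\<^sup>2)" "\<gamma> - 1" 1] p
    by (simp add: ball_weight_def mult.commute del: of_real_diff of_real_power)
  then show ?thesis by (simp add: algebra_simps)
qed (simp add: ball_weight_outside)

section \<open>Regularised weights and integration by parts on the unit ball\<close>

lemma has_real_derivative_max_0_square:
  "((\<lambda>s. (max 0 s)\<^sup>2) has_real_derivative 2 * max 0 s) (at (s::real))"
proof -
  consider "s < 0" | "s > 0" | "s = 0" by linarith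
  then show ?thesis
  proof cases
    case 1
    then have "eventually (\<lambda>s. s < 0) (nhds s)" using eventually_nhds_in_open[of "{..<0}" s] by simp
    then have "eventually (\<lambda>s. (max 0 s)\<^sup>2 = 0) (nhds s)" by eventually_elim auto
    then have "((\<lambda>s. (max 0 s)\<^sup>2) has_real_derivative 0) (at s) \<longleftrightarrow> ((\<lambda>s. 0) has_real_derivative 0) (at s)"
      by (intro DERIV_cong_ev) auto
    with 1 show ?thesis by simp
  next
    case 2
    then have "eventually (\<lambda>s. s > 0) (nhds s)" using eventually_nhds_in_open[of "{0<..}" s] by simp
    then have "eventually (\<lambda>s. (max 0 s)\<^sup>2 = s\<^sup>2) (nhds s)" by eventually_elim auto
    then have "((\<lambda>s. (max 0 s)\<^sup>2) has_real_derivative 2 * s) (at s) \<longleftrightarrow> ((\<lambda>s. s\<^sup>2) has_real_derivative 2 * s) (at s)"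
      by (intro DERIV_cong_ev) auto
    moreover have "((\<lambda>s. s\<^sup>2) has_real_derivative 2 * s) (at s)" by (auto intro!: derivative_eq_intros)
    ultimately show ?thesis using 2 by simp
  next
    case 3
    have "((\<lambda>h. ((max 0 (s + h))\<^sup>2 - (max 0 s)\<^sup>2) / h) \<longlongrightarrow> 0) (at 0)"
    proof (rule Lim_null_comparison)
      have "norm (((max 0 (s + h))\<^sup>2 - (max 0 s)\<^sup>2) / h) \<le> \<bar>h\<bar>" for h
        using 3 by (auto simp: max_def power2_eq_square)
      then show "\<forall>\<^sub>F h in at 0. norm (((max 0 (s + h))\<^sup>2 - (max 0 s)\<^sup>2) / h) \<le> \<bar>h\<bar>" by simp
      show "((\<lambda>h::real. \<bar>h\<bar>) \<longlongrightarrow> 0) (at 0)" by (auto intro!: tendsto_eq_intros)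
    qed
    with 3 show ?thesis by (simp add: DERIV_def)
  qed
qed

text \<open>A \<open>C\<^sup>1\<close> approximation of \<open>ball_weight (k + c)\<close>, needed because \<open>ball_weight \<alpha>\<close> is not
  differentiable across the unit sphere for small \<open>Re \<alpha>\<close>.\<close>

definition reg_weight :: "real \<Rightarrow> nat \<Rightarrow> complex \<Rightarrow> 'a::euclidean_space \<Rightarrow> complex" where
  "reg_weight \<epsilon> k c y = of_real ((max 0 (1 - (norm y)\<^sup>2)) ^ k)
     * exp (c / 2 * of_real (ln ((1 - (norm y)\<^sup>2)\<^sup>2 + \<epsilon>\<^sup>2)))"

lemma reg_weight_outside: "norm y \<ge> 1 \<Longrightarrow> k \<ge> 1 \<Longrightarrow> reg_weight \<epsilon> k c y = 0"
  using norm_less_1_iff[of y] by (simp add: reg_weight_def max_def)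

lemma continuous_on_reg_weight:
  assumes "\<epsilon> > 0"
  shows "continuous_on S (reg_weight \<epsilon> k c)"
  unfolding reg_weight_def[abs_def] using assms
  by (intro continuous_intros) (auto simp: add_nonneg_eq_0_iff)

text \<open>The majorant for dominated convergence, independent of \<open>\<epsilon>\<close>. If
  \<open>Re c \<le> 0\<close>, dropping \<open>\<epsilon>^2\<close> only increases the second factor
  and gives the first summand; if \<open>Re c > 0\<close>, that factor is bounded since its base is
  at most \<open>2\<close>.\<close>

lemma norm_reg_weight_le:
  assumes "0 < \<epsilon>" "\<epsilon> \<le> 1" "k \<ge> 1"
  shows "norm (reg_weight \<epsilon> k c y) \<le> ball_weight_real (real k + Re c) y + 2 powr \<bar>Re c\<bar> * ball_weight_real 0 y"
proof (cases "norm y < 1")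
  case False
  then show ?thesis using assms by (simp add: reg_weight_outside ball_weight_real_def)
next
  case True
  define s where "s = 1 - (norm y)\<^sup>2"
  have s: "0 < s" "s \<le> 1" using True norm_less_1_iff[of y] by (auto simp: s_def)
  have p: "s\<^sup>2 + \<epsilon>\<^sup>2 > 0" using s by (simp add: add_pos_nonneg)
  have "norm (reg_weight \<epsilon> k c y) = s ^ k * (s\<^sup>2 + \<epsilon>\<^sup>2) powr (Re c / 2)"
    using s p unfolding reg_weight_def s_def[symmetric] by (simp add: norm_mult norm_power powr_def)
  also have "\<dots> \<le> s powr (real k + Re c) + 2 powr \<bar>Re c\<bar>"
  proof (cases "Re c \<le> 0")
    case True
    have "(s\<^sup>2 + \<epsilon>\<^sup>2) powr (Re c / 2) \<le> (s\<^sup>2) powr (Re c / 2)"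
      using True s by (intro powr_mono2') auto
    also have "(s\<^sup>2) powr (Re c / 2) = s powr Re c"
      using s by (simp add: powr_powr flip: powr_numeral)
    finally have "s ^ k * (s\<^sup>2 + \<epsilon>\<^sup>2) powr (Re c / 2) \<le> s powr k * s powr Re c"
      using s by (simp add: powr_realpow)
    also have "\<dots> = s powr (real k + Re c)" by (simp add: powr_add)
    finally show ?thesis by (simp add: add_increasing2)
  next
    case False
    have "s\<^sup>2 \<le> 1" "\<epsilon>\<^sup>2 \<le> 1" using s assms by (auto intro: power_le_one)
    then have "(s\<^sup>2 + \<epsilon>\<^sup>2) powr (Re c / 2) \<le> 2 powr (Re c / 2)"
      using False p by (intro powr_mono2) auto
    also have "\<dots> \<le> 2 powr \<bar>Re c\<bar>" using False by (intro powr_mono) auto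
    finally have "s ^ k * (s\<^sup>2 + \<epsilon>\<^sup>2) powr (Re c / 2) \<le> 1 * 2 powr \<bar>Re c\<bar>"
      using s by (intro mult_mono) (auto intro: power_le_one)
    then show ?thesis by (simp add: add_increasing)
  qed
  finally show ?thesis using True norm_less_1_iff[of y] by (simp add: ball_weight_real_def s_def)
qed

lemma reg_weight_tendsto:
  assumes "k \<ge> 1"
  shows "(\<lambda>j. reg_weight (1 / real (Suc j)) k c y) \<longlonglongrightarrow> ball_weight (of_nat k + c) y"
proof (cases "norm y < 1")
  case False
  then show ?thesis using assms by (simp add: reg_weight_outside ball_weight_outside)
next
  case True
  define s where "s = 1 - (norm y)\<^sup>2"
  have s: "0 < s" using True norm_less_1_iff[of y] by (auto simp: s_def)
  have "(\<lambda>j. s\<^sup>2 + (1 / real (Suc j))\<^sup>2) \<longlonglongrightarrow> s\<^sup>2 + 0\<^sup>2"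
    by (intro tendsto_intros LIMSEQ_Suc[OF lim_1_over_n])
  then have "(\<lambda>j. of_real (s ^ k) * exp (c / 2 * of_real (ln (s\<^sup>2 + (1 / real (Suc j))\<^sup>2))))
      \<longlonglongrightarrow> of_real (s ^ k) * exp (c / 2 * complex_of_real (ln (s\<^sup>2)))"
    using s by (intro tendsto_intros) auto
  moreover have "of_real (s ^ k) * exp (c / 2 * complex_of_real (ln (s\<^sup>2))) = complex_of_real s powr (of_nat k + c)"
    using s by (simp add: powr_add powr_def Ln_of_real ln_realpow distrib_right exp_add flip: powr_complexpow)
  moreover have "reg_weight (1 / real (Suc j)) k c y
      = of_real (s ^ k) * exp (c / 2 * of_real (ln (s\<^sup>2 + (1 / real (Suc j))\<^sup>2)))" for j
    using s by (simp add: reg_weight_def flip: s_def)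
  moreover have "ball_weight (of_nat k + c) y = complex_of_real s powr (of_nat k + c)"
    using True by (simp only: ball_weight_def s_def if_True)
  ultimately show ?thesis by (simp only:)
qed

lemma integral_reg_weight_tendsto:
  fixes g :: "'a::euclidean_space \<Rightarrow> complex"
  assumes g: "continuous_on UNIV g" and k: "k \<ge> 1" and c: "real k + Re c > -1"
  shows "(\<lambda>j. LINT y|lborel. g y * reg_weight (1 / real (Suc j)) k c y)
    \<longlonglongrightarrow> (LINT y|lborel. g y * ball_weight (of_nat k + c) y)"
proof -
  obtain M where M: "M \<ge> 0" "\<And>y. norm y \<le> 1 \<Longrightarrow> norm (g y) \<le> M"
    using bounded_on_unit_ball[OF g] by blast
  have [measurable]: "g \<in> borel_measurable borel" by (rule borel_measurable_continuous_onI[OF g])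
  have [measurable]: "reg_weight (1 / real (Suc j)) k c \<in> borel_measurable borel" for j
    by (rule borel_measurable_continuous_onI[OF continuous_on_reg_weight]) simp
  let ?w = "\<lambda>y::'a. M * (ball_weight_real (real k + Re c) y + 2 powr \<bar>Re c\<bar> * ball_weight_real 0 y)"
  show ?thesis
  proof (rule integral_dominated_convergence[where w="?w"])
    show "integrable lborel ?w"
      using c by (intro integrable_mult_right Bochner_Integration.integrable_add integrable_ball_weight_real) auto
    show "AE y in lborel. (\<lambda>j. g y * reg_weight (1 / real (Suc j)) k c y) \<longlonglongrightarrow> g y * ball_weight (of_nat k + c) y"
      using reg_weight_tendsto[OF k] by (intro AE_I2 tendsto_mult tendsto_const)
    show "AE y in lborel. norm (g y * reg_weight (1 / real (Suc j)) k c y) \<le> ?w y" for j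
    proof (rule AE_I2)
      fix y :: 'a
      show "norm (g y * reg_weight (1 / real (Suc j)) k c y) \<le> ?w y"
      proof (cases "norm y < 1")
        case True
        then show ?thesis unfolding norm_mult
          using M norm_reg_weight_le[of "1 / real (Suc j)" k c y] k by (intro mult_mono) auto
      next
        case False
        then show ?thesis using k by (simp add: reg_weight_outside ball_weight_real_def)
      qed
    qed
  qed (use g in measurable)
qed

text \<open>With \<open>s = 1 - |y|^2\<close> and its positive part \<open>s_+\<close>, the product
  \<open>s_+^2 * s\<close> that arises from the logarithm is \<open>s_+^3\<close>, so the derivative
  is again built from regularised weights. As \<open>\<epsilon>\<close> tends to \<open>0\<close>
  both of them tend to \<open>ball_weight (c + 1)\<close>, with total coefficient
  \<open>2 + c\<close>.\<close>

lemma reg_weight_has_vector_derivative: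
  assumes "\<epsilon> > 0"
  shows "((\<lambda>s. reg_weight \<epsilon> 2 c (y + s *\<^sub>R b)) has_vector_derivative
     of_real (- 2 * (y \<bullet> b)) * (2 * reg_weight \<epsilon> 1 c y + c * reg_weight \<epsilon> 3 (c - 2) y)) (at 0)"
proof -
  define \<sigma> where "\<sigma> s = 1 - (norm (y + s *\<^sub>R b))\<^sup>2" for s
  define s0 where "s0 = 1 - (norm y)\<^sup>2"
  have s0: "\<sigma> 0 = s0" by (simp add: \<sigma>_def s0_def)
  have p: "s0\<^sup>2 + \<epsilon>\<^sup>2 > 0" using assms by (simp add: add_nonneg_pos)
  have d\<sigma>: "(\<sigma> has_real_derivative - 2 * (y \<bullet> b)) (at 0)"
    unfolding \<sigma>_def[abs_def] power2_norm_eq_inner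
    by (auto intro!: derivative_eq_intros has_derivative_imp_has_field_derivative simp: algebra_simps inner_commute)
  have d1: "((\<lambda>s. (max 0 (\<sigma> s))\<^sup>2) has_real_derivative 2 * max 0 s0 * (- 2 * (y \<bullet> b))) (at 0)"
    using DERIV_chain2[OF has_real_derivative_max_0_square d\<sigma>] by (simp add: s0)
  have d2: "((\<lambda>s. ln ((\<sigma> s)\<^sup>2 + \<epsilon>\<^sup>2)) has_real_derivative 2 * s0 * (- 2 * (y \<bullet> b)) / (s0\<^sup>2 + \<epsilon>\<^sup>2)) (at 0)"
    using d\<sigma> p by (auto intro!: derivative_eq_intros simp: s0)
  let ?e = "exp (c / 2 * of_real (ln (s0\<^sup>2 + \<epsilon>\<^sup>2)))"
  have e: "((\<lambda>z. exp (c / 2 * z)) has_field_derivative c / 2 * exp (c / 2 * z)) (at z)" for z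
    by (auto intro!: derivative_eq_intros)
  have d3: "((\<lambda>s. exp (c / 2 * of_real (ln ((\<sigma> s)\<^sup>2 + \<epsilon>\<^sup>2)))) has_vector_derivative
     of_real (2 * s0 * (- 2 * (y \<bullet> b)) / (s0\<^sup>2 + \<epsilon>\<^sup>2)) * (c / 2 * ?e)) (at 0)"
    using field_vector_diff_chain_at[OF has_vector_derivative_of_real[OF d2] e]
    by (simp add: o_def s0)
  have e2: "exp ((c - 2) / 2 * complex_of_real (ln (s0\<^sup>2 + \<epsilon>\<^sup>2))) = ?e / of_real (s0\<^sup>2 + \<epsilon>\<^sup>2)"
  proof -
    have "exp ((c - 2) / 2 * complex_of_real (ln (s0\<^sup>2 + \<epsilon>\<^sup>2))) = ?e / exp (of_real (ln (s0\<^sup>2 + \<epsilon>\<^sup>2)))"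
      by (simp add: exp_diff[symmetric] algebra_simps diff_divide_distrib)
    then show ?thesis using p by (simp add: exp_of_real del: of_real_add of_real_power)
  qed
  have m: "(max 0 s0)\<^sup>2 * s0 = (max 0 s0) ^ 3" by (simp add: max_def power2_eq_square power3_eq_cube)
  have "((\<lambda>s. of_real ((max 0 (\<sigma> s))\<^sup>2) * exp (c / 2 * of_real (ln ((\<sigma> s)\<^sup>2 + \<epsilon>\<^sup>2)))) has_vector_derivative
     of_real ((max 0 s0)\<^sup>2) * (of_real (2 * s0 * (- 2 * (y \<bullet> b)) / (s0\<^sup>2 + \<epsilon>\<^sup>2)) * (c / 2 * ?e))
     + of_real (2 * max 0 s0 * (- 2 * (y \<bullet> b))) * ?e) (at 0)"
    using has_vector_derivative_mult[OF has_vector_derivative_of_real[OF d1] d3]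
    by (simp add: s0)
  also have "of_real ((max 0 s0)\<^sup>2) * (of_real (2 * s0 * (- 2 * (y \<bullet> b)) / (s0\<^sup>2 + \<epsilon>\<^sup>2)) * (c / 2 * ?e))
     + of_real (2 * max 0 s0 * (- 2 * (y \<bullet> b))) * ?e
    = of_real (- 2 * (y \<bullet> b)) * (2 * (of_real (max 0 s0 ^ 1) * ?e)
      + c * (of_real ((max 0 s0)\<^sup>2 * s0) * (?e / of_real (s0\<^sup>2 + \<epsilon>\<^sup>2))))"
    unfolding of_real_divide of_real_mult divide_inverse by (simp add: algebra_simps)
  also have "\<dots> = of_real (- 2 * (y \<bullet> b)) * (2 * reg_weight \<epsilon> 1 c y + c * reg_weight \<epsilon> 3 (c - 2) y)"
    unfolding reg_weight_def s0_def[symmetric] e2 m by simp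
  finally show ?thesis unfolding reg_weight_def \<sigma>_def .
qed

text \<open>The product of \<open>g\<close> with the regularised weight for \<open>k = 2\<close> and
  \<open>c = \<alpha> - 2\<close> is C^1 along \<open>b\<close> and supported in the unit ball, so
  the integral of its derivative is zero. In the limit the two terms have coefficients
  \<open>4\<close> and \<open>2 * (\<alpha> - 2)\<close>, which add up to
  \<open>2 * \<alpha>\<close>; \<open>Re \<alpha> > 0\<close> is the integrability of the limit
  weight \<open>\<alpha> - 1\<close>.\<close>

lemma integral_dir_deriv_ball_weight:
  fixes g g' :: "'a::euclidean_space \<Rightarrow> complex"
  assumes \<alpha>: "Re \<alpha> > 0"
    and d: "\<And>y. ((\<lambda>s. g (y + s *\<^sub>R b)) has_vector_derivative g' y) (at 0)"
    and cont: "continuous_on UNIV g" "continuous_on UNIV g'"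
  shows "(LINT y|lborel. g' y * ball_weight \<alpha> y)
    = 2 * \<alpha> * (LINT y|lborel. (of_real (y \<bullet> b) * g y) * ball_weight (\<alpha> - 1) y)"
proof -
  let ?c = "\<alpha> - 2" and ?h = "\<lambda>y. of_real (y \<bullet> b) * g y"
  have ch: "continuous_on UNIV ?h" using cont by (intro continuous_intros)
  have eq: "(LINT y|lborel. g' y * reg_weight \<epsilon> 2 ?c y) =
     4 * (LINT y|lborel. ?h y * reg_weight \<epsilon> 1 ?c y) + 2 * ?c * (LINT y|lborel. ?h y * reg_weight \<epsilon> 3 (?c - 2) y)"
    if e: "\<epsilon> > 0" for \<epsilon>
  proof -
    have int: "integrable lborel (\<lambda>y. f y * reg_weight \<epsilon> k c' y)"
      if "continuous_on UNIV f" "k \<ge> 1" for f :: "'a \<Rightarrow> complex" and k c'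
    proof -
      obtain l u where lu: "cball (0::'a) 1 \<subseteq> cbox l u"
        using bounded_subset_cbox_symmetric[OF bounded_cball, of "0::'a" 1] by blast
      show ?thesis
      proof (rule integrable_continuous_compact_support)
        show "f y * reg_weight \<epsilon> k c' y = 0" if "y \<notin> cbox l u" for y
          using that lu \<open>k \<ge> 1\<close> reg_weight_outside[of y k] by (force simp: subset_iff)
      qed (intro continuous_on_mult that continuous_on_reg_weight[OF e])
    qed
    let ?\<psi>' = "\<lambda>y. g y * (of_real (- 2 * (y \<bullet> b)) * (2 * reg_weight \<epsilon> 1 ?c y + ?c * reg_weight \<epsilon> 3 (?c - 2) y))
        + g' y * reg_weight \<epsilon> 2 ?c y"
    have "(LINT y|lborel. ?\<psi>' y) = 0"
    proof (rule integral_dir_deriv_eq_0(2)[where \<psi>="\<lambda>y. g y * reg_weight \<epsilon> 2 ?c y" and R=1 and b=b])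
      show "((\<lambda>s. g (y + s *\<^sub>R b) * reg_weight \<epsilon> 2 ?c (y + s *\<^sub>R b)) has_vector_derivative ?\<psi>' y) (at 0)" for y
        using has_vector_derivative_mult[OF d[of y] reg_weight_has_vector_derivative[OF e, of ?c y b]] by simp
    qed (auto intro!: continuous_intros cont continuous_on_reg_weight[OF e] reg_weight_outside)
    moreover have "?\<psi>' = (\<lambda>y. g' y * reg_weight \<epsilon> 2 ?c y
        - 4 * (?h y * reg_weight \<epsilon> 1 ?c y) - 2 * ?c * (?h y * reg_weight \<epsilon> 3 (?c - 2) y))"
      by (simp add: fun_eq_iff algebra_simps)
    ultimately show ?thesis
      using int[OF cont(2), of 2] int[OF ch, of 1] int[OF ch, of 3] by (simp add: diff_eq_eq add.commute)
  qed
  have t: "(\<lambda>j. LINT y|lborel. f y * reg_weight (1 / real (Suc j)) k c y) \<longlonglongrightarrow> (LINT y|lborel. f y * ball_weight \<gamma> y)"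
    if "continuous_on UNIV f" "k \<ge> 1" "Re \<gamma> > -1" "\<gamma> = of_nat k + c" for f :: "'a \<Rightarrow> complex" and k c \<gamma>
    using integral_reg_weight_tendsto[of f k c] that by simp
  let ?W = "LINT y|lborel. ?h y * ball_weight (\<alpha> - 1) y"
  have "(\<lambda>j. LINT y|lborel. g' y * reg_weight (1 / real (Suc j)) 2 ?c y) \<longlonglongrightarrow> 4 * ?W + 2 * ?c * ?W"
  proof (subst eq)
    show "(\<lambda>j. 4 * (LINT y|lborel. ?h y * reg_weight (1 / real (Suc j)) 1 ?c y)
        + 2 * ?c * (LINT y|lborel. ?h y * reg_weight (1 / real (Suc j)) 3 (?c - 2) y)) \<longlonglongrightarrow> 4 * ?W + 2 * ?c * ?W"
      using \<alpha> by (intro tendsto_add tendsto_mult_left t ch) auto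
  qed simp
  moreover have "(\<lambda>j. LINT y|lborel. g' y * reg_weight (1 / real (Suc j)) 2 ?c y)
      \<longlonglongrightarrow> (LINT y|lborel. g' y * ball_weight \<alpha> y)"
    using \<alpha> cont by (intro t) auto
  ultimately have "(LINT y|lborel. g' y * ball_weight \<alpha> y) = 4 * ?W + 2 * ?c * ?W"
    using LIMSEQ_unique by blast
  then show ?thesis by (simp add: algebra_simps)
qed

section \<open>Weighted ball means\<close>

definition mean_coeff :: "nat \<Rightarrow> complex \<Rightarrow> complex" where
  "mean_coeff n \<alpha> = Gamma (\<alpha> + of_nat n / 2) / (of_real (pi powr (real n / 2)) * Gamma \<alpha>)"

text \<open>The mean over the ball of radius \<open>t\<close>, rescaled to the unit ball:
  \<open>t\<close> occurs only in the argument of \<open>f\<close>, and the integral makes sense for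
  \<open>t \<le> 0\<close> as well.\<close>

definition ball_integral :: "complex \<Rightarrow> ('a::euclidean_space \<Rightarrow> complex) \<Rightarrow> 'a \<times> real \<Rightarrow> complex" where
  "ball_integral \<gamma> f = (\<lambda>(x, t). LINT y|lborel. f (x - t *\<^sub>R y) * ball_weight \<gamma> y)"

definition ball_mean :: "complex \<Rightarrow> ('a::euclidean_space \<Rightarrow> complex) \<Rightarrow> 'a \<times> real \<Rightarrow> complex" where
  "ball_mean \<alpha> f p = mean_coeff DIM('a) \<alpha> * ball_integral (\<alpha> - 1) f p"

lemma not_nonpos_Int_Re_pos: "Re z > 0 \<Longrightarrow> z \<notin> \<int>\<^sub>\<le>\<^sub>0"
  by (auto elim!: nonpos_Ints_cases)

lemma mean_coeff_Suc:
  assumes "Re \<alpha> > 0"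
  shows "mean_coeff n (\<alpha> + 1) = (2 * \<alpha> + of_nat n) / (2 * \<alpha>) * mean_coeff n \<alpha>"
proof -
  have "\<alpha> + of_nat n / 2 \<notin> \<int>\<^sub>\<le>\<^sub>0" "\<alpha> \<notin> \<int>\<^sub>\<le>\<^sub>0" using assms by (auto intro!: not_nonpos_Int_Re_pos add_pos_nonneg)
  then have g: "Gamma (\<alpha> + 1 + of_nat n / 2) = (\<alpha> + of_nat n / 2) * Gamma (\<alpha> + of_nat n / 2)"
    "Gamma (\<alpha> + 1) = \<alpha> * Gamma \<alpha>" "Gamma \<alpha> \<noteq> 0" 
    using Gamma_plus1[of "\<alpha> + of_nat n / 2"] Gamma_plus1[of \<alpha>]
    by (simp_all add: algebra_simps Gamma_eq_zero_iff)
  have "\<alpha> \<noteq> 0" using assms by auto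
  have e: "((\<alpha> + M / 2) * X) / (P * (\<alpha> * Y)) = (2 * \<alpha> + M) / (2 * \<alpha>) * (X / (P * Y))"
    if "P \<noteq> 0" "Y \<noteq> 0" for M X P Y :: complex
    using that \<open>\<alpha> \<noteq> 0\<close> by (simp add: divide_simps)
  show ?thesis unfolding mean_coeff_def g(1,2) by (rule e) (use g(3) in auto)
qed

lemma continuous_on_scaled_arg:
  "smooth f \<Longrightarrow> continuous_on S (\<lambda>y. f (x - t *\<^sub>R y))"
  by (rule smooth_continuous_on_compose) (auto intro!: continuous_intros)

lemma has_vector_derivative_scaled_arg:
  assumes "smooth f"
  shows "((\<lambda>s. f (x - t *\<^sub>R (y + s *\<^sub>R b))) has_vector_derivative of_real (- t) * dir_deriv b f (x - t *\<^sub>R y)) (at 0)"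
proof -
  have "((\<lambda>s. f ((x - t *\<^sub>R y) + s *\<^sub>R ((- t) *\<^sub>R b))) has_vector_derivative dir_deriv ((- t) *\<^sub>R b) f (x - t *\<^sub>R y)) (at 0)"
    using has_vector_derivative_line[OF smooth_differentiable[OF assms], where s=0 and v="(- t) *\<^sub>R b" and x="x - t *\<^sub>R y"] by simp
  moreover have "dir_deriv ((- t) *\<^sub>R b) f (x - t *\<^sub>R y) = of_real (- t) * dir_deriv b f (x - t *\<^sub>R y)"
    using linear_scale[OF linear_dir_deriv[OF smooth_differentiable[OF assms]], of "- t" b]
    by (simp add: scaleR_conv_of_real)
  ultimately show ?thesis by (simp add: algebra_simps)
qed

lemma integrable_ball_integral:
  assumes "smooth f" "Re \<gamma> > -1" "continuous_on UNIV h"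
  shows "integrable lborel (\<lambda>y. (h y * f (x - t *\<^sub>R y)) * ball_weight \<gamma> y)"
  using assms by (intro integrable_mult_ball_weight continuous_intros continuous_on_scaled_arg) auto

text \<open>The weight \<open>(y \<bullet> b) * ball_weight (\<alpha> - 1) y\<close> is the
  derivative of \<open>ball_weight \<alpha>\<close> in direction \<open>b\<close>, up to the factor
  \<open>- 2 * \<alpha>\<close>. Moving that derivative onto \<open>dir_deriv b f\<close> and
  summing produces the Laplacian; each inner derivative contributes \<open>- t\<close>.\<close>

lemma integral_inner_gradient:
  fixes f :: "'a::euclidean_space \<Rightarrow> complex"
  assumes f: "smooth f" and \<alpha>: "Re \<alpha> > 0"
  shows "2 * \<alpha> * (\<Sum>b\<in>Basis. LINT y|lborel. (of_real (y \<bullet> b) * dir_deriv b f (x - t *\<^sub>R y)) * ball_weight (\<alpha> - 1) y)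
     = - of_real t * ball_integral \<alpha> (laplacian f) (x, t)"
proof -
  have i: "integrable lborel (\<lambda>y. dir_deriv b (dir_deriv b f) (x - t *\<^sub>R y) * ball_weight \<alpha> y)" for b
    using integrable_ball_integral[OF smooth_dir_deriv[OF smooth_dir_deriv[OF f]], of \<alpha> "\<lambda>_. 1"] \<alpha> by simp
  have "2 * \<alpha> * (LINT y|lborel. (of_real (y \<bullet> b) * dir_deriv b f (x - t *\<^sub>R y)) * ball_weight (\<alpha> - 1) y)
    = - of_real t * (LINT y|lborel. dir_deriv b (dir_deriv b f) (x - t *\<^sub>R y) * ball_weight \<alpha> y)" for b
    using integral_dir_deriv_ball_weight[OF \<alpha> has_vector_derivative_scaled_arg[OF smooth_dir_deriv[OF f]]
        continuous_on_scaled_arg[OF smooth_dir_deriv[OF f]], of t b b x]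
      continuous_on_scaled_arg[OF smooth_dir_deriv[OF smooth_dir_deriv[OF f]]]
    by (simp add: continuous_on_mult_left mult.assoc continuous_on_minus)
  then show ?thesis
    using i by (simp add: ball_integral_def laplacian_def sum_distrib_left sum_distrib_right)
qed

lemma eq_neg_divide_mult: "c \<noteq> 0 \<Longrightarrow> c * S = - T * J \<Longrightarrow> S = - T / c * (J::complex)"
  by (simp add: field_simps)

text \<open>Integrate by parts with the functions \<open>(y \<bullet> b) * f (x - t y)\<close> and
  sum over \<open>b\<close>. The divergence of \<open>y\<close> contributes the dimension, the
  radial derivative of \<open>f\<close> becomes a Laplacian by
  \<open>integral_inner_gradient\<close> at \<open>\<alpha> + 1\<close>, and
  \<open>ball_weight_recurrence\<close> removes the factor \<open>|y|^2\<close>.\<close>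

lemma ball_integral_recurrence:
  fixes f :: "'a::euclidean_space \<Rightarrow> complex"
  assumes f: "smooth f" and \<alpha>: "Re \<alpha> > 0"
  shows "2 * \<alpha> * ball_integral (\<alpha> - 1) f (x, t) = (of_nat DIM('a) + 2 * \<alpha>) * ball_integral \<alpha> f (x, t)
     + of_real t ^ 2 / (2 * (\<alpha> + 1)) * ball_integral (\<alpha> + 1) (laplacian f) (x, t)"
proof -
  let ?f = "\<lambda>y. f (x - t *\<^sub>R y)"
  let ?D = "\<lambda>b y. of_real (y \<bullet> b) * dir_deriv b f (x - t *\<^sub>R y)"
  have c: "continuous_on UNIV (\<lambda>y. complex_of_real (y \<bullet> b))" for b :: 'a by (intro continuous_intros)
  have i1: "integrable lborel (\<lambda>y. ?f y * ball_weight \<gamma> y)" if "Re \<gamma> > -1" for \<gamma>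
    using integrable_ball_integral[OF f that, of "\<lambda>_. 1"] by simp
  have i2: "integrable lborel (\<lambda>y. ?D b y * ball_weight \<alpha> y)" for b
    using integrable_ball_integral[OF smooth_dir_deriv[OF f] _ c] \<alpha> by simp
  have i3: "integrable lborel (\<lambda>y. (of_real ((y \<bullet> b)\<^sup>2) * ?f y) * ball_weight (\<alpha> - 1) y)" for b
    using \<alpha> by (intro integrable_ball_integral f continuous_intros) auto
  have 1: "ball_integral \<alpha> f (x, t) - of_real t * (LINT y|lborel. ?D b y * ball_weight \<alpha> y)
      = 2 * \<alpha> * (LINT y|lborel. (of_real ((y \<bullet> b)\<^sup>2) * ?f y) * ball_weight (\<alpha> - 1) y)" if b: "b \<in> Basis" for b
  proof -
    have "((\<lambda>s. of_real ((y + s *\<^sub>R b) \<bullet> b) * f (x - t *\<^sub>R (y + s *\<^sub>R b))) has_vector_derivative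
       (?f y - of_real t * ?D b y)) (at 0)" for y
    proof -
      have "((\<lambda>s. (y + s *\<^sub>R b) \<bullet> b) has_real_derivative 1) (at 0)"
        using b by (simp add: inner_add_left) (auto intro!: derivative_eq_intros)
      from has_vector_derivative_mult[OF has_vector_derivative_of_real[OF this] has_vector_derivative_scaled_arg[OF f, of x t y b]]
      show ?thesis by (simp add: algebra_simps)
    qed
    from integral_dir_deriv_ball_weight[OF \<alpha> this]
    have "(LINT y|lborel. (?f y - of_real t * ?D b y) * ball_weight \<alpha> y)
       = 2 * \<alpha> * (LINT y|lborel. (of_real (y \<bullet> b) * (of_real (y \<bullet> b) * ?f y)) * ball_weight (\<alpha> - 1) y)"
      by (simp add: continuous_intros continuous_on_scaled_arg f smooth_dir_deriv)
    moreover have "(LINT y|lborel. (?f y - of_real t * ?D b y) * ball_weight \<alpha> y)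
      = ball_integral \<alpha> f (x, t) - of_real t * (LINT y|lborel. ?D b y * ball_weight \<alpha> y)"
      using i1[of \<alpha>] i2[of b] \<alpha> by (simp add: left_diff_distrib ball_integral_def mult.assoc)
    ultimately show ?thesis by (simp add: power2_eq_square mult.assoc)
  qed
  have "(\<Sum>b\<in>Basis. LINT y|lborel. (of_real ((y \<bullet> b)\<^sup>2) * ?f y) * ball_weight (\<alpha> - 1) y)
    = (LINT y|lborel. ?f y * ball_weight (\<alpha> - 1) y - ?f y * ball_weight \<alpha> y)"
  proof -
    have "(\<Sum>b\<in>Basis. (of_real ((y \<bullet> b)\<^sup>2) * ?f y) * ball_weight (\<alpha> - 1) y)
      = ?f y * (of_real ((norm y)\<^sup>2) * ball_weight (\<alpha> - 1) y)" for y
      unfolding power2_norm_eq_inner euclidean_inner[of y y]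
      by (simp add: sum_distrib_left sum_distrib_right power2_eq_square mult_ac)
    then show ?thesis
      unfolding ball_weight_recurrence using i3 by (simp add: right_diff_distrib flip: Bochner_Integration.integral_sum)
  qed
  also have "\<dots> = ball_integral (\<alpha> - 1) f (x, t) - ball_integral \<alpha> f (x, t)"
    using i1[of \<alpha>] i1[of "\<alpha> - 1"] \<alpha> by (simp add: ball_integral_def)
  finally have 2: "(\<Sum>b\<in>Basis. LINT y|lborel. (of_real ((y \<bullet> b)\<^sup>2) * ?f y) * ball_weight (\<alpha> - 1) y)
    = ball_integral (\<alpha> - 1) f (x, t) - ball_integral \<alpha> f (x, t)" .
  have "of_nat DIM('a) * ball_integral \<alpha> f (x, t) - of_real t * (\<Sum>b\<in>Basis. LINT y|lborel. ?D b y * ball_weight \<alpha> y)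
     = (\<Sum>b\<in>Basis. ball_integral \<alpha> f (x, t) - of_real t * (LINT y|lborel. ?D b y * ball_weight \<alpha> y))"
    by (simp add: sum_subtractf sum_distrib_left)
  also have "\<dots> = 2 * \<alpha> * (ball_integral (\<alpha> - 1) f (x, t) - ball_integral \<alpha> f (x, t))"
    unfolding 2[symmetric] sum_distrib_left by (intro sum.cong 1 refl)
  finally have 3: "of_nat DIM('a) * ball_integral \<alpha> f (x, t) - of_real t * (\<Sum>b\<in>Basis. LINT y|lborel. ?D b y * ball_weight \<alpha> y)
     = 2 * \<alpha> * (ball_integral (\<alpha> - 1) f (x, t) - ball_integral \<alpha> f (x, t))" .
  have "Re (2 * (\<alpha> + 1)) \<noteq> 0" using \<alpha> by simp
  then have "2 * (\<alpha> + 1) \<noteq> 0" by (metis zero_complex.sel(1))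
  then have "(\<Sum>b\<in>Basis. LINT y|lborel. ?D b y * ball_weight \<alpha> y)
      = - of_real t / (2 * (\<alpha> + 1)) * ball_integral (\<alpha> + 1) (laplacian f) (x, t)"
    using integral_inner_gradient[OF f, of "\<alpha> + 1" x t] \<alpha> by (intro eq_neg_divide_mult) auto
  from 3[unfolded this] show ?thesis by (simp add: left_diff_distrib right_diff_distrib distrib_right power2_eq_square mult.assoc eq_diff_eq add_ac)
qed

text \<open>The normalising constants absorb the factors \<open>2 * \<alpha>\<close> and
  \<open>N + 2 * \<alpha>\<close> of the previous identity, so the first term on the right has
  coefficient \<open>1\<close>.\<close>

lemma ball_mean_recurrence:
  fixes f :: "'a::euclidean_space \<Rightarrow> complex"
  assumes f: "smooth f" and \<alpha>: "Re \<alpha> > 0"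
  defines "N \<equiv> of_nat DIM('a)"
  shows "ball_mean \<alpha> f (x, t) = ball_mean (\<alpha> + 1) f (x, t)
    + of_real t ^ 2 / ((N + 2 * \<alpha>) * (N + 2 * \<alpha> + 2)) * ball_mean (\<alpha> + 2) (laplacian f) (x, t)"
proof -
  have nz: "\<alpha> \<noteq> 0" "\<alpha> + 1 \<noteq> 0" "N + 2 * \<alpha> \<noteq> 0" "N + 2 * \<alpha> + 2 \<noteq> 0"
    using \<alpha> by (auto simp: complex_eq_iff N_def)
  have c1: "mean_coeff DIM('a) (\<alpha> + 1) = (N + 2 * \<alpha>) / (2 * \<alpha>) * mean_coeff DIM('a) \<alpha>"
    using mean_coeff_Suc[OF \<alpha>] by (simp add: N_def add.commute)
  have c2: "mean_coeff DIM('a) (\<alpha> + 2) = (N + 2 * \<alpha> + 2) / (2 * (\<alpha> + 1)) * mean_coeff DIM('a) (\<alpha> + 1)"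
    using mean_coeff_Suc[of "\<alpha> + 1"] \<alpha> by (simp add: N_def algebra_simps)
  have "ball_mean \<alpha> f (x, t) = mean_coeff DIM('a) \<alpha> / (2 * \<alpha>) * (2 * \<alpha> * ball_integral (\<alpha> - 1) f (x, t))"
    using nz by (simp add: ball_mean_def)
  also have "\<dots> = mean_coeff DIM('a) \<alpha> / (2 * \<alpha>) * ((N + 2 * \<alpha>) * ball_integral \<alpha> f (x, t)
     + of_real t ^ 2 / (2 * (\<alpha> + 1)) * ball_integral (\<alpha> + 1) (laplacian f) (x, t))"
    by (simp only: ball_integral_recurrence[OF f \<alpha>] N_def)
  also have "\<dots> = mean_coeff DIM('a) (\<alpha> + 1) * ball_integral \<alpha> f (x, t)
     + of_real t ^ 2 / ((N + 2 * \<alpha>) * (N + 2 * \<alpha> + 2)) * (mean_coeff DIM('a) (\<alpha> + 2) * ball_integral (\<alpha> + 1) (laplacian f) (x, t))"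
  proof -
    have e: "m / A * (B * I + T / C * J) = B / A * m * I + T / (B * E) * (E / C * (B / A * m) * J)"
      if "A \<noteq> 0" "B \<noteq> 0" "C \<noteq> 0" "E \<noteq> 0" for A B C E m I J T :: complex
      using that by (simp add: field_simps)
    have "2 * \<alpha> \<noteq> 0" "2 * (\<alpha> + 1) \<noteq> 0" using nz(1,2) by (metis mult_eq_0_iff zero_neq_numeral)+
    with nz show ?thesis unfolding c2 c1 by (intro e)
  qed
  moreover have "\<alpha> + 1 - 1 = \<alpha>" "\<alpha> + 2 - 1 = \<alpha> + 1" by simp_all
  ultimately show ?thesis unfolding ball_mean_def by (simp only:)
qed

lemma unit_ball_subset_cbox:
  obtains l u :: "'a::euclidean_space" where "\<And>y. norm y \<le> 1 \<Longrightarrow> y \<in> cbox l u"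
  using bounded_subset_cbox_symmetric[OF bounded_cball, of "0::'a" 1] by (metis mem_cball_0 subset_eq)

text \<open>Differentiation under the integral, jointly in space and time. The time direction gives
  minus the radial derivative of \<open>f\<close>, which \<open>integral_inner_gradient\<close>
  turns into \<open>t\<close> times a mean of the Laplacian. For \<open>Re \<alpha> > 2\<close> the
  weight is continuous, so the Leibniz rule on a box applies.\<close>

lemma ball_mean_has_derivative:
  fixes f :: "'a::euclidean_space \<Rightarrow> complex"
  assumes f: "smooth f" and \<alpha>: "Re \<alpha> > 2"
  shows "(ball_mean \<alpha> f has_derivative (\<lambda>q. ball_mean \<alpha> (dir_deriv (fst q) f) (x, t)
    + of_real (snd q) * (of_real t / (of_nat DIM('a) + 2 * \<alpha>) * ball_mean (\<alpha> + 1) (laplacian f) (x, t)))) (at (x, t))"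
proof -
  let ?w = "ball_weight (\<alpha> - 1) :: 'a \<Rightarrow> complex"
  obtain l u :: 'a where lu: "\<And>y. norm y \<le> 1 \<Longrightarrow> y \<in> cbox l u" using unit_ball_subset_cbox by blast
  have out: "?w y = 0" if "y \<notin> cbox l u" for y using lu[of y] that by (intro ball_weight_outside) linarith
  define A where "A p y = (\<lambda>q. dir_deriv (fst q - snd q *\<^sub>R y) f (fst p - snd p *\<^sub>R y) * ?w y)" for p :: "'a \<times> real" and y
  have dA: "((\<lambda>p. f (fst p - snd p *\<^sub>R y) * ?w y) has_derivative A p y) (at p)" for p y
  proof -
    have "((\<lambda>p. fst p - snd p *\<^sub>R y) has_derivative (\<lambda>q. fst q - snd q *\<^sub>R y)) (at p)"
      by (auto intro!: derivative_eq_intros)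
    from has_derivative_mult_left[OF has_derivative_compose[OF this smooth_has_derivative[OF f]]]
    show ?thesis unfolding A_def .
  qed
  note bl = has_derivative_bounded_linear[OF dA]
  have A_eq: "A p y q = dir_deriv (fst q) f (fst p - snd p *\<^sub>R y) * ?w y
      - of_real (snd q) * (\<Sum>b\<in>Basis. (of_real (y \<bullet> b) * dir_deriv b f (fst p - snd p *\<^sub>R y)) * ?w y)" for p y q
  proof -
    have "dir_deriv (fst q - snd q *\<^sub>R y) f z = dir_deriv (fst q) f z - of_real (snd q) * dir_deriv y f z" for z
      using linear_diff[OF linear_dir_deriv[OF smooth_differentiable[OF f]]]
        linear_scale[OF linear_dir_deriv[OF smooth_differentiable[OF f]]]
      by (simp add: scaleR_conv_of_real)
    moreover have "dir_deriv y f z = (\<Sum>b\<in>Basis. of_real (y \<bullet> b) * dir_deriv b f z)" for z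
      using dir_deriv_Basis[OF smooth_differentiable[OF f], of y] by (simp add: scaleR_conv_of_real)
    ultimately show ?thesis unfolding A_def
      by (simp only:) (simp add: left_diff_distrib sum_distrib_left sum_distrib_right mult.assoc)
  qed
  have cd: "continuous_on S (\<lambda>z. dir_deriv v f (fst (fst z) - snd (fst z) *\<^sub>R snd z))"
    for v and S :: "(('a \<times> real) \<times> 'a) set"
    by (rule smooth_continuous_on_compose[OF smooth_dir_deriv[OF f]]) (auto intro!: continuous_intros)
  \<comment> \<open>The Leibniz rule asks for continuity in operator norm; in finite dimension it
    suffices to test on each vector \<open>q\<close>.\<close>
  have Acont: "continuous_on (UNIV \<times> cbox l u) (\<lambda>(p, y). Blinfun (A p y))"
  proof (rule continuous_on_blinfun_componentwise)
    fix q :: "'a \<times> real"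
    have "continuous_on (UNIV \<times> cbox l u) (\<lambda>z. A (fst z) (snd z) q)"
      unfolding A_eq using \<alpha> by (intro continuous_intros cd) auto
    then show "continuous_on (UNIV \<times> cbox l u) (\<lambda>z. blinfun_apply (case z of (p, y) \<Rightarrow> Blinfun (A p y)) q)"
      by (simp add: split_beta bounded_linear_Blinfun_apply[OF bl])
  qed
  have Acont1: "continuous_on (cbox l u) (\<lambda>y. Blinfun (A (x, t) y))"
    by (rule continuous_on_compose2[OF Acont, of _ "\<lambda>y. ((x, t), y)", simplified]) (auto intro!: continuous_intros)
  have "((\<lambda>p. integral (cbox l u) (\<lambda>y. f (fst p - snd p *\<^sub>R y) * ?w y)) has_derivative
     integral (cbox l u) (\<lambda>y. Blinfun (A (x, t) y))) (at (x, t) within UNIV)"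
  proof (rule leibniz_rule)
    show "((\<lambda>p. f (fst p - snd p *\<^sub>R y) * ?w y) has_derivative blinfun_apply (Blinfun (A p y))) (at p within UNIV)" for p y
      using dA by (simp add: bounded_linear_Blinfun_apply[OF bl])
    show "(\<lambda>y. f (fst p - snd p *\<^sub>R y) * ?w y) integrable_on cbox l u" for p
      using \<alpha> by (intro integrable_continuous continuous_intros continuous_on_scaled_arg f) auto
  qed (use Acont in auto)
  moreover have "integral (cbox l u) (\<lambda>y. f (fst p - snd p *\<^sub>R y) * ?w y) = ball_integral (\<alpha> - 1) f p" for p
    unfolding ball_integral_def split_beta using \<alpha> out
    by (intro integrable_continuous_compact_support(2)[symmetric])
      (auto intro!: continuous_intros continuous_on_scaled_arg f)
  ultimately have D: "(ball_integral (\<alpha> - 1) f has_derivative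
      blinfun_apply (integral (cbox l u) (\<lambda>y. Blinfun (A (x, t) y)))) (at (x, t))"
    by simp
  have E: "blinfun_apply (integral (cbox l u) (\<lambda>y. Blinfun (A (x, t) y))) q =
     ball_integral (\<alpha> - 1) (dir_deriv (fst q) f) (x, t)
     + of_real (snd q) * (of_real t / (2 * \<alpha>) * ball_integral \<alpha> (laplacian f) (x, t))" for q
  proof -
    have cA: "continuous_on UNIV (\<lambda>y. A (x, t) y q)"
      unfolding A_eq using \<alpha> by (intro continuous_intros continuous_on_scaled_arg smooth_dir_deriv f) (auto intro!: continuous_on_scaled_arg smooth_dir_deriv f)
    have "blinfun_apply (integral (cbox l u) (\<lambda>y. Blinfun (A (x, t) y))) q = integral (cbox l u) (\<lambda>y. A (x, t) y q)"
      using blinfun_apply_integral[OF integrable_continuous[OF Acont1]]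
      by (simp add: bounded_linear_Blinfun_apply[OF bl])
    also have "\<dots> = (LINT y|lborel. A (x, t) y q)"
      using out by (intro integrable_continuous_compact_support(2)[symmetric] cA) (simp add: A_def)
    also have "\<dots> = ball_integral (\<alpha> - 1) (dir_deriv (fst q) f) (x, t)
        - of_real (snd q) * (\<Sum>b\<in>Basis. LINT y|lborel. (of_real (y \<bullet> b) * dir_deriv b f (x - t *\<^sub>R y)) * ?w y)"
    proof -
      have i1: "integrable lborel (\<lambda>y. dir_deriv (fst q) f (x - t *\<^sub>R y) * ?w y)"
        using integrable_ball_integral[OF smooth_dir_deriv[OF f], of "\<alpha> - 1" "\<lambda>_. 1"] \<alpha> by simp
      have i2: "integrable lborel (\<lambda>y. (of_real (y \<bullet> b) * dir_deriv b f (x - t *\<^sub>R y)) * ?w y)" for b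
        using \<alpha> by (intro integrable_ball_integral smooth_dir_deriv f continuous_intros) auto
      show ?thesis unfolding A_eq using i1 i2 by (simp add: ball_integral_def)
    qed
    also have "(\<Sum>b\<in>Basis. LINT y|lborel. (of_real (y \<bullet> b) * dir_deriv b f (x - t *\<^sub>R y)) * ?w y)
        = - of_real t / (2 * \<alpha>) * ball_integral \<alpha> (laplacian f) (x, t)"
    proof -
      have "2 * \<alpha> \<noteq> 0" using \<alpha> by auto
      then show ?thesis using integral_inner_gradient[OF f, of \<alpha> x t] \<alpha> by (intro eq_neg_divide_mult) auto
    qed
    finally show ?thesis by simp
  qed
  have "(ball_integral (\<alpha> - 1) f has_derivative (\<lambda>q. ball_integral (\<alpha> - 1) (dir_deriv (fst q) f) (x, t)
     + of_real (snd q) * (of_real t / (2 * \<alpha>) * ball_integral \<alpha> (laplacian f) (x, t)))) (at (x, t))"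
    by (rule has_derivative_eq_rhs[OF D]) (rule ext, rule E)
  note D = has_derivative_mult_right[OF this, of "mean_coeff DIM('a) \<alpha>"]
  have C: "mean_coeff DIM('a) \<alpha> * (of_real t / (2 * \<alpha>) * J)
      = of_real t / (of_nat DIM('a) + 2 * \<alpha>) * (mean_coeff DIM('a) (\<alpha> + 1) * J)" for J
  proof -
    have nz: "\<alpha> \<noteq> 0" "of_nat DIM('a) + 2 * \<alpha> \<noteq> 0" using \<alpha> by (auto simp: complex_eq_iff)
    have c: "mean_coeff DIM('a) (\<alpha> + 1) = (of_nat DIM('a) + 2 * \<alpha>) / (2 * \<alpha>) * mean_coeff DIM('a) \<alpha>"
      using mean_coeff_Suc[of \<alpha>] \<alpha> by (simp add: add.commute)
    have e: "m * (T / A * J) = T / B * (B / A * m * J)" if "A \<noteq> 0" "B \<noteq> 0" for m T A B :: complex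
      using that by (simp add: field_simps)
    show ?thesis unfolding c using nz by (intro e) auto
  qed
  have C': "m * (K + \<tau> * L) = m * K + \<tau> * (m * L)" for m K \<tau> L :: complex
    by (simp add: algebra_simps)
  have "\<alpha> + 1 - 1 = \<alpha>" by simp
  with D show ?thesis unfolding ball_mean_def[abs_def] C' C by (simp only:)
qed

section \<open>Holomorphy in the parameter, normalisation, and the link with the integral
  formula\<close>

lemma continuous_on_x_ln_x: "continuous_on {0..} (\<lambda>x::real. x * ln x)"
proof -
  have "isCont (\<lambda>x. x * ln x) x" if "x > 0" for x :: real
    using that by (auto intro!: continuous_intros)
  moreover have "((\<lambda>x. x * ln x) \<longlongrightarrow> 0) (at 0 within {0::real..})"
  proof (rule Lim_null_comparison)
    have "norm (x * ln x) \<le> 2 * sqrt x" if "x \<in> {0<..<1}" for x :: real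
    proof -
      \<comment> \<open>The bound \<open>ln z \<le> z\<close> at \<open>z = 1 / sqrt x\<close>
        trades the logarithm for half a power of \<open>x\<close>.\<close>
      have "ln (1 / sqrt x) \<le> 1 / sqrt x" using that ln_bound[of "1 / sqrt x"] by simp
      then have "- ln x \<le> 2 * (1 / sqrt x)" using that by (simp add: ln_div ln_sqrt)
      then have "x * - ln x \<le> x * (2 * (1 / sqrt x))" using that by (intro mult_left_mono) auto
      also have "\<dots> = 2 * (x / sqrt x)" by simp
      also have "\<dots> = 2 * sqrt x" using that by (simp only: real_div_sqrt[OF less_imp_le] greaterThanLessThan_iff)
      finally show ?thesis using that by (simp add: abs_mult)
    qed
    then show "\<forall>\<^sub>F x in at 0 within {0::real..}. norm (x * ln x) \<le> 2 * sqrt x"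
      unfolding eventually_at by (intro exI[of _ 1]) (auto simp: dist_real_def)
    show "((\<lambda>x. 2 * sqrt x) \<longlongrightarrow> 0) (at 0 within {0::real..})" by (auto intro!: tendsto_eq_intros)
  qed
  ultimately show ?thesis
    unfolding continuous_on_eq_continuous_within
    by (metis atLeast_iff continuous_at_imp_continuous_at_within continuous_within less_eq_real_def mult_zero_left)
qed

text \<open>The logarithm is unbounded at the sphere, so one factor \<open>1 - |y|^2\<close> is
  split off the power: \<open>s * ln s\<close> extends continuously to \<open>s = 0\<close>. The
  remaining exponent \<open>\<beta> - 2\<close> is the source of the half-plane
  \<open>Re \<beta> > 2\<close>.\<close>

lemma ball_weight_has_field_derivative:
  "((\<lambda>\<beta>. ball_weight (\<beta> - 1) y) has_field_derivative
     ball_weight (\<beta> - 2) y * of_real (max 0 (1 - (norm y)\<^sup>2) * ln (max 0 (1 - (norm y)\<^sup>2)))) (at \<beta> within S)"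
proof (cases "norm y < 1")
  case True
  define s where "s = 1 - (norm y)\<^sup>2"
  have s: "s > 0" using True norm_less_1_iff[of y] by (simp add: s_def)
  have "((\<lambda>\<beta>. complex_of_real s powr (\<beta> - 1)) has_field_derivative
     of_real s powr (\<beta> - 1) * of_real (ln s)) (at \<beta> within S)"
    using s unfolding powr_def by (auto intro!: derivative_eq_intros simp: Ln_of_real)
  moreover have "of_real s powr (\<beta> - 1) = of_real s powr (\<beta> - 2) * complex_of_real s"
    using s powr_add[of "complex_of_real s" "\<beta> - 2" 1] by simp
  ultimately show ?thesis
    using True s by (simp add: ball_weight_def mult.assoc max_def s_def)
qed (simp add: ball_weight_outside)

lemma ball_integral_holomorphic:
  assumes f: "smooth f"
  shows "(\<lambda>\<beta>. ball_integral (\<beta> - 1) f (x, t)) holomorphic_on {\<beta>. Re \<beta> > 2}"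
proof -
  obtain l u :: 'a where lu: "\<And>y. norm y \<le> 1 \<Longrightarrow> y \<in> cbox l u" using unit_ball_subset_cbox by blast
  let ?f = "\<lambda>y. f (x - t *\<^sub>R y)"
  have c: "continuous_on S (\<lambda>z. ?f (snd z))" for S :: "(complex \<times> 'a) set"
    by (rule smooth_continuous_on_compose[OF f]) (auto intro!: continuous_intros)
  have "(\<lambda>\<beta>. integral (cbox l u) (\<lambda>y. ?f y * ball_weight (\<beta> - 1) y)) holomorphic_on {\<beta>. Re \<beta> > 2}"
  proof (rule leibniz_rule_holomorphic)
    show "((\<lambda>\<beta>. ?f y * ball_weight (\<beta> - 1) y) has_field_derivative
       ?f y * (ball_weight (\<beta> - 2) y * of_real (max 0 (1 - (norm y)\<^sup>2) * ln (max 0 (1 - (norm y)\<^sup>2)))))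
       (at \<beta> within {\<beta>. Re \<beta> > 2})" for \<beta> y
      by (rule DERIV_cmult[OF ball_weight_has_field_derivative])
    show "(\<lambda>y. ?f y * ball_weight (\<beta> - 1) y) integrable_on cbox l u" if "\<beta> \<in> {\<beta>. Re \<beta> > 2}" for \<beta>
      using that by (intro integrable_continuous continuous_on_mult continuous_on_scaled_arg[OF f] continuous_on_ball_weight)
        (auto intro!: continuous_intros)
    have "continuous_on ({\<beta>. Re \<beta> > 2} \<times> cbox l u)
        (\<lambda>z. (\<lambda>x. x * ln x) (max 0 (1 - (norm (snd z))\<^sup>2)))"
      by (rule continuous_on_compose2[OF continuous_on_x_ln_x]) (auto intro!: continuous_intros)
    note c3 = continuous_on_of_real[OF this]
    have "continuous_on ({\<beta>. Re \<beta> > 2} \<times> cbox l u) (\<lambda>z. ball_weight (fst z - 2) (snd z))"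
      by (rule continuous_on_ball_weight) (auto intro!: continuous_intros)
    from continuous_on_mult[OF c continuous_on_mult[OF this c3]]
    show "continuous_on ({\<beta>. Re \<beta> > 2} \<times> cbox l u) (\<lambda>(\<beta>, y). ?f y *
       (ball_weight (\<beta> - 2) y * of_real (max 0 (1 - (norm y)\<^sup>2) * ln (max 0 (1 - (norm y)\<^sup>2)))))"
      unfolding split_beta .
  qed (rule convex_halfspace_Re_gt)
  moreover have "integral (cbox l u) (\<lambda>y. ?f y * ball_weight (\<beta> - 1) y) = ball_integral (\<beta> - 1) f (x, t)"
    if "Re \<beta> > 2" for \<beta>
    unfolding ball_integral_def split_conv
  proof (rule integrable_continuous_compact_support(2)[symmetric])
    show "continuous_on UNIV (\<lambda>y. ?f y * ball_weight (\<beta> - 1) y)"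
      using that by (intro continuous_on_mult continuous_on_scaled_arg[OF f] continuous_on_ball_weight)
        (auto intro!: continuous_intros)
    show "?f y * ball_weight (\<beta> - 1) y = 0" if "y \<notin> cbox l u" for y
      using lu[of y] that ball_weight_outside[of y] by fastforce
  qed
  ultimately show ?thesis by (auto elim: holomorphic_transform)
qed

lemma mean_coeff_holomorphic: "mean_coeff n holomorphic_on {\<beta>. Re \<beta> > 0}"
proof -
  have nz: "\<beta> + of_nat n / 2 \<notin> \<int>\<^sub>\<le>\<^sub>0" if "Re \<beta> > 0" for \<beta> :: complex
    using that by (intro not_nonpos_Int_Re_pos) (simp add: add_pos_nonneg)
  have "(\<lambda>\<beta>. Gamma (\<beta> + of_nat n / 2)) holomorphic_on {\<beta>. Re \<beta> > 0}"
    by (rule holomorphic_on_compose_gen[OF _ holomorphic_Gamma, unfolded o_def, where t="- \<int>\<^sub>\<le>\<^sub>0"])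
      (auto intro!: holomorphic_intros dest: nz)
  moreover have "Gamma holomorphic_on {\<beta>. Re \<beta> > 0}"
    using not_nonpos_Int_Re_pos by (intro holomorphic_Gamma) auto
  ultimately show ?thesis
    unfolding mean_coeff_def[abs_def]
    by (intro holomorphic_intros) (auto simp: Gamma_eq_zero_iff dest: not_nonpos_Int_Re_pos nz)
qed

lemma ball_mean_holomorphic:
  assumes "smooth f"
  shows "(\<lambda>\<beta>. ball_mean \<beta> f (x, t)) holomorphic_on {\<beta>. Re \<beta> > 2}"
  unfolding ball_mean_def
  by (intro holomorphic_on_mult ball_integral_holomorphic[OF assms]
      holomorphic_on_subset[OF mean_coeff_holomorphic]) auto

text \<open>Since \<open>unit_ball_vol n * (n / 2)\<close> is
  \<open>pi powr (n / 2) / Gamma (n / 2)\<close>, the Beta value cancels against the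
  coefficient.\<close>

lemma ball_mean_one_real:
  assumes "a > 2"
  shows "ball_mean (of_real a) (\<lambda>_::'a::euclidean_space. 1) p = 1"
proof -
  define n where "n = real DIM('a)"
  have n: "n > 0" by (simp add: n_def)
  have g: "Gamma (n / 2 + 1) = n / 2 * Gamma (n / 2)" 
    using n by (intro Gamma_plus1) (auto elim!: nonpos_Ints_cases)
  have pos: "Gamma (n / 2) > 0" "Gamma a > 0" "Gamma (a + n / 2) > 0"
    using n assms by (auto intro!: Gamma_real_pos)
  have c: "mean_coeff DIM('a) (of_real a) = of_real (Gamma (a + n / 2) / (pi powr (n / 2) * Gamma a))"
    using Gamma_complex_of_real[of "a + n / 2"]
    by (simp add: mean_coeff_def n_def Gamma_complex_of_real)
  have "ball_integral (of_real a - 1) (\<lambda>_::'a. 1) p = (LINT y|lborel. ball_weight (of_real (a - 1)) (y::'a))"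
    by (simp add: ball_integral_def split_beta)
  also have "\<dots> = of_real (unit_ball_vol n * (n / 2) * Beta (n / 2) a)"
  proof -
    have "integral\<^sup>L lborel (ball_weight_real (a - 1) :: 'a \<Rightarrow> real) = unit_ball_vol n * (n / 2) * Beta (n / 2) a"
      unfolding n_def using assms by (intro has_bochner_integral_integral_eq has_bochner_integral_ball_weight_real) simp
    then show ?thesis unfolding ball_weight_of_real integral_complex_of_real by (simp only:)
  qed
  finally have "ball_mean (of_real a) (\<lambda>_::'a. 1) p =
      of_real (Gamma (a + n / 2) / (pi powr (n / 2) * Gamma a) * (unit_ball_vol n * (n / 2) * Beta (n / 2) a))"
    unfolding ball_mean_def c by (simp only: of_real_mult)
  also have "Gamma (a + n / 2) / (pi powr (n / 2) * Gamma a) * (unit_ball_vol n * (n / 2) * Beta (n / 2) a) = 1"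
    using pos[THEN less_imp_neq, symmetric] n unfolding unit_ball_vol_def Beta_def g by (simp add: add.commute)
  finally show ?thesis by simp
qed

lemma smooth_const: "smooth (\<lambda>x::'a::euclidean_space. c :: 'b::real_normed_vector)"
  by (simp add: smooth_def k_smooth_const)

text \<open>The mass is known for real parameters, where the Beta integral is real; the identity
  theorem, with zeros accumulating at \<open>3\<close>, carries it to the half-plane.\<close>

lemma ball_mean_one:
  assumes "Re \<alpha> > 2"
  shows "ball_mean \<alpha> (\<lambda>_::'a::euclidean_space. 1) (x, t) = 1"
proof -
  let ?S = "{\<beta>. Re \<beta> > 2}" and ?U = "complex_of_real ` {2<..}"
  have "(\<lambda>\<beta>. ball_mean \<beta> (\<lambda>_::'a. 1) (x, t) - 1) \<alpha> = 0"
  proof (rule analytic_continuation[where f="\<lambda>\<beta>. ball_mean \<beta> (\<lambda>_::'a. 1) (x, t) - 1" and w=\<alpha> and S="?S" and U="?U" and \<xi>=3])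
    show "(\<lambda>\<beta>. ball_mean \<beta> (\<lambda>_::'a. 1) (x, t) - 1) holomorphic_on ?S"
      by (intro holomorphic_intros ball_mean_holomorphic smooth_const)
    show "open ?S" by (rule open_halfspace_Re_gt)
    show "connected ?S" by (intro convex_connected convex_halfspace_Re_gt)
    show "3 islimpt ?U"
      unfolding islimpt_sequential
    proof (intro exI[of _ "\<lambda>k. complex_of_real (3 + 1 / real (Suc k))"] conjI allI)
      show "complex_of_real (3 + 1 / real (Suc k)) \<in> ?U - {3}" for k
      proof -
        have "complex_of_real (3 + 1 / real (Suc k)) \<noteq> complex_of_real 3"
          unfolding of_real_eq_iff by simp
        moreover have "3 + 1 / real (Suc k) \<in> {2<..}"
          using divide_nonneg_nonneg[of 1 "real (Suc k)"] by (simp only: greaterThan_iff) linarith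
        ultimately show ?thesis by (metis DiffI imageI of_real_numeral singletonD)
      qed
      have "(\<lambda>k. complex_of_real (3 + 1 / real (Suc k))) \<longlonglongrightarrow> of_real (3 + 0)"
        by (intro tendsto_intros LIMSEQ_Suc[OF lim_1_over_n])
      then show "(\<lambda>k. complex_of_real (3 + 1 / real (Suc k))) \<longlonglongrightarrow> 3" by simp
    qed
  qed (use assms ball_mean_one_real in auto)
  then show ?thesis by simp
qed

lemma ball_mean_at_0:
  fixes f :: "'a::euclidean_space \<Rightarrow> complex"
  assumes "Re \<alpha> > 2"
  shows "ball_mean \<alpha> f (x, 0) = f x"
  using ball_mean_one[OF assms, of x 0] by (simp add: ball_mean_def ball_integral_def)

lemma lborel_integral_scale:
  fixes F :: "'a::euclidean_space \<Rightarrow> 'b::euclidean_space"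
  assumes [measurable]: "F \<in> borel_measurable borel" and "c \<noteq> 0"
  shows "(LINT y|lborel. F y) = \<bar>c\<bar> ^ DIM('a) *\<^sub>R (LINT y|lborel. F (c *\<^sub>R y))"
proof -
  have "(LINT y|lborel. F y) = (LINT y|density (distr lborel borel (\<lambda>x. 0 + c *\<^sub>R x)) (\<lambda>_. ennreal (\<bar>c\<bar> ^ DIM('a))). F y)"
    using lborel_affine[of c "0::'a"] assms(2) by (simp add: ennreal_power)
  also have "\<dots> = (LINT y|distr lborel borel (\<lambda>x. 0 + c *\<^sub>R x). \<bar>c\<bar> ^ DIM('a) *\<^sub>R F y)"
    by (intro integral_density) auto
  also have "\<dots> = (LINT y|lborel. \<bar>c\<bar> ^ DIM('a) *\<^sub>R F (0 + c *\<^sub>R y))"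
    by (intro integral_distr) auto
  finally show ?thesis by simp
qed

lemma ball_mean_even:
  assumes "smooth f"
  shows "ball_mean \<alpha> f (x, - t) = ball_mean \<alpha> f (x, t)"
proof -
  have [measurable]: "(\<lambda>y. f (x - t *\<^sub>R y)) \<in> borel_measurable borel"
    by (intro borel_measurable_continuous_onI continuous_on_scaled_arg assms)
  have "ball_integral (\<alpha> - 1) f (x, t) = ball_integral (\<alpha> - 1) f (x, - t)"
    using lborel_integral_scale[of "\<lambda>y. f (x - t *\<^sub>R y) * ball_weight (\<alpha> - 1) y" "-1"]
    by (simp add: ball_integral_def ball_weight_eq)
  then show ?thesis by (simp add: ball_mean_def)
qed

text \<open>The substitution \<open>y -> t y\<close> brings \<open>t^n\<close> from the volume and
  \<open>t^(2 \<alpha> - 2)\<close> from the weight, and these cancel the prefactor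
  \<open>t^(2 - n - 2 \<alpha>)\<close>.\<close>

lemma m_integral_eq_ball_mean:
  fixes f :: "real ^ 'n \<Rightarrow> complex"
  assumes f: "smooth f" and t: "t > 0"
  shows "m_integral \<alpha> t (\<lambda>y. f (x - y)) = ball_mean \<alpha> f (x, t)"
proof -
  let ?G = "\<lambda>y. indicator (cball 0 t) y *\<^sub>R (f (x - y) * of_real (t\<^sup>2 - (norm y)\<^sup>2) powr (\<alpha> - 1))"
  have [measurable]: "(\<lambda>y. f (x - y)) \<in> borel_measurable borel"
    using continuous_on_scaled_arg[OF f, of UNIV x 1] by (intro borel_measurable_continuous_onI) simp
  have pw: "(\<lambda>y. complex_of_real (t\<^sup>2 - (norm y)\<^sup>2) powr (\<alpha> - 1)) = (\<lambda>y::real^'n. if t\<^sup>2 - (norm y)\<^sup>2 = 0 then 0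
      else exp ((\<alpha> - 1) * Ln (complex_of_real (t\<^sup>2 - (norm y)\<^sup>2))))"
    unfolding powr_def of_real_eq_0_iff ..
  have "(\<lambda>y. complex_of_real (t\<^sup>2 - (norm y)\<^sup>2) powr (\<alpha> - 1)) \<in> borel_measurable (borel :: (real^'n) measure)"
    unfolding pw by measurable
  then have "?G \<in> borel_measurable borel" by (intro borel_measurable_scaleR borel_measurable_times borel_measurable_indicator) auto
  from lborel_integral_scale[OF this, of t]
  have "(LINT y:cball 0 t|lborel. f (x - y) * of_real (t\<^sup>2 - (norm y)\<^sup>2) powr (\<alpha> - 1))
      = t ^ CARD('n) *\<^sub>R (LINT y|lborel. ?G (t *\<^sub>R y))"
    using t by (simp add: set_lebesgue_integral_def)
  also have "(\<lambda>y. ?G (t *\<^sub>R y)) = (\<lambda>y. of_real t powr (2 * \<alpha> - 2) * (f (x - t *\<^sub>R y) * ball_weight (\<alpha> - 1) y))"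
  proof
    fix y :: "real ^ 'n"
    have tt: "t\<^sup>2 - (norm (t *\<^sub>R y))\<^sup>2 = t\<^sup>2 * (1 - (norm y)\<^sup>2)"
      using t by (simp add: power_mult_distrib algebra_simps)
    \<comment> \<open>On the sphere both sides vanish because \<open>0 powr z = 0\<close>. Outside
      the ball the power of a negative number is not zero, and it is the indicator that makes the
      left side vanish.\<close>
    have "norm y < 1 \<or> norm y = 1 \<or> norm y > 1" by linarith
    then show "?G (t *\<^sub>R y) = of_real t powr (2 * \<alpha> - 2) * (f (x - t *\<^sub>R y) * ball_weight (\<alpha> - 1) y)"
    proof (elim disjE)
      assume y: "norm y < 1"
      then have p: "1 - (norm y)\<^sup>2 > 0" by (simp only: norm_less_1_iff)
      have "complex_of_real (t\<^sup>2 * (1 - (norm y)\<^sup>2)) powr (\<alpha> - 1)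
        = of_real (t\<^sup>2) powr (\<alpha> - 1) * of_real (1 - (norm y)\<^sup>2) powr (\<alpha> - 1)"
        unfolding of_real_mult using t p by (intro powr_times_real) auto
      moreover have "complex_of_real (t\<^sup>2) powr (\<alpha> - 1) = of_real t powr (2 * \<alpha> - 2)"
        using t by (simp add: powr_def Ln_of_real ln_realpow algebra_simps flip: of_real_power)
      moreover have "t * norm y \<le> t" using y t by simp
      ultimately show ?thesis unfolding tt ball_weight_def using y t by (simp only: if_True) (simp add: indicator_def)
    next
      assume "norm y > 1"
      then show ?thesis using t by (simp add: ball_weight_outside)
    qed (simp add: ball_weight_outside)
  qed
  also have "(LINT y|lborel. of_real t powr (2 * \<alpha> - 2) * (f (x - t *\<^sub>R y) * ball_weight (\<alpha> - 1) y))
      = of_real t powr (2 * \<alpha> - 2) * ball_integral (\<alpha> - 1) f (x, t)"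
    by (simp add: ball_integral_def)
  finally have I: "(LINT y:cball 0 t|lborel. f (x - y) * of_real (t\<^sup>2 - (norm y)\<^sup>2) powr (\<alpha> - 1))
      = of_real t powr (of_nat CARD('n)) * (of_real t powr (2 * \<alpha> - 2) * ball_integral (\<alpha> - 1) f (x, t))"
    using t by (simp add: scaleR_conv_of_real)
  have "complex_of_real t powr (2 - of_nat CARD('n) - 2 * \<alpha>) * (of_real t powr (of_nat CARD('n)) * of_real t powr (2 * \<alpha> - 2)) = 1"
    using t unfolding powr_add[symmetric] by simp
  then have "complex_of_real t powr (2 - of_nat CARD('n) - 2 * \<alpha>)
     * (of_real t powr (of_nat CARD('n)) * (of_real t powr (2 * \<alpha> - 2) * J)) = J" for J
    by (simp add: mult.assoc[symmetric])
  then show ?thesis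
    unfolding m_integral_def I by (simp add: mult.assoc ball_mean_def mean_coeff_def)
qed

section \<open>Analytic continuation in the parameter\<close>

text \<open>The recurrence for \<open>ball_mean\<close> involves no derivative in \<open>t\<close> and lowers the bound on \<open>Re \<alpha>\<close> by one, so
  that it serves as the definition of the analytic continuation in \<open>\<alpha>\<close>.\<close>

primrec ext_mean :: "nat \<Rightarrow> complex \<Rightarrow> ('a::euclidean_space \<Rightarrow> complex) \<Rightarrow> 'a \<times> real \<Rightarrow> complex" where
  "ext_mean 0 \<alpha> f = ball_mean \<alpha> f"
| "ext_mean (Suc k) \<alpha> f = (\<lambda>p. ext_mean k (\<alpha> + 1) f p
     + of_real (snd p) ^ 2 / ((of_nat DIM('a) + 2 * \<alpha>) * (of_nat DIM('a) + 2 * \<alpha> + 2))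
       * ext_mean k (\<alpha> + 2) (laplacian f) p)"

text \<open>Named after the Euler-Poisson-Darboux equation. Every step raises the parameter by at
  least \<open>1\<close>, so this number of steps ends with real parts at least \<open>3\<close>; by
  \<open>epd_mean_eq\<close> other sufficiently large numbers give the same value.\<close>

definition epd_mean :: "complex \<Rightarrow> ('a::euclidean_space \<Rightarrow> complex) \<Rightarrow> 'a \<times> real \<Rightarrow> complex" where
  "epd_mean \<alpha> = ext_mean (nat \<lceil>3 - Re \<alpha>\<rceil>) \<alpha>"

text \<open>The expressions here are the denominators of the recurrence at \<open>\<alpha>\<close>
  and its integer shifts. \<open>exceptional_iff\<close> compares the condition with
  \<open>exceptional\<close>.\<close>

definition nonexceptional :: "nat \<Rightarrow> complex \<Rightarrow> bool" where
  "nonexceptional n \<alpha> \<longleftrightarrow> (\<forall>k::nat. of_nat n + 2 * \<alpha> + 2 * of_nat k \<noteq> 0)"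

text \<open>For \<open>k = 0\<close> this is \<open>ball_mean_recurrence\<close>; later both sides
  unfold by the same formula, at parameters whose larger real part makes up for the smaller
  \<open>k\<close>.\<close>

lemma ext_mean_Suc_eq:
  assumes "smooth f" "Re \<alpha> + real k > 0"
  shows "ext_mean (Suc k) \<alpha> f = ext_mean k \<alpha> f"
  using assms
proof (induction k arbitrary: \<alpha> f)
  case 0
  have "ball_mean \<alpha> f (x, t) = ext_mean (Suc 0) \<alpha> f (x, t)" for x t
    using ball_mean_recurrence[of f \<alpha> x t] 0 by simp
  then show ?case by (simp only: fun_eq_iff split_paired_All ext_mean.simps(1)) simp
next
  case (Suc k)
  have "ext_mean (Suc k) (\<alpha> + 1) f = ext_mean k (\<alpha> + 1) f"
    "ext_mean (Suc k) (\<alpha> + 2) (laplacian f) = ext_mean k (\<alpha> + 2) (laplacian f)"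
    using Suc by (auto intro!: Suc.IH smooth_laplacian simp del: ext_mean.simps)
  then show ?case unfolding ext_mean.simps(2)[of "Suc k"] by (simp only: ext_mean.simps(2))
qed

lemma ext_mean_add_eq:
  assumes "smooth f" "Re \<alpha> + real k > 0"
  shows "ext_mean (k + l) \<alpha> f = ext_mean k \<alpha> f"
  using assms by (induction l) (simp_all add: ext_mean_Suc_eq del: ext_mean.simps)

lemma epd_mean_eq:
  assumes "smooth f" "Re \<alpha> + real k > 0"
  shows "epd_mean \<alpha> f = ext_mean k \<alpha> f"
proof -
  define K where "K = nat \<lceil>3 - Re \<alpha>\<rceil>"
  have "Re \<alpha> + real K > 0" unfolding K_def by linarith
  then have "ext_mean K \<alpha> f = ext_mean (K + k) \<alpha> f" "ext_mean k \<alpha> f = ext_mean (k + K) \<alpha> f"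
    using assms by (simp_all add: ext_mean_add_eq)
  then show ?thesis by (simp add: epd_mean_def K_def add.commute)
qed

lemma epd_mean_eq_ball_mean: "smooth f \<Longrightarrow> Re \<alpha> > 0 \<Longrightarrow> epd_mean \<alpha> f = ball_mean \<alpha> f"
  using epd_mean_eq[of f \<alpha> 0] by simp

lemma epd_mean_recurrence:
  fixes f :: "'a::euclidean_space \<Rightarrow> complex"
  assumes f: "smooth f"
  shows "epd_mean \<alpha> f p = epd_mean (\<alpha> + 1) f p
    + of_real (snd p) ^ 2 / ((of_nat DIM('a) + 2 * \<alpha>) * (of_nat DIM('a) + 2 * \<alpha> + 2)) * epd_mean (\<alpha> + 2) (laplacian f) p"
proof -
  obtain k where "real k > - Re \<alpha>" using reals_Archimedean2 by blast
  then show ?thesis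
    using epd_mean_eq[OF f, of \<alpha> "Suc k"] epd_mean_eq[OF f, of "\<alpha> + 1" k]
      epd_mean_eq[OF smooth_laplacian[OF f], of "\<alpha> + 2" k]
    by simp
qed

lemma nonexceptional_add: "nonexceptional n \<alpha> \<Longrightarrow> nonexceptional n (\<alpha> + of_nat j)"
  unfolding nonexceptional_def
proof
  fix k assume "\<forall>k. of_nat n + 2 * \<alpha> + 2 * of_nat k \<noteq> 0"
  from this[rule_format, of "j + k"]
  show "of_nat n + 2 * (\<alpha> + of_nat j) + 2 * of_nat k \<noteq> 0" by (simp add: algebra_simps)
qed

lemma nonexceptionalD:
  assumes "nonexceptional n \<alpha>"
  shows "of_nat n + 2 * \<alpha> \<noteq> 0" "of_nat n + 2 * \<alpha> + 2 \<noteq> 0" "of_nat n + 2 * \<alpha> + 4 \<noteq> 0"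
    "nonexceptional n (\<alpha> + 1)" "nonexceptional n (\<alpha> + 2)"
  using assms[unfolded nonexceptional_def, rule_format, of 0]
    assms[unfolded nonexceptional_def, rule_format, of 1]
    assms[unfolded nonexceptional_def, rule_format, of 2]
    nonexceptional_add[OF assms, of 1] nonexceptional_add[OF assms, of 2]
  by simp_all

text \<open>Induction from right to left in the complex plane, in strips of width one. It transfers
  identities from the integrals to the continuation through the recurrence alone, without the
  identity theorem.\<close>

lemma nonexceptional_induct [consumes 1, case_names base step]:
  assumes "nonexceptional n \<alpha>"
    and base: "\<And>\<alpha>. Re \<alpha> > 2 \<Longrightarrow> P \<alpha>"
    and step: "\<And>\<alpha>. nonexceptional n \<alpha> \<Longrightarrow> P (\<alpha> + 1) \<Longrightarrow> P (\<alpha> + 2) \<Longrightarrow> P \<alpha>"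
  shows "P \<alpha>"
proof -
  have "P \<alpha>" if "Re \<alpha> + real k > 2" "nonexceptional n \<alpha>" for k \<alpha>
    using that
  proof (induction k arbitrary: \<alpha>)
    case 0
    then show ?case by (simp add: base)
  next
    case (Suc k)
    then have "P (\<alpha> + 1)" "P (\<alpha> + 2)" by (auto intro!: Suc.IH simp: nonexceptionalD)
    then show ?case using step Suc.prems by blast
  qed
  moreover obtain k where "real k > 2 - Re \<alpha>" using reals_Archimedean2 by blast
  then have "Re \<alpha> + real k > 2" by linarith
  ultimately show ?thesis using assms(1) by blast
qed

section \<open>Properties of the means carried to all nonexceptional parameters\<close>

lemma epd_mean_at_0:
  fixes f :: "'a::euclidean_space \<Rightarrow> complex"
  assumes "nonexceptional DIM('a) \<alpha>" "smooth f"
  shows "epd_mean \<alpha> f (x, 0) = f x"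
  using assms(1)
proof (induction rule: nonexceptional_induct)
  case (base \<alpha>)
  then show ?case using assms by (simp add: epd_mean_eq_ball_mean ball_mean_at_0)
next
  case (step \<alpha>)
  then show ?case using epd_mean_recurrence[OF assms(2), of \<alpha> "(x, 0)"] by simp
qed

lemma epd_mean_even:
  fixes f :: "'a::euclidean_space \<Rightarrow> complex"
  assumes "nonexceptional DIM('a) \<alpha>" "smooth f"
  shows "epd_mean \<alpha> f (x, - t) = epd_mean \<alpha> f (x, t)"
  using assms
proof (induction arbitrary: f rule: nonexceptional_induct)
  case (base \<alpha>)
  then show ?case by (simp add: epd_mean_eq_ball_mean ball_mean_even)
next
  case (step \<alpha>)
  have "epd_mean (\<alpha> + 1) f (x, - t) = epd_mean (\<alpha> + 1) f (x, t)"
    "epd_mean (\<alpha> + 2) (laplacian f) (x, - t) = epd_mean (\<alpha> + 2) (laplacian f) (x, t)"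
    using step by (auto intro: smooth_laplacian)
  then show ?case unfolding epd_mean_recurrence[OF \<open>smooth f\<close>, of \<alpha>] by simp
qed

lemma epd_mean_sum:
  fixes g :: "'i \<Rightarrow> 'a::euclidean_space \<Rightarrow> complex"
  assumes "nonexceptional DIM('a) \<alpha>" "finite A" "\<And>a. a \<in> A \<Longrightarrow> smooth (g a)"
  shows "epd_mean \<alpha> (\<lambda>x. \<Sum>a\<in>A. g a x) p = (\<Sum>a\<in>A. epd_mean \<alpha> (g a) p)"
  using assms
proof (induction arbitrary: g rule: nonexceptional_induct)
  case (base \<alpha>)
  obtain x t where p: "p = (x, t)" by fastforce
  have "integrable lborel (\<lambda>y. g a (x - t *\<^sub>R y) * ball_weight (\<alpha> - 1) y)" if "a \<in> A" for a
    using integrable_ball_integral[OF base(3)[OF that], of "\<alpha> - 1" "\<lambda>_. 1"] base(1) by simp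
  then have "ball_integral (\<alpha> - 1) (\<lambda>x. \<Sum>a\<in>A. g a x) p = (\<Sum>a\<in>A. ball_integral (\<alpha> - 1) (g a) p)"
    by (simp add: ball_integral_def p sum_distrib_right)
  then show ?case using base by (simp add: epd_mean_eq_ball_mean smooth_sum ball_mean_def sum_distrib_left)
next
  case (step \<alpha>)
  have s: "smooth (\<lambda>x. \<Sum>a\<in>A. g a x)" using step by (intro smooth_sum) auto
  have "epd_mean (\<alpha> + 1) (\<lambda>x. \<Sum>a\<in>A. g a x) p = (\<Sum>a\<in>A. epd_mean (\<alpha> + 1) (g a) p)"
    using step(4,5) by (rule step(2))
  moreover have "epd_mean (\<alpha> + 2) (laplacian (\<lambda>x. \<Sum>a\<in>A. g a x)) p = (\<Sum>a\<in>A. epd_mean (\<alpha> + 2) (laplacian (g a)) p)"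
    using laplacian_sum[of A g, OF step(4,5)] step(3)[of "\<lambda>a. laplacian (g a)"] step(4,5)
    by (simp add: smooth_laplacian)
  moreover have "(\<Sum>a\<in>A. epd_mean \<alpha> (g a) p) = (\<Sum>a\<in>A. epd_mean (\<alpha> + 1) (g a) p
      + of_real (snd p) ^ 2 / ((of_nat DIM('a) + 2 * \<alpha>) * (of_nat DIM('a) + 2 * \<alpha> + 2)) * epd_mean (\<alpha> + 2) (laplacian (g a)) p)"
    using step(5) by (intro sum.cong refl epd_mean_recurrence)
  ultimately show ?case
    unfolding epd_mean_recurrence[OF s, of \<alpha>] by (simp only: sum.distrib sum_distrib_left)
qed

text \<open>Differentiate the recurrence, with \<open>A = n + 2 \<alpha>\<close>. The term
  \<open>t / (A + 2)\<close> from the first summand and \<open>2 t / (A (A + 2))\<close> from the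
  factor \<open>t^2\<close> add up to \<open>t / A\<close>; the other terms regroup by the
  recurrence for \<open>laplacian f\<close> at \<open>\<alpha> + 1\<close> and for
  \<open>dir_deriv (fst q) f\<close> at \<open>\<alpha>\<close>. The latter uses that directional
  derivatives commute with the Laplacian.\<close>

lemma epd_mean_has_derivative:
  fixes f :: "'a::euclidean_space \<Rightarrow> complex"
  assumes "nonexceptional DIM('a) \<alpha>" "smooth f"
  shows "(epd_mean \<alpha> f has_derivative (\<lambda>q. epd_mean \<alpha> (dir_deriv (fst q) f) (x, t)
    + of_real (snd q) * (of_real t / (of_nat DIM('a) + 2 * \<alpha>) * epd_mean (\<alpha> + 1) (laplacian f) (x, t)))) (at (x, t))"
  using assms
proof (induction arbitrary: f rule: nonexceptional_induct)
  case (base \<alpha>)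
  have "epd_mean \<alpha> (dir_deriv v f) = ball_mean \<alpha> (dir_deriv v f)" for v
    using base by (simp add: epd_mean_eq_ball_mean smooth_dir_deriv)
  moreover have "epd_mean (\<alpha> + 1) (laplacian f) = ball_mean (\<alpha> + 1) (laplacian f)" "epd_mean \<alpha> f = ball_mean \<alpha> f"
    using base by (simp_all add: epd_mean_eq_ball_mean smooth_laplacian)
  ultimately show ?case using ball_mean_has_derivative[OF base(2,1)] by simp
next
  case (step \<alpha>)
  note f = \<open>smooth f\<close>
  define A where "A = (of_nat DIM('a) + 2 * \<alpha> :: complex)"
  have A: "A \<noteq> 0" "A + 2 \<noteq> 0" "A + 4 \<noteq> 0" using nonexceptionalD[OF step(1)] by (auto simp: A_def)
  let ?L = "laplacian f" and ?p = "(x, t)"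
  have A1: "of_nat DIM('a) + 2 * (\<alpha> + 1) = A + 2" "of_nat DIM('a) + 2 * (\<alpha> + 2) = A + 4" "A + 2 + 2 = A + 4"
    "\<alpha> + 1 + 1 = \<alpha> + 2" "\<alpha> + 1 + 2 = \<alpha> + 3" "\<alpha> + 2 + 1 = \<alpha> + 3"
    by (simp_all add: A_def algebra_simps)
  have d1: "(epd_mean (\<alpha> + 1) f has_derivative (\<lambda>q. epd_mean (\<alpha> + 1) (dir_deriv (fst q) f) ?p
      + of_real (snd q) * (of_real t / (A + 2) * epd_mean (\<alpha> + 2) ?L ?p))) (at ?p)"
    using step(2)[OF f] unfolding A1 .
  have d2: "(epd_mean (\<alpha> + 2) ?L has_derivative (\<lambda>q. epd_mean (\<alpha> + 2) (dir_deriv (fst q) ?L) ?p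
      + of_real (snd q) * (of_real t / (A + 4) * epd_mean (\<alpha> + 3) (laplacian ?L) ?p))) (at ?p)"
    using step(3)[OF smooth_laplacian[OF f]] unfolding A1 .
  have d3: "((\<lambda>p. complex_of_real (snd p) ^ 2 / (A * (A + 2))) has_derivative
      (\<lambda>q. of_real (snd q) * (2 * of_real t / (A * (A + 2))))) (at ?p)"
  proof -
    have "((\<lambda>p. complex_of_real (snd p) ^ 2) has_derivative (\<lambda>q. of_real (snd q) * (2 * of_real t))) (at ?p)"
      by (auto intro!: derivative_eq_intros)
    from has_derivative_mult_left[OF this, of "inverse (A * (A + 2))"]
    show ?thesis by (simp only: divide_inverse mult.assoc)
  qed
  have "((\<lambda>p. epd_mean (\<alpha> + 1) f p + of_real (snd p) ^ 2 / (A * (A + 2)) * epd_mean (\<alpha> + 2) ?L p) has_derivative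
     (\<lambda>q. (epd_mean (\<alpha> + 1) (dir_deriv (fst q) f) ?p + of_real (snd q) * (of_real t / (A + 2) * epd_mean (\<alpha> + 2) ?L ?p))
       + (of_real t ^ 2 / (A * (A + 2)) * (epd_mean (\<alpha> + 2) (dir_deriv (fst q) ?L) ?p
           + of_real (snd q) * (of_real t / (A + 4) * epd_mean (\<alpha> + 3) (laplacian ?L) ?p))
         + of_real (snd q) * (2 * of_real t / (A * (A + 2))) * epd_mean (\<alpha> + 2) ?L ?p))) (at ?p)"
    using has_derivative_add[OF d1 has_derivative_mult[OF d3 d2]] by simp
  moreover have "(\<lambda>p. epd_mean (\<alpha> + 1) f p + of_real (snd p) ^ 2 / (A * (A + 2)) * epd_mean (\<alpha> + 2) ?L p) = epd_mean \<alpha> f"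
    by (rule ext) (simp only: epd_mean_recurrence[OF f, of \<alpha>] A_def)
  moreover have "(epd_mean (\<alpha> + 1) (dir_deriv (fst q) f) ?p + of_real (snd q) * (of_real t / (A + 2) * epd_mean (\<alpha> + 2) ?L ?p))
       + (of_real t ^ 2 / (A * (A + 2)) * (epd_mean (\<alpha> + 2) (dir_deriv (fst q) ?L) ?p
           + of_real (snd q) * (of_real t / (A + 4) * epd_mean (\<alpha> + 3) (laplacian ?L) ?p))
         + of_real (snd q) * (2 * of_real t / (A * (A + 2))) * epd_mean (\<alpha> + 2) ?L ?p)
     = epd_mean \<alpha> (dir_deriv (fst q) f) ?p + of_real (snd q) * (of_real t / A * epd_mean (\<alpha> + 1) ?L ?p)" for q
  proof -
    have r1: "epd_mean \<alpha> (dir_deriv (fst q) f) ?p = epd_mean (\<alpha> + 1) (dir_deriv (fst q) f) ?p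
        + of_real t ^ 2 / (A * (A + 2)) * epd_mean (\<alpha> + 2) (dir_deriv (fst q) ?L) ?p"
      using epd_mean_recurrence[OF smooth_dir_deriv[OF f], of \<alpha> _ ?p] by (simp only: A_def snd_conv dir_deriv_laplacian[OF f])
    have r2: "epd_mean (\<alpha> + 1) ?L ?p = epd_mean (\<alpha> + 2) ?L ?p
        + of_real t ^ 2 / ((A + 2) * (A + 4)) * epd_mean (\<alpha> + 3) (laplacian ?L) ?p"
      using epd_mean_recurrence[OF smooth_laplacian[OF f], of "\<alpha> + 1" ?p] unfolding A1 by (simp only: snd_conv)
    have alg: "(X1 + \<tau> * (T / (B + 2) * Y)) + (T ^ 2 / (B * (B + 2)) * (X2 + \<tau> * (T / (B + 4) * Z)) + \<tau> * (2 * T / (B * (B + 2))) * Y)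
       = (X1 + T ^ 2 / (B * (B + 2)) * X2) + \<tau> * (T / B * (Y + T ^ 2 / ((B + 2) * (B + 4)) * Z))"
      if "B \<noteq> 0" "B + 2 \<noteq> 0" "B + 4 \<noteq> 0" for X1 X2 Y Z T \<tau> B :: complex
    proof -
      have "T / (B + 2) * Y + 2 * T / (B * (B + 2)) * Y = T / B * Y"
        using that by (simp add: divide_simps) (simp add: algebra_simps)
      then have "\<tau> * (T / (B + 2) * Y) + \<tau> * (2 * T / (B * (B + 2))) * Y = \<tau> * (T / B * Y)"
        by (metis distrib_left mult.assoc)
      moreover have "T ^ 2 / (B * (B + 2)) * (\<tau> * (T / (B + 4) * Z)) = \<tau> * (T / B * (T ^ 2 / ((B + 2) * (B + 4)) * Z))"
        by (simp add: algebra_simps)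
      moreover have "(X1 + a) + (P * (X2 + w) + b) = (X1 + P * X2) + (c + e)"
        if "a + b = c" "P * w = e" for a b c e P w :: complex
        using that by (auto simp: algebra_simps)
      moreover have "\<tau> * (T / B * (Y + K * Z)) = \<tau> * (T / B * Y) + \<tau> * (T / B * (K * Z))" for K
        by (simp only: distrib_left)
      ultimately show ?thesis by (simp only:)
    qed
    show ?thesis unfolding r1 r2 by (rule alg[OF A])
  qed
  ultimately show ?case by (simp only: A_def)
qed

lemma epd_mean_dir_deriv:
  fixes f :: "'a::euclidean_space \<Rightarrow> complex"
  assumes "nonexceptional DIM('a) \<alpha>" "smooth f"
  shows "dir_deriv q (epd_mean \<alpha> f) = (\<lambda>p. epd_mean \<alpha> (dir_deriv (fst q) f) p
    + of_real (snd q) / (of_nat DIM('a) + 2 * \<alpha>) * (of_real (snd p) * epd_mean (\<alpha> + 1) (laplacian f) p))"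
proof
  fix p :: "'a \<times> real"
  show "dir_deriv q (epd_mean \<alpha> f) p = epd_mean \<alpha> (dir_deriv (fst q) f) p
    + of_real (snd q) / (of_nat DIM('a) + 2 * \<alpha>) * (of_real (snd p) * epd_mean (\<alpha> + 1) (laplacian f) p)"
    using dir_deriv_eqI[OF epd_mean_has_derivative[OF assms, of "fst p" "snd p"], of q] by simp
qed

text \<open>A directional derivative of a mean is a mean of a derivative of \<open>f\<close> plus a
  multiple of \<open>t\<close> times a mean with parameter \<open>\<alpha> + 1\<close>. The class of
  means of smooth functions thus reproduces itself, which is why the induction on \<open>k\<close>
  varies \<open>\<alpha>\<close> and \<open>f\<close>.\<close>

lemma smooth_epd_mean:
  fixes f :: "'a::euclidean_space \<Rightarrow> complex"
  assumes "nonexceptional DIM('a) \<alpha>" "smooth f"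
  shows "smooth (epd_mean \<alpha> f)"
proof -
  have diff: "epd_mean \<alpha> f differentiable (at p)"
    if "nonexceptional DIM('a) \<alpha>" "smooth f" for \<alpha> p and f :: "'a \<Rightarrow> complex"
    using epd_mean_has_derivative[OF that, of "fst p" "snd p"] by (auto simp: differentiable_def)
  have "k_smooth k (epd_mean \<alpha> f)" for k
    using assms
  proof (induction k arbitrary: \<alpha> f)
    case 0
    then show ?case
      using diff by (simp add: continuous_on_eq_continuous_at differentiable_imp_continuous_within)
  next
    case (Suc k)
    have "k_smooth k (dir_deriv q (epd_mean \<alpha> f))" for q
      unfolding epd_mean_dir_deriv[OF Suc.prems] using Suc
      by (intro k_smooth_add k_smooth_linear[OF bounded_linear_mult_right] k_smooth_linear_mult bounded_linear_snd Suc.IH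
          smooth_dir_deriv smooth_laplacian nonexceptionalD) auto
    then show ?case using diff Suc.prems by simp
  qed
  then show ?thesis by (simp add: smooth_def)
qed

lemma laplacian_epd_mean:
  fixes f :: "'a::euclidean_space \<Rightarrow> complex"
  assumes ne: "nonexceptional DIM('a) \<alpha>" and f: "smooth f"
  shows "laplacian (\<lambda>y. epd_mean \<alpha> f (y, t)) x = epd_mean \<alpha> (laplacian f) (x, t)"
proof -
  have d: "dir_deriv b (\<lambda>y. epd_mean \<alpha> g (y, t)) = (\<lambda>y. epd_mean \<alpha> (dir_deriv b g) (y, t))"
    if g: "smooth g" for b and g :: "'a \<Rightarrow> complex"
  proof
    fix y :: 'a
    have "((\<lambda>y. (y, t)) has_derivative (\<lambda>v. (v, 0))) (at y)" by (auto intro!: derivative_eq_intros)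
    from dir_deriv_eqI[OF has_derivative_compose[OF this epd_mean_has_derivative[OF ne g, of y t]], of b]
    show "dir_deriv b (\<lambda>y. epd_mean \<alpha> g (y, t)) y = epd_mean \<alpha> (dir_deriv b g) (y, t)" by simp
  qed
  show ?thesis
    unfolding laplacian_eq using f by (simp add: d smooth_dir_deriv epd_mean_sum[OF ne])
qed

lemma epd_mean_vector_derivative:
  fixes f :: "'a::euclidean_space \<Rightarrow> complex"
  assumes ne: "nonexceptional DIM('a) \<alpha>" and f: "smooth f"
  shows "((\<lambda>s. epd_mean \<alpha> f (x, s)) has_vector_derivative
    of_real t / (of_nat DIM('a) + 2 * \<alpha>) * epd_mean (\<alpha> + 1) (laplacian f) (x, t)) (at t)"
proof -
  have "((\<lambda>s. epd_mean \<alpha> f ((x, 0) + s *\<^sub>R (0, 1))) has_vector_derivative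
     dir_deriv (0, 1) (epd_mean \<alpha> f) ((x, 0) + t *\<^sub>R (0, 1))) (at t)"
    by (intro has_vector_derivative_line smooth_differentiable smooth_epd_mean assms)
  moreover have "dir_deriv 0 f = (\<lambda>_. 0)"
    by (rule ext) (simp add: linear_0[OF linear_dir_deriv[OF smooth_differentiable[OF f]]])
  moreover have "epd_mean \<alpha> (\<lambda>_. 0) p = 0" for p :: "'a \<times> real"
    using epd_mean_sum[OF ne, of "{}"] by simp
  ultimately show ?thesis by (simp add: epd_mean_dir_deriv[OF assms])
qed

text \<open>With \<open>A = n + 2 \<alpha>\<close> the first-order coefficient is
  \<open>(A - 1) / t\<close>. The terms \<open>1 / A\<close> from the second derivative and
  \<open>(A - 1) / A\<close> from the first add up to \<open>1\<close>, and what remains is the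
  recurrence for \<open>laplacian f\<close>, whose mean is the Laplacian of the mean.\<close>

lemma epd_mean_solves:
  fixes f :: "real ^ 'n \<Rightarrow> complex"
  assumes ne: "nonexceptional CARD('n) \<alpha>" and f: "smooth f"
  shows "solves_cauchy \<alpha> f (epd_mean \<alpha> f)"
proof -
  define A where "A = (of_nat CARD('n) + 2 * \<alpha> :: complex)"
  have A: "A \<noteq> 0" "A + 2 \<noteq> 0" using nonexceptionalD[OF ne] by (auto simp: A_def)
  have ne': "nonexceptional DIM(real ^ 'n) \<alpha>" "nonexceptional DIM(real ^ 'n) (\<alpha> + 1)"
    using ne nonexceptionalD by simp_all
  have A1: "of_nat CARD('n) + 2 * (\<alpha> + 1) = A + 2" "\<alpha> + 1 + 1 = \<alpha> + 2" by (simp_all add: A_def algebra_simps)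
  let ?L = "laplacian f"
  note L = smooth_laplacian[OF f]
  have t1: "time_deriv (epd_mean \<alpha> f) = (\<lambda>(x, t). of_real t / A * epd_mean (\<alpha> + 1) ?L (x, t))"
    unfolding time_deriv_def A_def
    using vector_derivative_at[OF epd_mean_vector_derivative[OF ne'(1) f]] by (simp add: fun_eq_iff)
  have t2: "time_deriv (time_deriv (epd_mean \<alpha> f)) (x, t)
      = of_real t / A * (of_real t / (A + 2) * epd_mean (\<alpha> + 2) (laplacian ?L) (x, t)) + 1 / A * epd_mean (\<alpha> + 1) ?L (x, t)" for x t
  proof -
    have "((\<lambda>s. complex_of_real s / A) has_vector_derivative 1 / A) (at t)"
      by (auto intro!: derivative_eq_intros)
    from vector_derivative_at[OF has_vector_derivative_mult[OF this epd_mean_vector_derivative[OF ne'(2) L, of x]]]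
    show ?thesis unfolding t1 by (simp only: time_deriv_def prod.case A1 DIM_cart DIM_real mult_1_right)
  qed
  have "laplacian (\<lambda>y. epd_mean \<alpha> f (y, t)) x = time_deriv (time_deriv (epd_mean \<alpha> f)) (x, t)
          + (of_nat CARD('n) - 1 + 2 * \<alpha>) / of_real t * time_deriv (epd_mean \<alpha> f) (x, t)" if "t > 0" for x t
  proof -
    have alg: "Y + T ^ 2 / (B * (B + 2)) * Z = T / B * (T / (B + 2) * Z) + 1 / B * Y + (B - 1) / T * (T / B * Y)"
      if "B \<noteq> 0" "B + 2 \<noteq> 0" "T \<noteq> 0" for Y Z T B :: complex
    proof -
      have "1 / B * Y + (B - 1) / T * (T / B * Y) = Y" using that by (simp add: divide_simps) (simp add: algebra_simps)
      then show ?thesis by (simp add: power2_eq_square add.assoc)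
    qed
    have r: "epd_mean \<alpha> ?L (x, t) = epd_mean (\<alpha> + 1) ?L (x, t)
        + of_real t ^ 2 / (A * (A + 2)) * epd_mean (\<alpha> + 2) (laplacian ?L) (x, t)"
      using epd_mean_recurrence[OF L, of \<alpha> "(x, t)"] by (simp add: A_def)
    have e: "of_nat CARD('n) - 1 + 2 * \<alpha> = A - 1" by (simp add: A_def)
    show ?thesis
      unfolding t2 laplacian_epd_mean[OF ne'(1) f] r e unfolding t1 prod.case using A that by (intro alg) auto
  qed
  moreover have "((\<lambda>t. epd_mean \<alpha> f (x, t)) \<longlongrightarrow> f x) (at_right 0)" for x
  proof -
    have "((\<lambda>t. epd_mean \<alpha> f (x, t)) \<longlongrightarrow> epd_mean \<alpha> f (x, 0)) (at_right 0)"
      by (intro isCont_tendsto_compose[OF smooth_isCont[OF smooth_epd_mean[OF ne'(1) f]]] tendsto_intros)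
    then show ?thesis by (simp only: epd_mean_at_0[OF ne'(1) f])
  qed
  moreover have "((\<lambda>t. time_deriv (epd_mean \<alpha> f) (x, t)) \<longlongrightarrow> 0) (at_right 0)" for x
  proof -
    have "((\<lambda>t. of_real t / A * epd_mean (\<alpha> + 1) ?L (x, t)) \<longlongrightarrow> of_real 0 / A * epd_mean (\<alpha> + 1) ?L (x, 0)) (at_right 0)"
      using A by (intro tendsto_intros isCont_tendsto_compose[OF smooth_isCont[OF smooth_epd_mean[OF ne'(2) L]]])
    then show ?thesis by (simp add: t1)
  qed
  ultimately show ?thesis by (simp add: solves_cauchy_def)
qed

section \<open>Identification with the distributions\<close>

lemma exceptional_iff: "\<alpha> \<in> exceptional TYPE('n::finite) \<longleftrightarrow> \<not> nonexceptional CARD('n) \<alpha>"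
proof -
  have "\<alpha> = - of_nat CARD('n) / 2 - of_nat k \<longleftrightarrow> of_nat CARD('n) + 2 * \<alpha> + 2 * of_nat k = 0" for k
  proof -
    have "of_nat CARD('n) + 2 * \<alpha> + 2 * of_nat k = 2 * (\<alpha> - (- of_nat CARD('n) / 2 - of_nat k))"
      by (simp add: algebra_simps)
    then show ?thesis by (metis mult_eq_0_iff right_minus_eq zero_neq_numeral)
  qed
  then show ?thesis by (auto simp: exceptional_def nonexceptional_def)
qed

lemma exceptional_eq: "exceptional TYPE('n::finite) = (\<lambda>z. - of_nat CARD('n) / 2 - z) -` range of_nat"
proof (intro set_eqI iffI)
  fix z :: complex assume "z \<in> (\<lambda>z. - of_nat CARD('n) / 2 - z) -` range of_nat"
  then obtain k where "- of_nat CARD('n) / 2 - z = of_nat k" by auto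
  then have "z = - of_nat CARD('n) / 2 - of_nat k" by (simp add: algebra_simps)
  then show "z \<in> exceptional TYPE('n)" by (auto simp: exceptional_def)
qed (auto simp: exceptional_def)

lemma open_Compl_exceptional: "open (- exceptional TYPE('n::finite))"
proof -
  have "closed ((\<lambda>z::complex. - of_nat CARD('n) / 2 - z) -` range of_nat)"
    by (rule continuous_closed_vimage[OF closed_of_nat_image]) (auto intro!: continuous_intros)
  then show ?thesis by (simp add: exceptional_eq open_Compl)
qed

lemma connected_Compl_exceptional: "connected (- exceptional TYPE('n::finite))"
proof -
  have "exceptional TYPE('n) = range (\<lambda>k::nat. - of_nat CARD('n) / 2 - of_nat k)"
    by (auto simp: exceptional_def)
  then have "countable (exceptional TYPE('n))" by simp
  then show ?thesis by (intro path_connected_imp_connected path_connected_complement_countable) auto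
qed

lemma ext_mean_holomorphic:
  fixes f :: "'a::euclidean_space \<Rightarrow> complex"
  assumes "smooth f"
  shows "(\<lambda>\<alpha>. ext_mean k \<alpha> f p) holomorphic_on {\<alpha>. Re \<alpha> + real k > 2 \<and> nonexceptional DIM('a) \<alpha>}"
  using assms
proof (induction k arbitrary: f)
  case 0
  then show ?case
    using holomorphic_on_subset[OF ball_mean_holomorphic[of f "fst p" "snd p"]] by (auto simp: subset_iff)
next
  case (Suc k)
  let ?S = "\<lambda>k::nat. {\<alpha>. Re \<alpha> + real k > 2 \<and> nonexceptional DIM('a) \<alpha>}"
  have "(\<lambda>\<alpha>. ext_mean k (\<alpha> + 1) f p) holomorphic_on ?S (Suc k)"
    by (rule holomorphic_on_compose_gen[OF _ Suc.IH[OF Suc.prems], unfolded o_def])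
      (auto intro!: holomorphic_intros nonexceptionalD)
  moreover have "(\<lambda>\<alpha>. ext_mean k (\<alpha> + 2) (laplacian f) p) holomorphic_on ?S (Suc k)"
    by (rule holomorphic_on_compose_gen[OF _ Suc.IH[OF smooth_laplacian[OF Suc.prems]], unfolded o_def])
      (auto intro!: holomorphic_intros nonexceptionalD)
  ultimately show ?case
    unfolding ext_mean.simps by (intro holomorphic_intros) (auto simp: nonexceptionalD)
qed

text \<open>At a zero of a denominator HOL division returns \<open>0\<close>;
  \<open>meromorphic_on\<close> depends only on punctured neighbourhoods, so this default value is
  harmless.\<close>

lemma ext_mean_meromorphic:
  fixes f :: "'a::euclidean_space \<Rightarrow> complex"
  assumes "smooth f"
  shows "(\<lambda>\<alpha>. ext_mean k \<alpha> f p) meromorphic_on {\<alpha>. Re \<alpha> + real k > 2}"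
  using assms
proof (induction k arbitrary: f)
  case 0
  have "open {\<alpha>. Re \<alpha> > 2}" by (rule open_halfspace_Re_gt)
  with 0 show ?case
    using ball_mean_holomorphic[of f "fst p" "snd p"]
    by (auto intro!: analytic_on_imp_meromorphic_on simp: analytic_on_open)
next
  case (Suc k)
  have "(\<lambda>\<alpha>. ext_mean k (\<alpha> + 1) f p) meromorphic_on {\<alpha>. Re \<alpha> + real (Suc k) > 2}"
    by (rule meromorphic_on_compose[OF Suc.IH[OF Suc.prems]]) (auto intro!: analytic_intros)
  moreover have "(\<lambda>\<alpha>. ext_mean k (\<alpha> + 2) (laplacian f) p) meromorphic_on {\<alpha>. Re \<alpha> + real (Suc k) > 2}"
    by (rule meromorphic_on_compose[OF Suc.IH[OF smooth_laplacian[OF Suc.prems]]]) (auto intro!: analytic_intros)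
  ultimately show ?case
    unfolding ext_mean.simps by (intro meromorphic_intros)
qed

text \<open>The number of steps in \<open>epd_mean\<close> jumps with \<open>Re \<alpha>\<close>.
  Near a given point one fixed number serves, so regularity in the parameter can be read off from
  \<open>ext_mean\<close>.\<close>

lemma epd_mean_eq_ext_mean_near:
  assumes "smooth f"
  obtains k where "\<And>w. w \<in> ball z 1 \<Longrightarrow> Re w + real k > 2" "\<And>w. w \<in> ball z 1 \<Longrightarrow> epd_mean w f = ext_mean k w f"
proof -
  obtain k where k: "real k > 3 - Re z" using reals_Archimedean2 by blast
  have "Re w + real k > 2" if "w \<in> ball z 1" for w
    using that k abs_Re_le_cmod[of "z - w"] by (auto simp: dist_norm)
  then show ?thesis using assms by (intro that[of k]) (auto intro!: epd_mean_eq intro: less_trans[of 0 2])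
qed

lemma epd_mean_holomorphic:
  fixes f :: "real ^ 'n \<Rightarrow> complex"
  assumes f: "smooth f"
  shows "(\<lambda>\<alpha>. epd_mean \<alpha> f p) holomorphic_on - exceptional TYPE('n)"
proof -
  have "(\<lambda>\<alpha>. epd_mean \<alpha> f p) field_differentiable (at z)" if z: "z \<in> - exceptional TYPE('n)" for z
  proof -
    obtain k where k: "\<And>w. w \<in> ball z 1 \<Longrightarrow> Re w + real k > 2" "\<And>w. w \<in> ball z 1 \<Longrightarrow> epd_mean w f = ext_mean k w f"
      using epd_mean_eq_ext_mean_near[OF f] by metis
    let ?U = "ball z 1 \<inter> - exceptional TYPE('n)"
    have "(\<lambda>\<alpha>. ext_mean k \<alpha> f p) holomorphic_on ?U"
      using k(1) by (intro holomorphic_on_subset[OF ext_mean_holomorphic[OF f]]) (auto simp: exceptional_iff)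
    then have "(\<lambda>\<alpha>. epd_mean \<alpha> f p) holomorphic_on ?U"
      by (rule holomorphic_transform) (simp add: k(2))
    moreover have "open ?U" by (intro open_Int open_Compl_exceptional) auto
    ultimately show ?thesis using z by (auto intro: holomorphic_on_imp_differentiable_at)
  qed
  then show ?thesis by (auto simp: holomorphic_on_def intro: field_differentiable_at_within)
qed

lemma epd_mean_meromorphic:
  fixes f :: "'a::euclidean_space \<Rightarrow> complex"
  assumes f: "smooth f"
  shows "(\<lambda>\<alpha>. epd_mean \<alpha> f p) meromorphic_on UNIV"
proof -
  have "(\<lambda>\<alpha>. epd_mean \<alpha> f p) meromorphic_on {z}" for z
  proof -
    obtain k where k: "\<And>w. w \<in> ball z 1 \<Longrightarrow> Re w + real k > 2" "\<And>w. w \<in> ball z 1 \<Longrightarrow> epd_mean w f = ext_mean k w f"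
      using epd_mean_eq_ext_mean_near[OF f] by metis
    have "eventually (\<lambda>w. w \<in> ball z 1) (at z)" by (rule eventually_at_in_open') auto
    then have ev: "eventually (\<lambda>w. epd_mean w f p = ext_mean k w f p) (at z)" by eventually_elim (simp add: k(2))
    have "(\<lambda>w. ext_mean k w f p) meromorphic_on {z}"
      by (rule meromorphic_on_subset[OF ext_mean_meromorphic[OF f]]) (use k(1)[of z] in auto)
    then show ?thesis using ev by (subst meromorphic_on_cong[where g="\<lambda>w. ext_mean k w f p" and B="{z}"]) auto
  qed
  then show ?thesis by (simp add: meromorphic_on_def)
qed

text \<open>The continued mean is a witness for the definite description. Any other witness agrees
  with it on \<open>Re \<beta> > 0\<close>, hence on the complement of the exceptional set, which is
  connected because that set is countable.\<close>

lemma m_pos_eq_epd_mean: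
  fixes f :: "real ^ 'n \<Rightarrow> complex"
  assumes f: "smooth f" and \<alpha>: "\<alpha> \<notin> exceptional TYPE('n)" and t: "t > 0"
  shows "m_pos \<alpha> t (\<lambda>y. f (x - y)) = epd_mean \<alpha> f (x, t)"
proof -
  let ?F = "\<lambda>\<beta>. epd_mean \<beta> f (x, t)" and ?E = "exceptional TYPE('n)"
  have eq: "m_integral \<beta> t (\<lambda>y. f (x - y)) = ?F \<beta>" if "Re \<beta> > 0" for \<beta>
    using that by (simp add: m_integral_eq_ball_mean f t epd_mean_eq_ball_mean)
  have sub: "{\<beta>. Re \<beta> > 0} \<subseteq> - ?E" by (auto simp: exceptional_def)
  show ?thesis
    unfolding m_pos_def
  proof (rule the_equality)
    show "\<exists>F. F meromorphic_on UNIV \<and> F holomorphic_on - ?E \<and>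
        (\<forall>\<beta>. Re \<beta> > 0 \<longrightarrow> F \<beta> = m_integral \<beta> t (\<lambda>y. f (x - y))) \<and> epd_mean \<alpha> f (x, t) = F \<alpha>"
      by (intro exI[of _ ?F]) (auto simp: eq epd_mean_meromorphic f epd_mean_holomorphic)
    fix z assume "\<exists>F. F meromorphic_on UNIV \<and> F holomorphic_on - ?E \<and>
        (\<forall>\<beta>. Re \<beta> > 0 \<longrightarrow> F \<beta> = m_integral \<beta> t (\<lambda>y. f (x - y))) \<and> z = F \<alpha>"
    then obtain F where F: "F holomorphic_on - ?E" "\<And>\<beta>. Re \<beta> > 0 \<Longrightarrow> F \<beta> = ?F \<beta>" "z = F \<alpha>"
      by (auto simp: eq)
    have "F \<alpha> = ?F \<alpha>"
    proof (rule analytic_continuation_open[where s="{\<beta>. Re \<beta> > 0}" and s'="- ?E" and f=F and g="?F"])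
      have "1 \<in> {\<beta>. Re \<beta> > 0}" by simp
      then show "{\<beta>. Re \<beta> > 0} \<noteq> {}" by blast
    qed (use F \<alpha> f sub in \<open>auto simp: open_halfspace_Re_gt open_Compl_exceptional connected_Compl_exceptional
        intro: epd_mean_holomorphic\<close>)
    with F show "z = epd_mean \<alpha> f (x, t)" by simp
  qed
qed

lemma convolution_m_dist_eq_epd_mean:
  fixes f :: "real ^ 'n \<Rightarrow> complex"
  assumes f: "smooth f" and \<alpha>: "\<alpha> \<notin> exceptional TYPE('n)"
  shows "convolution f (m_dist \<alpha> t) x = epd_mean \<alpha> f (x, t)"
proof -
  have ne: "nonexceptional DIM(real ^ 'n) \<alpha>" using \<alpha> by (simp add: exceptional_iff)
  show ?thesis
  proof (cases "t = 0")
    case True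
    then show ?thesis by (simp add: convolution_def m_dist_def epd_mean_at_0[OF ne f])
  next
    case False
    then have "convolution f (m_dist \<alpha> t) x = epd_mean \<alpha> f (x, \<bar>t\<bar>)"
      by (simp add: convolution_def m_dist_def m_pos_eq_epd_mean f \<alpha>)
    also have "\<dots> = epd_mean \<alpha> f (x, t)"
      by (cases "t \<ge> 0") (simp_all add: epd_mean_even[OF ne f])
    finally show ?thesis .
  qed
qed

section \<open>Taylor expansion at the initial time\<close>

abbreviation dt :: "('a::euclidean_space \<times> real \<Rightarrow> 'b::real_normed_vector) \<Rightarrow> 'a \<times> real \<Rightarrow> 'b" where
  "dt \<equiv> dir_deriv (0, 1)"

abbreviation dx :: "'a::euclidean_space \<Rightarrow> ('a \<times> real \<Rightarrow> 'b::real_normed_vector) \<Rightarrow> 'a \<times> real \<Rightarrow> 'b" where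
  "dx b \<equiv> dir_deriv (b, 0)"

definition xlap :: "('a::euclidean_space \<times> real \<Rightarrow> complex) \<Rightarrow> 'a \<times> real \<Rightarrow> complex" where
  "xlap g = (\<lambda>p. \<Sum>b\<in>Basis. dx b (dx b g) p)"

lemma has_vector_derivative_dt:
  "smooth g \<Longrightarrow> ((\<lambda>s. g (x, s)) has_vector_derivative dt g (x, t)) (at t within S)"
  using has_vector_derivative_line[OF smooth_differentiable, where f=g and x="(x, 0)" and s=t and v="(0, 1)" and S=S] by simp

lemma has_vector_derivative_dx:
  "smooth g \<Longrightarrow> ((\<lambda>s. g (x + s *\<^sub>R b, t)) has_vector_derivative dx b g (x, t)) (at 0)"
  using has_vector_derivative_line[OF smooth_differentiable, where f=g and x="(x, t)" and s=0 and v="(b, 0)"] by simp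

lemma time_deriv_eq_dt: "smooth g \<Longrightarrow> time_deriv g = dt g"
  by (auto simp: time_deriv_def fun_eq_iff intro!: vector_derivative_at has_vector_derivative_dt)

lemma dir_deriv_slice:
  fixes g :: "'a::euclidean_space \<times> real \<Rightarrow> 'b::real_normed_vector"
  assumes "smooth g"
  shows "dir_deriv b (\<lambda>y. g (y, t)) = (\<lambda>y. dx b g (y, t))"
proof
  fix y :: 'a
  have "((\<lambda>y. (y, t)) has_derivative (\<lambda>v. (v, 0))) (at y)" by (auto intro!: derivative_eq_intros)
  from dir_deriv_eqI[OF has_derivative_compose[OF this smooth_has_derivative[OF assms]]]
  show "dir_deriv b (\<lambda>y. g (y, t)) y = dx b g (y, t)" .
qed

lemma laplacian_slice: "smooth g \<Longrightarrow> laplacian (\<lambda>y. g (y, t)) x = xlap g (x, t)"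
  by (simp add: laplacian_def xlap_def dir_deriv_slice smooth_dir_deriv)

lemma smooth_xlap: "smooth g \<Longrightarrow> smooth (xlap g)"
  unfolding xlap_def by (intro smooth_sum smooth_dir_deriv) auto

lemma dir_deriv_xlap:
  assumes "smooth g"
  shows "dir_deriv v (xlap g) = xlap (dir_deriv v g)"
proof -
  have 1: "dir_deriv v (dx b g) = dx b (dir_deriv v g)" for b
    by (rule ext) (rule dir_deriv_commute[OF assms])
  have 2: "dir_deriv v (dx b (dx b g)) = dx b (dir_deriv v (dx b g))" for b
    by (rule ext) (rule dir_deriv_commute[OF smooth_dir_deriv[OF assms]])
  show ?thesis
    unfolding xlap_def using assms by (simp add: dir_deriv_sum smooth_dir_deriv 1 2)
qed

lemma smooth_dt_pow: "smooth g \<Longrightarrow> smooth ((dt ^^ m) g)"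
  by (induction m) (auto intro: smooth_dir_deriv)

lemma dx_vanish_initially:
  fixes g :: "'a::euclidean_space \<times> real \<Rightarrow> 'b::real_normed_vector"
  assumes "smooth g" "\<And>x. g (x, 0) = 0"
  shows "dx b g (x, 0) = 0"
  using dir_deriv_slice[OF assms(1), of b 0, THEN fun_cong, of x] assms(2)
    dir_deriv_eqI[OF has_derivative_const[of "0::'b"], of b x]
  by simp

lemma dt_parity:
  fixes g :: "'a::euclidean_space \<times> real \<Rightarrow> complex"
  assumes g: "smooth g" and "\<And>x t. g (x, - t) = \<sigma> * g (x, t)"
  shows "dt g (x, - t) = - \<sigma> * dt g (x, t)"
proof -
  have "((\<lambda>s. - s) has_vector_derivative - 1) (at t)" by (auto intro!: derivative_eq_intros)
  from vector_diff_chain_at[OF this has_vector_derivative_dt[OF g]]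
  have "((\<lambda>s. g (x, - s)) has_vector_derivative - dt g (x, - t)) (at t)" by (simp add: o_def)
  then have "((\<lambda>s. \<sigma> * g (x, s)) has_vector_derivative - dt g (x, - t)) (at t)" by (simp add: assms(2))
  moreover have "((\<lambda>s. \<sigma> * g (x, s)) has_vector_derivative \<sigma> * dt g (x, t)) (at t)"
    using has_vector_derivative_mult_right[OF has_vector_derivative_dt[OF g]] .
  ultimately have "- dt g (x, - t) = \<sigma> * dt g (x, t)" by (rule vector_derivative_unique_at)
  then show ?thesis by (metis minus_equation_iff mult_minus_left)
qed

lemma dt_pow_parity:
  fixes g :: "'a::euclidean_space \<times> real \<Rightarrow> complex"
  assumes g: "smooth g" and even: "\<And>x t. g (x, - t) = g (x, t)"
  shows "(dt ^^ m) g (x, - t) = (- 1) ^ m * (dt ^^ m) g (x, t)"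
proof (induction m arbitrary: x t)
  case (Suc m)
  show ?case using dt_parity[OF smooth_dt_pow[OF g] Suc.IH, of x t] by simp
qed (simp add: even)

text \<open>Differentiating \<open>t \<Delta>w = t w\<^bsub>tt\<^esub> + c w\<^bsub>t\<^esub>\<close> \<open>m\<close> times in \<open>t\<close> and setting \<open>t = 0\<close> determines the
  \<open>(m + 1)\<close>-st Taylor coefficient in \<open>t\<close> unless \<open>c = - m\<close>; by evenness only odd \<open>m\<close> matter.\<close>

lemma epd_initially_flat:
  fixes w :: "'a::euclidean_space \<times> real \<Rightarrow> complex"
  assumes w: "smooth w" and even: "\<And>x t. w (x, - t) = w (x, t)" and init: "\<And>x. w (x, 0) = 0"
    and eq: "\<And>x t. t > 0 \<Longrightarrow> xlap w (x, t) = dt (dt w) (x, t) + c / of_real t * dt w (x, t)"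
    and c: "\<And>k::nat. odd k \<Longrightarrow> c + of_nat k \<noteq> 0"
  shows "(dt ^^ m) w (x, 0) = 0"
proof -
  let ?W = "\<lambda>m. (dt ^^ m) w"
  \<comment> \<open>The \<open>m\<close>-th time derivative of
    \<open>t * xlap w - t * dt (dt w) - c * dt w\<close>. At \<open>m = 0\<close> the truncated
    \<open>m - 1\<close> does no harm, since its term carries the factor
    \<open>of_nat m\<close>.\<close>
  define G where "G m x t = of_real t * xlap (?W m) (x, t) + of_nat m * xlap (?W (m - 1)) (x, t)
      - of_real t * ?W (m + 2) (x, t) - (c + of_nat m) * ?W (m + 1) (x, t)" for m x t
  note sW = smooth_dt_pow[OF w]
  have dx_W: "((\<lambda>s. xlap (?W m) (x, s)) has_vector_derivative xlap (?W (Suc m)) (x, t)) (at t)" for m x t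
    using has_vector_derivative_dt[OF smooth_xlap[OF sW]] by (simp add: dir_deriv_xlap[OF sW])
  have d_W: "((\<lambda>s. ?W m (x, s)) has_vector_derivative ?W (Suc m) (x, t)) (at t)" for m x t
    using has_vector_derivative_dt[OF sW] by simp
  have d_id: "((\<lambda>s. complex_of_real s) has_vector_derivative 1) (at t)" for t
    by (auto intro!: derivative_eq_intros)
  have dG: "((\<lambda>s. G m x s) has_vector_derivative G (Suc m) x t) (at t)" for m x t
  proof -
    have "((\<lambda>s. G m x s) has_vector_derivative
       (of_real t * xlap (?W (Suc m)) (x, t) + 1 * xlap (?W m) (x, t)) + of_nat m * xlap (?W (Suc (m - 1))) (x, t)
       - (of_real t * ?W (Suc (m + 2)) (x, t) + 1 * ?W (m + 2) (x, t)) - (c + of_nat m) * ?W (Suc (m + 1)) (x, t)) (at t)"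
      unfolding G_def
      by (rule has_vector_derivative_diff[OF has_vector_derivative_diff[OF has_vector_derivative_add[OF
            has_vector_derivative_mult[OF d_id dx_W] has_vector_derivative_mult_right[OF dx_W]]
            has_vector_derivative_mult[OF d_id d_W]] has_vector_derivative_mult_right[OF d_W]])
    then show ?thesis
      by (rule has_vector_derivative_eq_rhs) (cases m; simp add: G_def algebra_simps)
  qed
  have G0: "G m x t = 0" if "t > 0" for m x t
    using that
  proof (induction m arbitrary: t)
    case 0
    then show ?case by (simp add: G_def eq algebra_simps)
  next
    case (Suc m)
    have "((\<lambda>s. G m x s) has_vector_derivative 0) (at t)"
      by (rule has_vector_derivative_transform_within_open[of "\<lambda>s. 0" _ _ "{0<..}"]) (use Suc in auto)
    with dG show ?case by (rule vector_derivative_unique_at)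
  qed
  \<comment> \<open>The equation is given for \<open>t > 0\<close>; multiplied by \<open>t\<close>
    it has no singularity and reaches \<open>t = 0\<close> by continuity.\<close>
  have G00: "G m x 0 = 0" for m x
  proof -
    have "(G m x \<longlongrightarrow> G m x 0) (at_right 0)"
      using has_vector_derivative_continuous[OF dG] by (auto simp: isCont_def intro: filterlim_mono[OF _ order_refl at_le])
    moreover have "(G m x \<longlongrightarrow> 0) (at_right 0)"
      by (rule tendsto_eventually) (auto simp: eventually_at_filter G0)
    ultimately show ?thesis using tendsto_unique trivial_limit_at_right_real by blast
  qed
  show ?thesis
  proof (induction m arbitrary: x rule: less_induct)
    case (less m)
    consider "m = 0" | "odd m" | j where "m = Suc j" "odd j"
      by (metis even_Suc not0_implies_Suc)
    then show ?case
    proof cases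
      case 1
      then show ?thesis by (simp add: init)
    next
      case 2
      then show ?thesis using dt_pow_parity[OF w even, of m x 0] by simp
    next
      case 3
      then obtain i where i: "j = Suc i" by (metis odd_pos gr0_implies_Suc)
      \<comment> \<open>At \<open>t = 0\<close> the relation for \<open>j\<close> reads
        \<open>j * xlap (W (j - 1)) = (c + j) * W (j + 1)\<close>. The left side is zero because
        \<open>W (j - 1)\<close> vanishes on the whole slice.\<close>
      have "xlap (?W i) (x, 0) = 0"
        using less.IH[of i] 3 i unfolding xlap_def
        by (intro sum.neutral ballI dx_vanish_initially smooth_dir_deriv sW) auto
      with G00[of j x] have "(c + of_nat j) * ?W m (x, 0) = 0"
        using 3 i by (simp add: G_def)
      then show ?thesis using c[OF 3(2)] by simp
    qed
  qed
qed

definition flat :: "('a::euclidean_space \<times> real \<Rightarrow> complex) \<Rightarrow> bool" where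
  "flat g \<longleftrightarrow> smooth g \<and> (\<forall>m x. (dt ^^ m) g (x, 0) = 0)"

lemma flat_dt: "flat g \<Longrightarrow> flat (dt g)"
  unfolding flat_def by (metis funpow_swap1 funpow_simps_right(2) o_apply smooth_dir_deriv)

lemma dt_pow_dx:
  fixes g :: "'a::euclidean_space \<times> real \<Rightarrow> complex"
  assumes "smooth g"
  shows "(dt ^^ m) (dx b g) = dx b ((dt ^^ m) g)"
proof (induction m)
  case (Suc m)
  have "dt (dx b ((dt ^^ m) g)) = dx b (dt ((dt ^^ m) g))"
    by (rule ext) (rule dir_deriv_commute[OF smooth_dt_pow[OF assms]])
  with Suc show ?case by simp
qed simp

lemma flat_dx: "flat g \<Longrightarrow> flat (dx b g)"
  unfolding flat_def using smooth_dir_deriv by (auto simp: dt_pow_dx intro!: dx_vanish_initially smooth_dt_pow)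

text \<open>By the mean value inequality a bound of order \<open>N\<close> for \<open>dt g\<close>
  becomes one of order \<open>N + 1\<close> for \<open>g\<close>, which vanishes at time
  \<open>0\<close>. Flatness passes to \<open>dt g\<close>, so the induction varies
  \<open>g\<close>.\<close>

lemma flat_bound:
  assumes "flat g" "compact K"
  shows "\<exists>M\<ge>0. \<forall>x\<in>K. \<forall>t\<in>{0..T}. norm (g (x, t)) \<le> M * t ^ N"
  using assms(1)
proof (induction N arbitrary: g)
  case 0
  have "compact (g ` (K \<times> {0..T}))"
    using 0 by (intro compact_continuous_image compact_Times assms(2) smooth_continuous_on) (auto simp: flat_def)
  then obtain M where "M > 0" "\<And>z. z \<in> g ` (K \<times> {0..T}) \<Longrightarrow> norm z \<le> M"
    using compact_imp_bounded bounded_pos by metis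
  then show ?case by (intro exI[of _ M]) auto
next
  case (Suc N)
  obtain M where M: "M \<ge> 0" "\<And>x t. x \<in> K \<Longrightarrow> t \<in> {0..T} \<Longrightarrow> norm (dt g (x, t)) \<le> M * t ^ N"
    using Suc.IH[OF flat_dt[OF Suc.prems]] by blast
  have "norm (g (x, t)) \<le> M * t ^ Suc N" if "x \<in> K" "t \<in> {0..T}" for x t
  proof -
    have "norm (g (x, t) - g (x, 0)) \<le> (M * t ^ N) * norm (t - 0)"
    proof (rule differentiable_bound[of "{0..t}"])
      show "((\<lambda>s. g (x, s)) has_derivative (\<lambda>h. h *\<^sub>R dt g (x, s))) (at s within {0..t})" if "s \<in> {0..t}" for s
        using has_vector_derivative_dt[of g x s] Suc.prems by (auto simp: flat_def has_vector_derivative_def)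
      show "onorm (\<lambda>h. h *\<^sub>R dt g (x, s)) \<le> M * t ^ N" if s: "s \<in> {0..t}" for s
      proof -
        have "norm (dt g (x, s)) \<le> M * s ^ N" using M(2) \<open>x \<in> K\<close> \<open>t \<in> {0..T}\<close> s by auto
        also have "\<dots> \<le> M * t ^ N" using s M by (intro mult_left_mono power_mono) auto
        finally show ?thesis
          by (intro onorm_le) (metis mult.commute mult_right_mono norm_ge_zero norm_scaleR real_norm_def)
      qed
    qed (use that in auto)
    moreover have "g (x, 0) = 0" using Suc.prems unfolding flat_def by (metis funpow_0)
    ultimately show ?thesis using that by (simp add: mult_ac)
  qed
  with M show ?case by (intro exI[of _ M]) auto
qed

section \<open>Energy estimate and uniqueness\<close>

lemma has_real_derivative_inner:
  fixes f g :: "real \<Rightarrow> 'a::real_inner"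
  assumes "(f has_vector_derivative f') (at t)" "(g has_vector_derivative g') (at t)"
  shows "((\<lambda>s. f s \<bullet> g s) has_real_derivative f t \<bullet> g' + f' \<bullet> g t) (at t)"
proof -
  have "((\<lambda>s. f s \<bullet> g s) has_derivative (\<lambda>h. f t \<bullet> (h *\<^sub>R g') + (h *\<^sub>R f') \<bullet> g t)) (at t)"
    using assms unfolding has_vector_derivative_def by (rule has_derivative_inner)
  then show ?thesis
    unfolding has_field_derivative_def by (rule has_derivative_eq_rhs) (auto simp: algebra_simps)
qed

text \<open>The energy is weighted by the squared positive part of \<open>R - t - sqrt (1 + \<parallel>x - x\<^sub>0\<parallel>\<^sup>2)\<close>: this is \<open>C\<^sup>1\<close>
  with compact support in \<open>x\<close>, and its derivatives have the sign that finite propagation speed requires. The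
  singular term \<open>c / t\<close> is absorbed by the factor \<open>t powr (- 2 \<bar>Re c\<bar>)\<close>, which flatness at \<open>t = 0\<close> beats.\<close>

lemma flat_epd_solution_eq_0:
  fixes w :: "'a::euclidean_space \<times> real \<Rightarrow> complex"
  assumes flat: "flat w"
    and eq: "\<And>x t. t > 0 \<Longrightarrow> xlap w (x, t) = dt (dt w) (x, t) + c / of_real t * dt w (x, t)"
    and t0: "t0 > 0"
  shows "w (x0, t0) = 0"
proof -
  have w: "smooth w" using flat by (simp add: flat_def)
  note s1 = smooth_dir_deriv[OF w] and s2 = smooth_dir_deriv[OF smooth_dir_deriv[OF w]]
  \<comment> \<open>Since \<open>\<rho> x0 = 1\<close>, this choice makes
    \<open>m x0 t \<ge> 1\<close> for all \<open>t \<le> t0\<close>.\<close>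
  define R where "R = t0 + 2"
  have R: "R > 0" using t0 by (simp add: R_def)
  \<comment> \<open>A smooth substitute for the distance to \<open>x0\<close>. Its gradient, with
    components \<open>r b x\<close>, has norm below \<open>1\<close>, the speed of
    propagation.\<close>
  define \<rho> where "\<rho> x = sqrt (1 + (norm (x - x0))\<^sup>2)" for x
  have pos: "1 + (norm (x - x0))\<^sup>2 > 0" for x by (simp add: add_pos_nonneg)
  have \<rho>: "\<rho> x > 0" "norm (x - x0) \<le> \<rho> x" "(\<rho> x)\<^sup>2 = 1 + (norm (x - x0))\<^sup>2" for x
    using pos[of x] by (auto simp: \<rho>_def real_le_rsqrt)
  define m where "m x t = max 0 (R - t - \<rho> x)" for x t
  have m0: "m x t \<ge> 0" for x t by (simp add: m_def)
  have m_out: "m x t = 0" if "norm (x - x0) \<ge> R" "t \<ge> 0" for x t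
    using that \<rho>(2)[of x] by (simp add: m_def)
  define e where "e x t = (norm (dt w (x, t)))\<^sup>2 + (\<Sum>b\<in>Basis. (norm (dx b w (x, t)))\<^sup>2)" for x t
  have e0: "e x t \<ge> 0" for x t by (simp add: e_def sum_nonneg)
  define e' where "e' x t = 2 * (dt w (x, t) \<bullet> dt (dt w) (x, t)) + (\<Sum>b\<in>Basis. 2 * (dx b w (x, t) \<bullet> dt (dx b w) (x, t)))" for x t
  define F where "F x t = (m x t)\<^sup>2 * e' x t + - (2 * m x t) * e x t" for x t
  define r where "r b x = ((x - x0) \<bullet> b) / \<rho> x" for b x
  \<comment> \<open>The derivative in direction \<open>b\<close> of the energy flux
    \<open>(m x t)^2 * (dt w \<bullet> dx b w)\<close>. Its integral over space is zero, and its sum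
    over \<open>b\<close> contains the second derivatives that the equation brings into
    \<open>F\<close>.\<close>
  define \<psi>' where "\<psi>' b t x = (m x t)\<^sup>2 * (dt w (x, t) \<bullet> dx b (dx b w) (x, t) + dx b (dt w) (x, t) \<bullet> dx b w (x, t))
     + - (2 * m x t * r b x) * (dt w (x, t) \<bullet> dx b w (x, t))" for b t x
  obtain k where k: "cball x0 R \<subseteq> box (- k) k"
    using bounded_subset_box_symmetric[OF bounded_cball] by metis
  define K where "K = cbox (- k) k"
  have K: "x \<in> K" if "norm (x - x0) \<le> R" for x
    using k that box_subset_cbox[of "- k" k] by (auto simp: K_def subset_iff dist_norm norm_minus_commute)
  have x0K: "x0 \<in> K" "x0 \<in> box (- k) k" using K[of x0] R k by auto

  have cg: "continuous_on S (\<lambda>z. g (snd z, fst z))" if "smooth g" for g :: "'a \<times> real \<Rightarrow> complex" and S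
    by (rule smooth_continuous_on_compose[OF that]) (auto intro!: continuous_intros)
  have c\<rho>: "continuous_on S (\<lambda>z. \<rho> (h z))" if "continuous_on S h" for S :: "'s::topological_space set" and h
    unfolding \<rho>_def by (intro continuous_intros that)
  have cm: "continuous_on S (\<lambda>z. m (snd z) (fst z))" for S
    unfolding m_def by (intro continuous_intros c\<rho>)
  have ce: "continuous_on S (\<lambda>z. e (snd z) (fst z))" for S
    unfolding e_def by (intro continuous_intros cg s1)
  have cF: "continuous_on S (\<lambda>z. F (snd z) (fst z))" for S
    unfolding F_def e'_def by (intro continuous_intros cm ce cg s1 s2)
  have c\<psi>': "continuous_on S (\<lambda>z. \<psi>' b (fst z) (snd z))" for S b
    unfolding \<psi>'_def r_def using \<rho>(1)[THEN less_imp_neq, symmetric] by (intro continuous_intros cm c\<rho> cg s1 s2) auto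
  have slice: "continuous_on S (H t)" if "\<And>S. continuous_on S (\<lambda>z. H (fst z) (snd z))"
    for S :: "'a set" and H :: "real \<Rightarrow> 'a \<Rightarrow> real" and t
  proof -
    have "continuous_on S (\<lambda>x. (\<lambda>z. H (fst z) (snd z)) (t, x))"
      by (rule continuous_on_compose2[OF that[of UNIV]]) (auto intro!: continuous_intros)
    then show ?thesis by simp
  qed

  define E where "E t = integral K (\<lambda>x. (m x t)\<^sup>2 * e x t)" for t
  have dm: "((\<lambda>t. (m x t)\<^sup>2) has_real_derivative - (2 * m x t)) (at t)" for x t
  proof -
    have "((\<lambda>t. R - t - \<rho> x) has_real_derivative - 1) (at t)" by (auto intro!: derivative_eq_intros)
    from DERIV_chain2[OF has_real_derivative_max_0_square this] show ?thesis by (simp add: m_def)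
  qed
  have de: "((\<lambda>t. e x t) has_real_derivative e' x t) (at t)" for x t
  proof -
    have dgg: "((\<lambda>s. g (x, s) \<bullet> g (x, s)) has_real_derivative 2 * (g (x, t) \<bullet> dt g (x, t))) (at t)"
      if "smooth g" for g :: "'a \<times> real \<Rightarrow> complex"
      using has_real_derivative_inner[OF has_vector_derivative_dt[OF that, of x t] has_vector_derivative_dt[OF that, of x t]]
      by (simp add: inner_commute)
    show ?thesis
      unfolding e_def e'_def power2_norm_eq_inner by (intro DERIV_add DERIV_sum dgg s1)
  qed
  have dE: "(E has_real_derivative integral K (\<lambda>x. F x t)) (at t)" for t
  proof -
    have "((\<lambda>t. integral (cbox (- k) k) (\<lambda>x. (m x t)\<^sup>2 * e x t)) has_real_derivative integral (cbox (- k) k) (\<lambda>x. F x t)) (at t within UNIV)"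
    proof (rule leibniz_rule_field_derivative)
      show "((\<lambda>t. (m x t)\<^sup>2 * e x t) has_real_derivative F x t) (at t within UNIV)" for x t
        using DERIV_mult[OF dm[of x t] de[of x t]] by (simp add: F_def algebra_simps)
      show "(\<lambda>x. (m x t)\<^sup>2 * e x t) integrable_on cbox (- k) k" for t
        by (intro integrable_continuous slice[of "\<lambda>t x. (m x t)\<^sup>2 * e x t"] continuous_intros cm ce)
      show "continuous_on (UNIV \<times> cbox (- k) k) (\<lambda>(t, x). F x t)"
        using cF by (simp add: split_beta)
    qed auto
    then show ?thesis by (simp add: E_def[abs_def] K_def)
  qed

  have int\<psi>': "integral K (\<psi>' b t) = 0" if t: "t \<ge> 0" for b t
  proof -
    let ?\<psi> = "\<lambda>x. (m x t)\<^sup>2 * (dt w (x, t) \<bullet> dx b w (x, t))"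
    have "(LINT x|lborel. \<psi>' b t x) = 0"
    proof (rule integral_dir_deriv_eq_0(2)[where \<psi>="?\<psi>" and R="R + norm x0" and b=b])
      fix x :: 'a
      have "((\<lambda>s. 1 + (norm (x + s *\<^sub>R b - x0))\<^sup>2) has_real_derivative 2 * ((x - x0) \<bullet> b)) (at 0)"
        unfolding power2_norm_eq_inner
        by (auto intro!: derivative_eq_intros has_derivative_imp_has_field_derivative simp: algebra_simps inner_commute)
      from DERIV_chain2[OF DERIV_real_sqrt this] pos[of x]
      have "((\<lambda>s. \<rho> (x + s *\<^sub>R b)) has_real_derivative r b x) (at 0)"
        by (simp add: \<rho>_def r_def field_simps)
      then have "((\<lambda>s. R - t - \<rho> (x + s *\<^sub>R b)) has_real_derivative - r b x) (at 0)"
        by (auto intro!: derivative_eq_intros)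
      from DERIV_chain2[OF has_real_derivative_max_0_square this]
      have d1: "((\<lambda>s. (m (x + s *\<^sub>R b) t)\<^sup>2) has_real_derivative - (2 * m x t * r b x)) (at 0)"
        by (simp add: m_def)
      have d2: "((\<lambda>s. dt w (x + s *\<^sub>R b, t) \<bullet> dx b w (x + s *\<^sub>R b, t)) has_real_derivative
          dt w (x, t) \<bullet> dx b (dx b w) (x, t) + dx b (dt w) (x, t) \<bullet> dx b w (x, t)) (at 0)"
        using has_real_derivative_inner[OF has_vector_derivative_dx[OF s1] has_vector_derivative_dx[OF s1]] by simp
      show "((\<lambda>s. ?\<psi> (x + s *\<^sub>R b)) has_vector_derivative \<psi>' b t x) (at 0)"
        using DERIV_mult[OF d1 d2] unfolding has_real_derivative_iff_has_vector_derivative[symmetric]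
        by (simp add: \<psi>'_def algebra_simps)
      show "?\<psi> x = 0" if "norm x \<ge> R + norm x0"
        using that m_out[of x t] t norm_triangle_ineq2[of x x0] by simp
    next
      show "continuous_on UNIV ?\<psi>"
        by (intro slice[of "\<lambda>t x. (m x t)\<^sup>2 * (dt w (x, t) \<bullet> dx b w (x, t))"] continuous_intros cm cg s1)
    qed (rule slice[OF c\<psi>'])
    moreover have "\<psi>' b t x = 0" if "x \<notin> cbox (- k) k" for x
    proof -
      have "R \<le> norm (x - x0)" using that K[of x] unfolding K_def by linarith
      then show ?thesis using m_out[of x t] t by (simp add: \<psi>'_def)
    qed
    ultimately show ?thesis
      unfolding K_def using integrable_continuous_compact_support(2)[OF slice[OF c\<psi>']] by metis
  qed

  \<comment> \<open>The singular term contributes \<open>- 2 * Re c / t * |dt w|^2\<close> to the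
    energy balance, with either sign; it is bounded by \<open>p / t\<close> times the energy
    density.\<close>
  define p where "p = 2 * \<bar>Re c\<bar>"
  \<comment> \<open>Subtracting the divergence cancels all second derivatives. The moving cutoff
    leaves \<open>2 * m x t * (2 * S1 - e x t)\<close>, which is nonpositive because the gradient of
    \<open>\<rho>\<close> has norm at most \<open>1\<close>.\<close>
  have ineq: "F x t - 2 * (\<Sum>b\<in>Basis. \<psi>' b t x) \<le> p / t * ((m x t)\<^sup>2 * e x t)" if t: "t > 0" for x t
  proof -
    let ?wt = "dt w (x, t)" and ?d = "\<lambda>b. dx b w (x, t)"
    define S1 where "S1 = (\<Sum>b\<in>Basis. r b x * (?wt \<bullet> ?d b))"
    define S2 where "S2 = (\<Sum>b\<in>Basis. dx b (dt w) (x, t) \<bullet> ?d b)"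
    have comm: "dt (dx b w) (x, t) = dx b (dt w) (x, t)" for b by (rule dir_deriv_commute[OF w])
    have e'_eq: "e' x t = 2 * (?wt \<bullet> dt (dt w) (x, t)) + 2 * S2"
      by (simp add: e'_def S2_def comm sum_distrib_left inner_commute)
    have \<psi>_eq: "(\<Sum>b\<in>Basis. \<psi>' b t x) = (m x t)\<^sup>2 * (?wt \<bullet> xlap w (x, t) + S2) - 2 * m x t * S1"
      unfolding \<psi>'_def S1_def S2_def xlap_def
      by (simp add: inner_sum_right sum.distrib sum_distrib_left distrib_left sum_negf sum_subtractf mult.assoc)
    have inner_c: "?wt \<bullet> (c / of_real t * ?wt) = Re c / t * (norm ?wt)\<^sup>2"
      unfolding cmod_power2 inner_complex_def
      by (simp add: power2_eq_square Re_divide_of_real Im_divide_of_real add_divide_distrib diff_divide_distrib algebra_simps)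
    have S1_le: "2 * S1 \<le> e x t"
    proof -
      have "2 * (r b x * (?wt \<bullet> ?d b)) \<le> (r b x)\<^sup>2 * (norm ?wt)\<^sup>2 + (norm (?d b))\<^sup>2" for b
      proof -
        have "0 \<le> (norm (r b x *\<^sub>R ?wt - ?d b))\<^sup>2" by simp
        also have "\<dots> = (r b x)\<^sup>2 * (norm ?wt)\<^sup>2 + (norm (?d b))\<^sup>2 - 2 * (r b x * (?wt \<bullet> ?d b))"
          unfolding power2_norm_eq_inner by (simp add: algebra_simps inner_commute power2_eq_square)
        finally show ?thesis by simp
      qed
      then have "2 * S1 \<le> (\<Sum>b\<in>Basis. (r b x)\<^sup>2 * (norm ?wt)\<^sup>2 + (norm (?d b))\<^sup>2)"
        unfolding S1_def sum_distrib_left by (intro sum_mono)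
      also have "\<dots> = (\<Sum>b\<in>Basis. (r b x)\<^sup>2) * (norm ?wt)\<^sup>2 + (\<Sum>b\<in>Basis. (norm (?d b))\<^sup>2)"
        by (simp add: sum.distrib sum_distrib_right)
      also have "(\<Sum>b\<in>Basis. (r b x)\<^sup>2) = (norm (x - x0))\<^sup>2 / (\<rho> x)\<^sup>2"
        unfolding r_def power2_norm_eq_inner euclidean_inner[of "x - x0" "x - x0"]
        by (simp add: power_divide sum_divide_distrib power2_eq_square)
      also have "\<dots> * (norm ?wt)\<^sup>2 + (\<Sum>b\<in>Basis. (norm (?d b))\<^sup>2) \<le> 1 * (norm ?wt)\<^sup>2 + (\<Sum>b\<in>Basis. (norm (?d b))\<^sup>2)"
        using pos[of x] by (intro add_right_mono mult_right_mono) (auto simp: \<rho>(3))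
      finally show ?thesis by (simp add: e_def)
    qed
    have "F x t - 2 * (\<Sum>b\<in>Basis. \<psi>' b t x)
       = 2 * m x t * (2 * S1 - e x t) + (m x t)\<^sup>2 * (- 2 * Re c / t * (norm ?wt)\<^sup>2)"
      unfolding F_def \<psi>_eq e'_eq eq[OF t] inner_add_right inner_c by (simp add: algebra_simps)
    also have "\<dots> \<le> 0 + (m x t)\<^sup>2 * (p / t * e x t)"
    proof (rule add_mono)
      show "2 * m x t * (2 * S1 - e x t) \<le> 0" using S1_le m0[of x t] by (simp add: mult_nonneg_nonpos)
      have "- 2 * Re c / t * (norm ?wt)\<^sup>2 \<le> p / t * (norm ?wt)\<^sup>2"
        using t by (intro mult_right_mono divide_right_mono) (auto simp: p_def)
      also have "\<dots> \<le> p / t * e x t"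
        using t by (intro mult_left_mono) (auto simp: p_def e_def sum_nonneg)
      finally show "(m x t)\<^sup>2 * (- 2 * Re c / t * (norm ?wt)\<^sup>2) \<le> (m x t)\<^sup>2 * (p / t * e x t)"
        by (intro mult_left_mono) auto
    qed
    finally show ?thesis by (simp add: mult_ac)
  qed

  have iE: "(\<lambda>x. (m x t)\<^sup>2 * e x t) integrable_on K" for t
    unfolding K_def by (intro integrable_continuous slice[of "\<lambda>t x. (m x t)\<^sup>2 * e x t"] continuous_intros cm ce)
  have E'_le: "integral K (\<lambda>x. F x t) \<le> p / t * E t" if t: "t > 0" for t
  proof -
    have i\<psi>: "\<psi>' b t integrable_on K" for b
      unfolding K_def by (intro integrable_continuous slice[OF c\<psi>'])
    have iF: "(\<lambda>x. F x t) integrable_on K"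
      unfolding K_def by (intro integrable_continuous slice[of "\<lambda>t x. F x t"] cF)
    have i2: "(\<lambda>x. 2 * (\<Sum>b\<in>Basis. \<psi>' b t x)) integrable_on K"
      using i\<psi> by (intro integrable_on_mult_right integrable_sum) auto
    have "integral K (\<lambda>x. 2 * (\<Sum>b\<in>Basis. \<psi>' b t x)) = 0"
      using i\<psi> t by (simp add: integral_sum int\<psi>')
    then have "integral K (\<lambda>x. F x t) = integral K (\<lambda>x. F x t - 2 * (\<Sum>b\<in>Basis. \<psi>' b t x))"
      using iF i2 by (simp add: integral_diff)
    also have "\<dots> \<le> integral K (\<lambda>x. p / t * ((m x t)\<^sup>2 * e x t))"
      by (intro integral_le integrable_diff[OF iF i2] integrable_on_mult_right iE ineq[OF t])
    also have "\<dots> = p / t * E t" by (simp add: E_def)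
    finally show ?thesis .
  qed

  \<comment> \<open>The energy is quadratic, so bounds of order \<open>N\<close> on the first
    derivatives of \<open>w\<close> make it \<open>O(t^(2 N))\<close>, and
    \<open>2 N > p\<close>.\<close>
  obtain N :: nat where N: "real N > p" using reals_Archimedean2 by blast
  obtain C where C: "C \<ge> 0" "\<And>t. 0 < t \<Longrightarrow> t \<le> t0 \<Longrightarrow> E t \<le> C * t ^ (2 * N)"
  proof -
    have cK: "compact K" by (simp add: K_def compact_cbox)
    have bound: "\<exists>M\<ge>0. \<forall>x\<in>K. \<forall>t\<in>{0..t0}. (norm (g (x, t)))\<^sup>2 \<le> M * t ^ (2 * N)" if g: "flat g" for g :: "'a \<times> real \<Rightarrow> complex"
    proof -
      obtain M where M: "M \<ge> 0" "\<And>x t. x \<in> K \<Longrightarrow> t \<in> {0..t0} \<Longrightarrow> norm (g (x, t)) \<le> M * t ^ N"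
        using flat_bound[OF g cK, of t0 N] by blast
      have "(norm (g (x, t)))\<^sup>2 \<le> M\<^sup>2 * t ^ (2 * N)" if "x \<in> K" "t \<in> {0..t0}" for x t
        using power_mono[OF M(2)[OF that], of 2] by (simp add: power_mult_distrib power_mult mult.commute)
      then show ?thesis by (intro exI[of _ "M\<^sup>2"]) auto
    qed
    obtain M0 where M0: "M0 \<ge> 0" "\<And>x t. x \<in> K \<Longrightarrow> t \<in> {0..t0} \<Longrightarrow> (norm (dt w (x, t)))\<^sup>2 \<le> M0 * t ^ (2 * N)"
      using bound[OF flat_dt[OF flat]] by blast
    obtain M where M: "\<And>b. M b \<ge> 0" "\<And>b x t. x \<in> K \<Longrightarrow> t \<in> {0..t0} \<Longrightarrow> (norm (dx b w (x, t)))\<^sup>2 \<le> M b * t ^ (2 * N)"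
      using bound[OF flat_dx[OF flat]] by metis
    define M' where "M' = M0 + (\<Sum>b\<in>Basis. M b)"
    have M': "M' \<ge> 0" using M0 M by (simp add: M'_def sum_nonneg)
    have "E t \<le> (R\<^sup>2 * M' * measure lborel K) * t ^ (2 * N)" if t: "0 < t" "t \<le> t0" for t
    proof -
      have "(m x t)\<^sup>2 * e x t \<le> R\<^sup>2 * (M' * t ^ (2 * N))" if "x \<in> K" for x
      proof (rule mult_mono)
        have "m x t \<le> R" using t \<rho>(1)[of x] R by (simp add: m_def)
        then show "(m x t)\<^sup>2 \<le> R\<^sup>2" using m0 by (intro power_mono)
        show "e x t \<le> M' * t ^ (2 * N)"
          unfolding e_def M'_def distrib_right sum_distrib_right using that t by (intro add_mono sum_mono M0 M) auto
      qed (use e0 in auto)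
      then have "E t \<le> integral K (\<lambda>x. R\<^sup>2 * (M' * t ^ (2 * N)))"
        unfolding E_def using iE by (intro integral_le) (auto simp: K_def)
      also have "\<dots> = (R\<^sup>2 * M' * measure lborel K) * t ^ (2 * N)" by (simp add: K_def)
      finally show ?thesis .
    qed
    then show ?thesis using M' by (intro that[of "R\<^sup>2 * M' * measure lborel K"]) auto
  qed

  \<comment> \<open>The integrating factor for \<open>E' \<le> (p / t) * E\<close>: \<open>G\<close>
    is nonincreasing, so \<open>G t\<close> is at most its limit at \<open>0\<close>, which is zero
    because the order \<open>2 N\<close> of \<open>E\<close> exceeds \<open>p\<close>.\<close>
  define G where "G t = t powr (- p) * E t" for t
  have G_mono: "G t \<le> G s" if "0 < s" "s \<le> t" for s t
  proof (rule DERIV_nonpos_imp_nonincreasing[OF that(2)])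
    fix u assume "s \<le> u" "u \<le> t"
    then have u: "u > 0" using that by simp
    have "(G has_real_derivative (- p * u powr (- p - 1)) * E u + integral K (\<lambda>x. F x u) * u powr (- p)) (at u)"
      unfolding G_def[abs_def] using u by (intro DERIV_mult dE) (auto intro!: derivative_eq_intros)
    moreover have "(- p * u powr (- p - 1)) * E u + integral K (\<lambda>x. F x u) * u powr (- p) \<le> 0"
    proof -
      have "integral K (\<lambda>x. F x u) * u powr (- p) \<le> p / u * E u * u powr (- p)"
        using E'_le[OF u] by (intro mult_right_mono) auto
      also have "\<dots> = p * u powr (- p - 1) * E u" using u by (simp add: powr_diff)
      finally show ?thesis by simp
    qed
    ultimately show "\<exists>y. (G has_real_derivative y) (at u) \<and> y \<le> 0" by blast
  qed
  have E_nonneg: "E t \<ge> 0" for t unfolding E_def by (intro integral_nonneg iE) (auto simp: e0)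
  have E_zero: "E t = 0" if t: "0 < t" "t \<le> t0" for t
  proof -
    have "G t \<le> C * s powr (2 * real N - p)" if s: "0 < s" "s \<le> t" for s
    proof -
      have "G t \<le> G s" using s by (rule G_mono)
      also have "\<dots> \<le> s powr (- p) * (C * s ^ (2 * N))"
        unfolding G_def using C(2)[of s] s t by (intro mult_left_mono) auto
      also have "s ^ (2 * N) = s powr (2 * real N)" using s powr_realpow[of s "2 * N"] by simp
      also have "s powr (- p) * (C * s powr (2 * real N)) = C * s powr (2 * real N - p)"
        using s by (simp add: powr_diff powr_minus field_simps)
      finally show ?thesis .
    qed
    then have "\<forall>\<^sub>F s in at_right 0. G t \<le> C * s powr (2 * real N - p)"
      using t unfolding eventually_at_right_field by (intro exI[of _ t]) auto
    moreover have "((\<lambda>s. C * s powr (2 * real N - p)) \<longlongrightarrow> C * 0) (at_right 0)"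
      using N p_def
      by (intro tendsto_mult tendsto_const tendsto_zero_powrI[where b="2 * real N - p"])
        (auto intro: tendsto_ident_at eventually_at_right_less simp: eventually_at_filter)
    ultimately have "G t \<le> 0" using tendsto_lowerbound[of _ "C * 0" "at_right (0::real)"] by simp
    with t E_nonneg[of t] show ?thesis by (simp add: G_def mult_le_0_iff)
  qed
  \<comment> \<open>A continuous nonnegative integrand with integral zero vanishes in the interior
    of the box, in particular at \<open>x0\<close>, where the cutoff is positive.\<close>
  have "dt w (x0, t) = 0" if t: "0 < t" "t \<le> t0" for t
  proof -
    have "(m x0 t)\<^sup>2 * e x0 t = 0"
    proof (rule has_integral_0_cbox_imp_0[of "- k" k "\<lambda>x. (m x t)\<^sup>2 * e x t"])
      show "continuous_on (cbox (- k) k) (\<lambda>x. (m x t)\<^sup>2 * e x t)"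
        by (intro slice[of "\<lambda>t x. (m x t)\<^sup>2 * e x t"] continuous_intros cm ce)
      show "((\<lambda>x. (m x t)\<^sup>2 * e x t) has_integral 0) (cbox (- k) k)"
        using integrable_integral[OF iE[of t]] E_zero[OF t] unfolding E_def K_def by simp
    qed (use x0K e0 in \<open>auto simp: K_def\<close>)
    moreover have "m x0 t > 0" using t by (simp add: m_def R_def \<rho>_def)
    ultimately have "e x0 t = 0" by simp
    then show ?thesis
      using add_nonneg_eq_0_iff[of "(norm (dt w (x0, t)))\<^sup>2" "\<Sum>b\<in>Basis. (norm (dx b w (x0, t)))\<^sup>2"]
      by (simp add: e_def sum_nonneg)
  qed
  moreover have "dt w (x0, 0) = 0" using flat_dt[OF flat] unfolding flat_def by (metis funpow_0)
  ultimately have dz: "dt w (x0, t) = 0" if "t \<in> {0..t0}" for t using that by (cases "t = 0") auto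
  have "((\<lambda>t. w (x0, t)) has_vector_derivative 0) (at t within {0..t0})" if "t \<in> {0..t0}" for t
    using has_vector_derivative_dt[OF w, of x0 t] dz[OF that] by simp
  then obtain y where "\<And>t. t \<in> {0..t0} \<Longrightarrow> w (x0, t) = y"
    using has_vector_derivative_zero_constant[of "{0..t0}" "\<lambda>t. w (x0, t)"] by auto
  then have "w (x0, t0) = w (x0, 0)" using t0 by simp
  also have "\<dots> = 0" using flat unfolding flat_def by (metis funpow_0)
  finally show ?thesis .
qed

text \<open>The difference of two solutions solves the equation with zero initial values. It is flat
  at time \<open>0\<close>, hence zero for \<open>t > 0\<close> by the energy estimate, and evenness
  settles \<open>t < 0\<close>.\<close>

lemma epd_solution_unique:
  fixes f :: "real ^ 'n \<Rightarrow> complex"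
  assumes \<alpha>: "\<alpha> \<notin> exceptional TYPE('n)"
    and u: "smooth u" "even_in_time u" "solves_cauchy \<alpha> f u"
    and v: "smooth v" "even_in_time v" "solves_cauchy \<alpha> f v"
  shows "v = u"
proof -
  let ?w = "\<lambda>p. v p - u p" and ?c = "of_nat CARD('n) - 1 + 2 * \<alpha>"
  have init: "g (x, 0) = f x" if "smooth g" "solves_cauchy \<alpha> f g" for g x
  proof -
    have "((\<lambda>t. g (x, t)) \<longlongrightarrow> g (x, 0)) (at_right 0)"
      by (intro isCont_tendsto_compose[OF smooth_isCont[OF that(1)]] tendsto_intros)
    moreover have "((\<lambda>t. g (x, t)) \<longlongrightarrow> f x) (at_right 0)" using that(2) by (simp add: solves_cauchy_def)
    ultimately show ?thesis using tendsto_unique trivial_limit_at_right_real by blast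
  qed
  have pde: "xlap g (x, t) = dt (dt g) (x, t) + ?c / of_real t * dt g (x, t)"
    if "smooth g" "solves_cauchy \<alpha> f g" "t > 0" for g x t
    using that by (simp add: solves_cauchy_def laplacian_slice time_deriv_eq_dt smooth_dir_deriv)
  have w: "smooth ?w" by (rule smooth_diff[OF v(1) u(1)])
  have dw: "dir_deriv a (\<lambda>p. g p - h p) = (\<lambda>p. dir_deriv a g p - dir_deriv a h p)"
    if "smooth g" "smooth h" for a and g h :: "(real ^ 'n) \<times> real \<Rightarrow> complex"
    using that by (intro ext dir_deriv_eqI has_derivative_diff smooth_has_derivative)
  have weq: "xlap ?w (x, t) = dt (dt ?w) (x, t) + ?c / of_real t * dt ?w (x, t)" if "t > 0" for x t
    using pde[OF u(1,3) that, of x] pde[OF v(1,3) that, of x] u v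
    by (simp add: xlap_def dw smooth_dir_deriv sum_subtractf right_diff_distrib)
  have "flat ?w"
    unfolding flat_def
  proof (intro conjI allI w)
    show "(dt ^^ m) ?w (x, 0) = 0" for m x
    proof (rule epd_initially_flat[OF w _ _ weq])
      show "?w (x, - t) = ?w (x, t)" for x t using u(2) v(2) by (simp add: even_in_time_def)
      show "?w (x, 0) = 0" for x using init[OF u(1,3)] init[OF v(1,3)] by simp
      show "?c + of_nat k \<noteq> 0" if "odd k" for k
      proof -
        \<comment> \<open>For odd \<open>k = 2 j + 1\<close> the factor
          \<open>n - 1 + 2 \<alpha> + k\<close> is \<open>n + 2 \<alpha> + 2 j\<close>, a zero of
          which would be an exceptional parameter.\<close>
        from that obtain j where "k = Suc (2 * j)" by (metis oddE Suc_eq_plus1)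
        then have "?c + of_nat k = of_nat CARD('n) + 2 * \<alpha> + 2 * of_nat j" by simp
        moreover have "of_nat CARD('n) + 2 * \<alpha> + 2 * of_nat j \<noteq> 0"
          using \<alpha> by (simp add: exceptional_iff nonexceptional_def)
        ultimately show ?thesis by (simp only: not_False_eq_True)
      qed
    qed
  qed
  then have pos: "?w (x, t) = 0" if "t > 0" for x t
    using flat_epd_solution_eq_0[OF _ weq that] by blast
  show ?thesis
  proof
    fix p :: "(real ^ 'n) \<times> real"
    obtain x t where p: "p = (x, t)" by fastforce
    consider "t = 0" | "t > 0" | "- t > 0" by linarith
    then show "v p = u p"
    proof cases
      case 1
      then show ?thesis using init[OF u(1,3)] init[OF v(1,3)] by (simp add: p)
    next
      case 2
      then show ?thesis using pos[of t x] by (simp add: p)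
    next
      case 3
      then show ?thesis using pos[of "- t" x] u(2) v(2) by (simp add: p even_in_time_def)
    qed
  qed
qed

theorem theorem3p2:
  fixes \<alpha> :: complex and f :: "real ^ 'n \<Rightarrow> complex"
    and u :: "(real ^ 'n) \<times> real \<Rightarrow> complex"
  assumes "CARD('n) \<ge> 2"
    and "\<alpha> \<notin> exceptional TYPE('n)"
    and "smooth f"
    and u_def: "u = (\<lambda>(x, t). convolution f (m_dist \<alpha> t) x)"
  shows "smooth u \<and> even_in_time u \<and> solves_cauchy \<alpha> f u \<and>
         (\<forall>v. smooth v \<and> even_in_time v \<and> solves_cauchy \<alpha> f v \<longrightarrow> v = u)"
proof -
  have u: "u = epd_mean \<alpha> f"
    unfolding u_def using convolution_m_dist_eq_epd_mean[OF assms(3,2)] by auto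
  have ne: "nonexceptional CARD('n) \<alpha>" "nonexceptional DIM(real ^ 'n) \<alpha>"
    using assms(2) by (simp_all add: exceptional_iff)
  have "smooth u" "even_in_time u" "solves_cauchy \<alpha> f u"
    unfolding u even_in_time_def
    by (auto intro: smooth_epd_mean[OF ne(2) assms(3)] epd_mean_even[OF ne(2) assms(3)] epd_mean_solves[OF ne(1) assms(3)])
  then show ?thesis using epd_solution_unique[OF assms(2)] by blast
qed

end
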